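(* Let $X\subset\mathbb{P}^n$ be a fat point subscheme, and let $L\subset\mathbb{P}^n$ be a positive-dimensional linear subspace such that $\operatorname{Seg}(X)=\left\lceil\frac{w_L(X)-1}{\dim L}\right\rceil$. If the points of $\operatorname{Supp}X$ that are in $L$ lie on a rational normal curve of $L$, then $r(X)=\operatorname{Seg}(X)$.
   Context: $K$ is an arbitrary field, $n\ge 1$, $\mathbb{P}^n=\mathbb{P}^n_K$ with coordinate ring $R=K[x_0,\dots,x_n]$; points of $\mathbb{P}^n$ are represented by nonzero vectors of $K^{n+1}$. For a point $P$, $I_P\subset R$ is its homogeneous ideal. A fat point scheme $X=\sum_{i=1}^s m_iP_i$ is given by distinct points $P_1,\dots,P_s\in\mathbb{P}^n$ ($s\ge1$) and positive integers $m_1,\dots,m_s$; it is the zero-dimensional subscheme defined by $I_X=\bigcap_{i=1}^s I_{P_i}^{m_i}$, with $\deg X=\sum_{i=1}^s\binom{m_i+n-1}{n}$, and $\operatorname{Supp}X=\{P_1,\dots,P_s\}$. The regularity index $r(X)$ is the least integer $j$ such that $\dim_K[R/I_X]_j=\deg X$ (equality then holds for all larger degrees). For a linear subspace $L\subseteq\mathbb{P}^n$ the weight is $w_L(X)=\sum_{P_i\in L}m_i$. The Segre bound is $$\operatorname{Seg}(X)=\max\left\{\left\lceil\frac{w_L(X)-1}{\dim L}\right\rceil \;\Big|\; L\subseteq\mathbb{P}^n\text{ a linear subspace with }\dim L\ge1\right\}.$$ A rational normal curve of $L\cong\mathbb{P}^d$ is the image of the $d$-th Veronese embedding $\mathbb{P}^1\to\mathbb{P}^d$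 up to a linear change of coordinates of $L$ (for $\dim L=1$ it is $L$ itself). *)

theory Defs
  imports "HOL-Analysis.Analysis" "HOL-Library.Poly_Mapping"
begin

text \<open>
  The homogeneous coordinates of projective space are indexed by a finite type \<open>'v\<close> with
  \<open>n + 1\<close> elements, so \<open>K\<^sup>n\<^sup>+\<^sup>1\<close> is \<open>'a ^ 'v\<close> for a field \<open>'a\<close>. A point is represented by a
  nonzero vector, and a linear subspace of projective space by the linear subspace of
  \<open>'a ^ 'v\<close> lying over it. A polynomial is a finitely supported function from
  exponent vectors to coefficients, with the convolution product of \<open>Poly_Mapping\<close>.
\<close>

type_synonym ('v, 'a) polynomial = "('v \<Rightarrow>\<^sub>0 nat) \<Rightarrow>\<^sub>0 'a"

abbreviation poly_const :: "'a::field \<Rightarrow> ('v, 'a) polynomial" where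
  "poly_const c \<equiv> Poly_Mapping.single 0 c"

definition poly_eval :: "('v::finite, 'a::field) polynomial \<Rightarrow> 'a ^ 'v \<Rightarrow> 'a" where
  "poly_eval f x =
    (\<Sum>t\<in>Poly_Mapping.keys f. Poly_Mapping.lookup f t * (\<Prod>v\<in>UNIV. (x $ v) ^ Poly_Mapping.lookup t v))"

definition forms :: "nat \<Rightarrow> ('v::finite, 'a::field) polynomial set" where
  "forms j = {f. \<forall>t\<in>Poly_Mapping.keys f. (\<Sum>v\<in>UNIV. Poly_Mapping.lookup t v) = j}"

definition ideal_generated ::
  "('v::finite, 'a::field) polynomial set \<Rightarrow> ('v, 'a) polynomial set" where
  "ideal_generated S = module.span (*) S"

fun ideal_power ::
  "('v::finite, 'a::field) polynomial set \<Rightarrow> nat \<Rightarrow> ('v, 'a) polynomial set" where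
  "ideal_power I 0 = UNIV"
| "ideal_power I (Suc k) = ideal_generated {f * g |f g. f \<in> I \<and> g \<in> ideal_power I k}"

definition point_ideal :: "'a::field ^ 'v::finite \<Rightarrow> ('v, 'a) polynomial set" where
  "point_ideal P = ideal_generated {f. (\<exists>j. f \<in> forms j) \<and> poly_eval f P = 0}"

text \<open>
  \<open>B\<close> is a finite set of forms of degree \<open>j\<close> whose residue classes are a basis of the graded
  component \<open>[R/I]\<^sub>j\<close>. Independence modulo \<open>I\<close> makes these classes distinct, so the
  dimension of \<open>[R/I]\<^sub>j\<close> is the cardinality of any such \<open>B\<close>. Finite sets suffice because
  \<open>forms j\<close> is finite-dimensional.
\<close>

definition basis_of_component ::
  "('v::finite, 'a::field) polynomial set \<Rightarrow> nat \<Rightarrow> ('v, 'a) polynomial set \<Rightarrow> bool" where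
  "basis_of_component I j B \<longleftrightarrow>
     finite B \<and> B \<subseteq> forms j \<and>
     (\<forall>c. (\<Sum>b\<in>B. poly_const (c b) * b) \<in> I \<longrightarrow> (\<forall>b\<in>B. c b = 0)) \<and>
     (\<forall>f\<in>forms j. \<exists>c. f - (\<Sum>b\<in>B. poly_const (c b) * b) \<in> I)"

definition hilbert_function :: "('v::finite, 'a::field) polynomial set \<Rightarrow> nat \<Rightarrow> nat" where
  "hilbert_function I j = card (SOME B. basis_of_component I j B)"

text \<open>
  A fat point scheme \<open>m\<^sub>1 P\<^sub>1 + \<dots> + m\<^sub>s P\<^sub>s\<close> is given by representatives \<open>P i\<close> and multiplicities
  \<open>m i\<close>, of which only the values for \<open>i\<close> in \<open>{1..s}\<close> matter.
\<close>

definition fat_point_scheme ::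
  "nat \<Rightarrow> (nat \<Rightarrow> 'a::field ^ 'v::finite) \<Rightarrow> (nat \<Rightarrow> nat) \<Rightarrow> bool" where
  "fat_point_scheme s P m \<longleftrightarrow>
     s \<ge> 1 \<and> (\<forall>i\<in>{1..s}. P i \<noteq> 0 \<and> m i \<ge> 1) \<and>
     (\<forall>i\<in>{1..s}. \<forall>k\<in>{1..s}. i \<noteq> k \<longrightarrow> \<not> (\<exists>c. P i = c *s P k))"

definition fat_ideal ::
  "nat \<Rightarrow> (nat \<Rightarrow> 'a::field ^ 'v::finite) \<Rightarrow> (nat \<Rightarrow> nat) \<Rightarrow> ('v, 'a) polynomial set" where
  "fat_ideal s P m = (\<Inter>i\<in>{1..s}. ideal_power (point_ideal (P i)) (m i))"

definition fat_degree ::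
  "nat \<Rightarrow> (nat \<Rightarrow> 'a::field ^ 'v::finite) \<Rightarrow> (nat \<Rightarrow> nat) \<Rightarrow> nat" where
  "fat_degree s P m = (let n = CARD('v) - 1 in \<Sum>i=1..s. (m i + n - 1) choose n)"

definition regularity_index ::
  "nat \<Rightarrow> (nat \<Rightarrow> 'a::field ^ 'v::finite) \<Rightarrow> (nat \<Rightarrow> nat) \<Rightarrow> nat" where
  "regularity_index s P m =
     (LEAST j. hilbert_function (fat_ideal s P m) j = fat_degree s P m)"

definition proj_dim :: "('a::field ^ 'v::finite) set \<Rightarrow> int" where
  "proj_dim L = int (vec.dim L) - 1"

definition weight ::
  "nat \<Rightarrow> (nat \<Rightarrow> 'a::field ^ 'v::finite) \<Rightarrow> (nat \<Rightarrow> nat) \<Rightarrow> ('a ^ 'v) set \<Rightarrow> nat" where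
  "weight s P m L = (\<Sum>i\<in>{i \<in> {1..s}. P i \<in> L}. m i)"

definition segre_quotient ::
  "nat \<Rightarrow> (nat \<Rightarrow> 'a::field ^ 'v::finite) \<Rightarrow> (nat \<Rightarrow> nat) \<Rightarrow> ('a ^ 'v) set \<Rightarrow> int" where
  "segre_quotient s P m L = \<lceil>(real (weight s P m L) - 1) / real_of_int (proj_dim L)\<rceil>"

text \<open>The maximum is over a finite set: there are finitely many weights and dimensions.\<close>

definition segre_bound ::
  "nat \<Rightarrow> (nat \<Rightarrow> 'a::field ^ 'v::finite) \<Rightarrow> (nat \<Rightarrow> nat) \<Rightarrow> int" where
  "segre_bound s P m =
     Max {segre_quotient s P m L |L. vec.subspace L \<and> proj_dim L \<ge> 1}"

text \<open>
  The Veronese image of \<open>(a : b)\<close> in the coordinates of \<open>L\<close> given by a basis \<open>e 0, \<dots>, e d\<close> is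
  the point represented by \<open>\<Sum>i\<le>d. a\<^sup>d\<^sup>-\<^sup>i b\<^sup>i e i\<close>; \<open>C\<close> is the set of all representatives of
  \<open>K\<close>-rational points of the curve. Over any field these are the images of the \<open>K\<close>-rational
  points of the projective line, since the Veronese map is an isomorphism onto its image.
\<close>

definition rational_normal_curve ::
  "('a::field ^ 'v::finite) set \<Rightarrow> ('a ^ 'v) set \<Rightarrow> bool" where
  "rational_normal_curve L C \<longleftrightarrow>
     (\<exists>d e. d \<ge> (1::nat) \<and> proj_dim L = int d \<and>
        inj_on e {..d} \<and> vec.independent (e ` {..d}) \<and> vec.span (e ` {..d}) = L \<and>
        C = {k *s (\<Sum>i\<le>d. (a ^ (d - i) * b ^ i) *s e i) |k a b. k \<noteq> 0 \<and> (a, b) \<noteq> (0, 0)})"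

end

theory Submission
  imports Defs "HOL-Library.Function_Algebras" "HOL-Computational_Algebra.Polynomial"
begin

text \<open>
  Let \<open>X = m\<^sub>1 P\<^sub>1 + \<dots> + m\<^sub>s P\<^sub>s\<close>, let \<open>I\<^sub>i\<close> be the ideal of \<open>P\<^sub>i\<close>, and let \<open>R\<^sub>j\<close> be the space of forms of
  degree \<open>j\<close>. The quotient of \<open>R\<^sub>j\<close> by the \<open>m\<^sub>i\<close>-th power of \<open>I\<^sub>i\<close> has the dimension of
  the \<open>i\<close>-th summand of \<open>deg X\<close> for \<open>j \<ge> m\<^sub>i - 1\<close> and a smaller one otherwise (\<open>local_basis\<close>). So the
  Hilbert function of \<open>X\<close> equals \<open>deg X\<close> in degree \<open>j\<close> if and only if \<open>j \<ge> m\<^sub>i - 1\<close> for all \<open>i\<close>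
  and arbitrary congruences modulo these powers can be solved simultaneously by a form of degree \<open>j\<close>
  (\<open>hilbert_function_if_congruences\<close>, \<open>congruences_if_hilbert_function\<close>). The theorem says
  that this is the case for \<open>j = Seg(X)\<close> but for no smaller \<open>j\<close>.

  In degree \<open>b = Seg(X)\<close> the congruences are solved by raising the multiplicities one by one
  (\<open>simultaneous_congruences\<close>). To raise the multiplicity of \<open>P\<close> from \<open>c\<close> to \<open>c + 1\<close>, each form \<open>G\<close> of
  degree \<open>b\<close> and order \<open>c\<close> at \<open>P\<close> has to be changed, without changing its leading term at \<open>P\<close>, into
  a form vanishing on the multiset \<open>E\<close> of the other points (\<open>lift_layer\<close>). Projected from \<open>P\<close>,
  the bound on the weights reads \<open>|Y| + c \<le> b r(Y)\<close> for each nonempty part \<open>Y\<close> of \<open>E\<close>, where \<open>r\<close> is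
  the rank. For each direction \<open>v\<close> at \<open>P\<close> there is a hyperplane through \<open>P\<close>, but not through \<open>v\<close>, such
  that the points of \<open>E\<close> left over when it has taken away its share satisfy the bound for \<open>b - 1\<close> and
  \<open>c - 1\<close>. The hyperplanes obtained for all \<open>v\<close> span the linear forms through \<open>P\<close>, and \<open>G\<close> is a
  combination of products of such a form with a form of order \<open>c - 1\<close>; induction on the degree
  supplies the cofactors. Once \<open>c = 0\<close>, hyperplanes missing \<open>P\<close> are used instead.

  That a hyperplane can always take away enough (\<open>extract_hyperplane\<close>) is a matroid
  union theorem: the points must be split into a set that is independent modulo \<open>v\<close> and a
  set satisfying a count of the form \<open>|Y| \<le> (b - 1) r(Y) - (c - 1)\<close>. The right-hand side is
  submodular for intersecting sets only, because it should be zero and not \<open>1 - c\<close> on the empty set,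
  so costs of partitions take its place in the argument
  (\<open>two_colouring\<close>, \<open>extract_layer\<close>).

  For the lower bound let \<open>d = dim L\<close>. If the congruences could be solved in degree \<open>j\<close> with
  \<open>j d < w\<^sub>L(X) - 1\<close>, there would be a form that vanishes to order at least \<open>m\<^sub>k\<close> at each
  point except one point \<open>P\<^sub>i\<close> on the curve, where its restriction has order exactly \<open>m\<^sub>i - 1\<close>. Its restriction to the
  rational normal curve is a nonzero binary form of degree \<open>j d\<close> with at least \<open>w\<^sub>L(X) - 1\<close> zeros
  (\<open>hilbert_function_below_curve_bound\<close>).
\<close>

section \<open>A matroid union theorem\<close>

text \<open>
  If \<open>h\<close> is only submodular on intersecting pairs, the minimum of \<open>\<Sum>i. h (T i)\<close> over the
  partitions \<open>T\<close> of \<open>X\<close> is a submodular function of \<open>X\<close> (Dilworth truncation).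
  The relation \<open>partition_cost h X k\<close> says that \<open>k\<close> is the cost of some partition; working with all
  costs avoids the minimum.
\<close>

inductive partition_cost :: "('e set \<Rightarrow> int) \<Rightarrow> 'e set \<Rightarrow> int \<Rightarrow> bool" for h where
  empty: "partition_cost h {} 0"
| block: "partition_cost h X k \<Longrightarrow> T \<noteq> {} \<Longrightarrow> X \<inter> T = {} \<Longrightarrow> partition_cost h (X \<union> T) (k + h T)"

lemma partition_cost_single: "T \<noteq> {} \<Longrightarrow> partition_cost h T (h T)"
  using partition_cost.block[OF partition_cost.empty, of T h] by simp

lemma partition_cost_disjoint_union:
  assumes "partition_cost h Y l" "partition_cost h X k" "X \<inter> Y = {}"
  shows "partition_cost h (X \<union> Y) (k + l)"
  using assms
proof (induction rule: partition_cost.induct)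
  case empty
  then show ?case by simp
next
  case (block Y l T)
  then have "partition_cost h (X \<union> Y) (k + l)" by blast
  then have "partition_cost h (X \<union> Y \<union> T) (k + l + h T)"
    using block by (intro partition_cost.block) auto
  then show ?case by (simp add: Un_assoc add.assoc)
qed

text \<open>
  The block \<open>T\<close> swallows one after the other the blocks of the partition that it meets. Each time
  intersecting submodularity pays for the swallowed block by its trace on \<open>T\<close>, and the traces
  partition \<open>X \<inter> T\<close>.
\<close>

lemma partition_cost_uncross_block:
  fixes h :: "'e set \<Rightarrow> int"
  assumes sub: "\<And>S T. S \<inter> T \<noteq> {} \<Longrightarrow> h (S \<union> T) + h (S \<inter> T) \<le> h S + h T"
    and "partition_cost h X k" "T \<noteq> {}"
  shows "\<exists>k1 k2. partition_cost h (X \<union> T) k1 \<and> partition_cost h (X \<inter> T) k2 \<and> k1 + k2 \<le> k + h T"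
  using assms(2,3)
proof (induction arbitrary: T rule: partition_cost.induct)
  case empty
  then show ?case
    using partition_cost_single[of T h] partition_cost.empty[of h]
    by (intro exI[of _ "h T"] exI[of _ 0]) simp
next
  case (block X k S)
  show ?case
  proof (cases "S \<inter> T = {}")
    case True
    obtain k1 k2 where k: "partition_cost h (X \<union> T) k1" "partition_cost h (X \<inter> T) k2" "k1 + k2 \<le> k + h T"
      using block.IH[OF block.prems] by blast
    have "partition_cost h (X \<union> T \<union> S) (k1 + h S)"
      using k(1) block.hyps True by (intro partition_cost.block) auto
    moreover have "X \<union> T \<union> S = X \<union> S \<union> T" "(X \<union> S) \<inter> T = X \<inter> T" using True by auto
    ultimately show ?thesis using k by (intro exI[of _ "k1 + h S"] exI[of _ k2]) auto
  next
    case False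
    obtain k1 k2 where k: "partition_cost h (X \<union> (S \<union> T)) k1" "partition_cost h (X \<inter> (S \<union> T)) k2"
      "k1 + k2 \<le> k + h (S \<union> T)"
      using block.IH[of "S \<union> T"] block.prems by blast
    have "partition_cost h (X \<inter> (S \<union> T) \<union> (S \<inter> T)) (k2 + h (S \<inter> T))"
      using k(2) block.hyps False by (intro partition_cost.block) auto
    moreover have "X \<inter> (S \<union> T) \<union> (S \<inter> T) = (X \<union> S) \<inter> T" using block.hyps by auto
    moreover have "X \<union> (S \<union> T) = X \<union> S \<union> T" by auto
    ultimately show ?thesis using k sub[OF False]
      by (intro exI[of _ k1] exI[of _ "k2 + h (S \<inter> T)"]) auto
  qed
qed

lemma partition_cost_uncross:
  fixes h :: "'e set \<Rightarrow> int"
  assumes sub: "\<And>S T. S \<inter> T \<noteq> {} \<Longrightarrow> h (S \<union> T) + h (S \<inter> T) \<le> h S + h T"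
    and "partition_cost h Y l" "partition_cost h X k"
  shows "\<exists>k1 k2. partition_cost h (X \<union> Y) k1 \<and> partition_cost h (X \<inter> Y) k2 \<and> k1 + k2 \<le> k + l"
  using assms(2,3)
proof (induction rule: partition_cost.induct)
  case empty
  then show ?case using partition_cost.empty[of h] by (intro exI[of _ k] exI[of _ 0]) simp
next
  case (block Y l T)
  obtain k1 k2 where k: "partition_cost h (X \<union> Y) k1" "partition_cost h (X \<inter> Y) k2" "k1 + k2 \<le> k + l"
    using block.IH block.prems by blast
  obtain j1 j2 where j: "partition_cost h (X \<union> Y \<union> T) j1" "partition_cost h ((X \<union> Y) \<inter> T) j2"
    "j1 + j2 \<le> k1 + h T"
    using partition_cost_uncross_block[OF sub k(1) \<open>T \<noteq> {}\<close>] by blast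
  have "partition_cost h (X \<inter> Y \<union> (X \<union> Y) \<inter> T) (k2 + j2)"
    using block.hyps by (intro partition_cost_disjoint_union j k) auto
  moreover have "X \<inter> Y \<union> (X \<union> Y) \<inter> T = X \<inter> (Y \<union> T)" using block.hyps by auto
  moreover have "X \<union> Y \<union> T = X \<union> (Y \<union> T)" by auto
  ultimately show ?case using k j
    by (intro exI[of _ j1] exI[of _ "k2 + j2"]) auto
qed

text \<open>
  A matroid union theorem for a submodular \<open>f\<close> and the truncation of \<open>h\<close>. Each element starts
  with both colours allowed. If neither colour of \<open>e\<close> could be withdrawn, there would be violated
  sets \<open>X\<close> and \<open>Y\<close>, one for each colour; after uncrossing, the bounds for \<open>X \<union> Y\<close> and
  \<open>X \<inter> Y - {e}\<close> exclude this.
\<close>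

lemma two_colouring:
  fixes f h :: "'e set \<Rightarrow> int"
  assumes fin: "finite E"
    and f_sub: "\<And>S T. f (S \<union> T) + f (S \<inter> T) \<le> f S + f T"
    and f_empty: "f {} = 0"
    and h_sub: "\<And>S T. S \<inter> T \<noteq> {} \<Longrightarrow> h (S \<union> T) + h (S \<inter> T) \<le> h S + h T"
    and bound: "\<And>X k. X \<subseteq> E \<Longrightarrow> partition_cost h X k \<Longrightarrow> int (card X) \<le> f X + k"
  shows "\<exists>A\<subseteq>E. (\<forall>X\<subseteq>A. int (card X) \<le> f X) \<and>
    (\<forall>X\<subseteq>E - A. X \<noteq> {} \<longrightarrow> int (card X) \<le> h X)"
proof -
  define valid where "valid T1 T2 \<longleftrightarrow> T1 \<union> T2 = E \<and>
    (\<forall>X\<subseteq>E. \<forall>k. partition_cost h (X \<inter> T2) k \<longrightarrow> int (card X) \<le> f (X \<inter> T1) + k)" for T1 T2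
  have shrink: "\<exists>S1 S2. valid S1 S2 \<and> S1 \<inter> S2 = {}" if "valid T1 T2" for T1 T2
    using that
  proof (induction "card (T1 \<inter> T2)" arbitrary: T1 T2 rule: less_induct)
    case less
    show ?case
    proof (cases "T1 \<inter> T2 = {}")
      case True
      with less.prems show ?thesis by blast
    next
      case False
      then obtain e where e: "e \<in> T1" "e \<in> T2" by blast
      have TE: "T1 \<union> T2 = E" using less.prems by (simp add: valid_def)
      have valid_bound: "int (card X) \<le> f (X \<inter> T1) + k"
        if "X \<subseteq> E" "partition_cost h (X \<inter> T2) k" for X k
        using less.prems that unfolding valid_def by blast
      from TE have finT: "finite (T1 \<inter> T2)" using fin by (meson finite_Int finite_Un)
      have "valid (T1 - {e}) T2 \<or> valid T1 (T2 - {e})"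
      proof (rule ccontr)
        assume neg: "\<not> ?thesis"
        have "(T1 - {e}) \<union> T2 = E" "T1 \<union> (T2 - {e}) = E" using TE e by auto
        moreover from neg have "\<not> valid (T1 - {e}) T2" "\<not> valid T1 (T2 - {e})" by simp_all
        ultimately have
          "\<exists>X k. X \<subseteq> E \<and> partition_cost h (X \<inter> T2) k \<and> \<not> int (card X) \<le> f (X \<inter> (T1 - {e})) + k"
          "\<exists>Y l. Y \<subseteq> E \<and> partition_cost h (Y \<inter> (T2 - {e})) l \<and> \<not> int (card Y) \<le> f (Y \<inter> T1) + l"
          unfolding valid_def by simp_all
        then obtain X k Y l where
          X: "X \<subseteq> E" "partition_cost h (X \<inter> T2) k" "int (card X) > f (X \<inter> (T1 - {e})) + k" and
          Y: "Y \<subseteq> E" "partition_cost h (Y \<inter> (T2 - {e})) l" "int (card Y) > f (Y \<inter> T1) + l"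
          unfolding not_le by blast
        have eX: "e \<in> X"
        proof (rule ccontr)
          assume "e \<notin> X"
          then have "X \<inter> (T1 - {e}) = X \<inter> T1" by auto
          then show False using valid_bound[OF X(1,2)] X(3) by simp
        qed
        have eY: "e \<in> Y"
        proof (rule ccontr)
          assume "e \<notin> Y"
          then have "Y \<inter> (T2 - {e}) = Y \<inter> T2" by auto
          then show False using valid_bound[of Y l] Y by simp
        qed
        obtain k1 k2 where k: "partition_cost h (X \<inter> T2 \<union> Y \<inter> (T2 - {e})) k1"
          "partition_cost h (X \<inter> T2 \<inter> (Y \<inter> (T2 - {e}))) k2" "k1 + k2 \<le> k + l"
          using partition_cost_uncross[OF h_sub Y(2) X(2)] by blast
        have s1: "X \<inter> T2 \<union> Y \<inter> (T2 - {e}) = (X \<union> Y) \<inter> T2" using eX by auto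
        have s2: "X \<inter> T2 \<inter> (Y \<inter> (T2 - {e})) = (X \<inter> Y - {e}) \<inter> T2" by auto
        have s3: "X \<inter> (T1 - {e}) \<union> Y \<inter> T1 = (X \<union> Y) \<inter> T1" using eY by auto
        have s4: "X \<inter> (T1 - {e}) \<inter> (Y \<inter> T1) = (X \<inter> Y - {e}) \<inter> T1" by auto
        have f': "f ((X \<union> Y) \<inter> T1) + f ((X \<inter> Y - {e}) \<inter> T1) \<le> f (X \<inter> (T1 - {e})) + f (Y \<inter> T1)"
          using f_sub[of "X \<inter> (T1 - {e})" "Y \<inter> T1"] by (simp only: s3 s4)
        have u: "int (card (X \<union> Y)) \<le> f ((X \<union> Y) \<inter> T1) + k1"
          using valid_bound[of "X \<union> Y"] k(1) X(1) Y(1) unfolding s1 by simp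
        have i: "int (card (X \<inter> Y - {e})) \<le> f ((X \<inter> Y - {e}) \<inter> T1) + k2"
          using valid_bound[of "X \<inter> Y - {e}"] k(2) X(1) unfolding s2 by blast
        have fXY: "finite X" "finite Y" using X(1) Y(1) fin finite_subset by blast+
        then have "card X + card Y = card (X \<union> Y) + card (X \<inter> Y)" by (rule card_Un_Int)
        moreover have "card (X \<inter> Y) = card (X \<inter> Y - {e}) + 1"
          using fXY eX eY by (metis IntI Suc_eq_plus1 card_Suc_Diff1 finite_Int)
        ultimately show False using f' u i k(3) X(3) Y(3) by linarith
      qed
      moreover have "(T1 - {e}) \<inter> T2 \<subset> T1 \<inter> T2" "T1 \<inter> (T2 - {e}) \<subset> T1 \<inter> T2" using e by auto
      then have "card ((T1 - {e}) \<inter> T2) < card (T1 \<inter> T2)" "card (T1 \<inter> (T2 - {e})) < card (T1 \<inter> T2)"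
        using finT psubset_card_mono by blast+
      ultimately show ?thesis using less.hyps by blast
    qed
  qed
  have "valid E E"
    unfolding valid_def using bound by (auto simp: Int_absorb2)
  then obtain A B where AB: "valid A B" "A \<inter> B = {}" using shrink by blast
  have AB': "A \<subseteq> E" "B = E - A" using AB unfolding valid_def by auto
  have "int (card X) \<le> f X" if "X \<subseteq> A" for X
  proof -
    have "X \<inter> B = {}" "X \<inter> A = X" "X \<subseteq> E" using that AB AB' by auto
    moreover have "int (card X) \<le> f (X \<inter> A) + 0"
      using AB(1) \<open>X \<subseteq> E\<close> \<open>X \<inter> B = {}\<close> partition_cost.empty[of h] unfolding valid_def by metis
    ultimately show ?thesis by simp
  qed
  moreover have "int (card X) \<le> h X" if "X \<subseteq> E - A" "X \<noteq> {}" for X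
  proof -
    have "X \<inter> B = X" "X \<inter> A = {}" "X \<subseteq> E" using that AB' by auto
    moreover have "int (card X) \<le> f (X \<inter> A) + h X"
      using AB(1) \<open>X \<subseteq> E\<close> \<open>X \<inter> B = X\<close> partition_cost_single[OF that(2), of h]
      unfolding valid_def by metis
    ultimately show ?thesis using f_empty by simp
  qed
  ultimately show ?thesis using AB'(1) by blast
qed

text \<open>
  For \<open>\<epsilon> = 1\<close> a partition of \<open>X\<close> into \<open>t\<close> blocks with ranks adding up to \<open>R\<close> costs
  \<open>k = (b - 1) R - (c - 1) t\<close>. The blocks give \<open>|X| \<le> b R - c t = k + R - t\<close>, and \<open>X\<close> itself gives
  \<open>|X| \<le> b r - c\<close> with \<open>r = r X\<close>. If \<open>R - t \<le> r - 1\<close> the first bound is at most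
  \<open>k + r - 1\<close>; otherwise \<open>R - r \<ge> t\<close>, and then the second one is, because \<open>c \<le> b\<close>.
  So the hypothesis of the two-colour theorem holds whatever the partition is. For \<open>\<epsilon> = 0\<close>, where
  \<open>c = 0\<close>, it is enough that \<open>r\<close> is subadditive.
\<close>

lemma extract_layer:
  fixes r f :: "'e set \<Rightarrow> int" and b c \<epsilon> :: int
  assumes fin: "finite E"
    and r_sub: "\<And>S T. r (S \<union> T) + r (S \<inter> T) \<le> r S + r T"
    and f_sub: "\<And>S T. f (S \<union> T) + f (S \<inter> T) \<le> f S + f T"
    and f_empty: "f {} = 0"
    and f_ge: "\<And>X. r X - \<epsilon> \<le> f X"
    and \<epsilon>: "\<epsilon> = 0 \<and> c = 0 \<or> \<epsilon> = 1 \<and> 1 \<le> c"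
    and bc: "1 \<le> b" "c \<le> b"
    and r_empty: "r {} = 0"
    and bound: "\<And>X. X \<subseteq> E \<Longrightarrow> X \<noteq> {} \<Longrightarrow> int (card X) + c \<le> b * r X"
  shows "\<exists>A\<subseteq>E. (\<forall>X\<subseteq>A. int (card X) \<le> f X) \<and>
    (\<forall>X\<subseteq>E - A. X \<noteq> {} \<longrightarrow> int (card X) + (c - \<epsilon>) \<le> (b - 1) * r X)"
proof -
  define h where "h X = (b - 1) * r X - (c - \<epsilon>)" for X
  have h_sub: "h (S \<union> T) + h (S \<inter> T) \<le> h S + h T" for S T
    using mult_left_mono[OF r_sub[of S T], of "b - 1"] bc by (simp add: h_def algebra_simps)
  have cost: "\<exists>R t. k = (b - 1) * R - (c - \<epsilon>) * t \<and> r X \<le> R \<and> 0 \<le> t \<and> (X \<noteq> {} \<longrightarrow> 1 \<le> t) \<and>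
      int (card X) \<le> b * R - c * t"
    if "partition_cost h X k" "X \<subseteq> E" for X k
    using that
  proof (induction rule: partition_cost.induct)
    case empty
    then show ?case by (intro exI[of _ 0]) (simp add: r_empty)
  next
    case (block X k T)
    then obtain R t where Rt: "k = (b - 1) * R - (c - \<epsilon>) * t" "r X \<le> R" "0 \<le> t"
      "int (card X) \<le> b * R - c * t" by auto
    have "r (X \<union> T) \<le> R + r T" using r_sub[of X T] block.hyps Rt(2) r_empty by simp
    moreover have "int (card (X \<union> T)) = int (card X) + int (card T)"
      using block.hyps block.prems fin by (simp add: card_Un_disjoint finite_subset[OF _ fin])
    moreover have "int (card T) + c \<le> b * r T" using block bound by auto
    ultimately show ?case using Rt
      by (intro exI[of _ "R + r T"] exI[of _ "t + 1"]) (auto simp: h_def algebra_simps)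
  qed
  have "int (card X) \<le> f X + k" if X: "X \<subseteq> E" "partition_cost h X k" for X k
  proof (cases "X = {}")
    case True
    with X(2) have "k = 0" by cases auto
    then show ?thesis using True f_empty by simp
  next
    case False
    obtain R t where Rt: "k = (b - 1) * R - (c - \<epsilon>) * t" "r X \<le> R" "1 \<le> t"
      "int (card X) \<le> b * R - c * t" using cost[OF X(2,1)] False by auto
    have bX: "int (card X) + c \<le> b * r X" using bound X False by blast
    show ?thesis
    proof (cases "R - \<epsilon> * t \<le> r X - \<epsilon>")
      case True
      have "int (card X) \<le> k + (R - \<epsilon> * t)" using Rt(1,4) by (simp add: algebra_simps)
      then show ?thesis using True f_ge[of X] by linarith
    next
      case False
      have "(c - \<epsilon>) * (t - 1) \<le> (b - 1) * (R - r X)"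
      proof (cases "\<epsilon> = 0")
        case True
        then show ?thesis using \<epsilon> bc Rt by auto
      next
        case False
        then have "\<epsilon> = 1" using \<epsilon> by auto
        then show ?thesis using bc \<epsilon> Rt \<open>\<not> R - \<epsilon> * t \<le> r X - \<epsilon>\<close> by (intro mult_mono) auto
      qed
      then have "b * r X - c \<le> k + (r X - \<epsilon>)" unfolding Rt(1) by (simp add: algebra_simps)
      then show ?thesis using bX f_ge[of X] by linarith
    qed
  qed
  then have "\<exists>A\<subseteq>E. (\<forall>X\<subseteq>A. int (card X) \<le> f X) \<and> (\<forall>X\<subseteq>E - A. X \<noteq> {} \<longrightarrow> int (card X) \<le> h X)"
    by (intro two_colouring fin f_sub f_empty h_sub)
  moreover have "int (card X) \<le> h X \<longleftrightarrow> int (card X) + (c - \<epsilon>) \<le> (b - 1) * r X" for X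
    by (auto simp: h_def)
  ultimately show ?thesis by simp
qed

section \<open>Separating points by linear forms\<close>

definition pairing :: "'a::field ^ 'v::finite \<Rightarrow> 'a ^ 'v \<Rightarrow> 'a" where
  "pairing l x = (\<Sum>u\<in>UNIV. l $ u * x $ u)"

lemma pairing_commute: "pairing l x = pairing x l"
  unfolding pairing_def by (simp only: mult.commute)

lemma pairing_add: "pairing (k + l) x = pairing k x + pairing l x"
  by (simp add: pairing_def distrib_right sum.distrib)

lemma pairing_scale: "pairing (c *s l) x = c * pairing l x"
  by (simp add: pairing_def sum_distrib_left mult.assoc)

text \<open>
  This is the only source of hyperplanes in the development. Over an arbitrary field a general
  hyperplane through given points need not exist, so each hyperplane is chosen to miss one vector.
\<close>

lemma exists_separating_form:
  fixes w :: "'a::field ^ 'v::finite"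
  assumes "w \<notin> vec.span S"
  shows "\<exists>l. (\<forall>x\<in>S. pairing l x = 0) \<and> pairing l w = 1"
proof -
  obtain B where B: "B \<subseteq> vec.span S" "vec.independent B" "vec.span S \<subseteq> vec.span B"
    by (rule vec.basis_exists[of "vec.span S"])
  have "vec.span B = vec.span S" using B(3) vec.span_minimal[OF B(1) vec.subspace_span] by simp
  then have "w \<notin> vec.span B" using assms by simp
  then have "vec.independent (insert w B)" "w \<notin> B"
    using B(2) by (simp_all add: vec.independent_insert) (use vec.span_base in blast)
  interpret ff: vector_space_pair "(*s) :: 'a \<Rightarrow> 'a^'v \<Rightarrow> 'a^'v" "(*) :: 'a \<Rightarrow> 'a \<Rightarrow> 'a"
    by unfold_locales
  obtain g where g: "Vector_Spaces.linear (*s) (*) g"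
    "\<And>x. x \<in> insert w B \<Longrightarrow> g x = (if x = w then 1 else 0)"
    using ff.linear_independent_extend[OF \<open>vec.independent (insert w B)\<close>, of "\<lambda>x. if x = w then 1 else 0"]
    by blast
  interpret g: Vector_Spaces.linear "(*s)" "(*)" g by (rule g(1))
  define l :: "'a^'v" where "l = (\<chi> u. g (axis u 1))"
  have gl: "g x = pairing l x" for x
  proof -
    have "x = (\<Sum>u\<in>UNIV. x $ u *s axis u 1)" by (simp add: basis_expansion)
    then have "g x = g (\<Sum>u\<in>UNIV. x $ u *s axis u 1)" by simp
    also have "\<dots> = (\<Sum>u\<in>UNIV. x $ u * g (axis u 1))"
      by (simp only: g.sum g.scale)
    finally show ?thesis by (simp add: pairing_def l_def mult.commute)
  qed
  have "g x = 0" if "x \<in> vec.span B" for x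
    using that
  proof (induction rule: vec.span_induct_alt)
    case base
    then show ?case by (simp add: g.zero)
  next
    case (step c x y)
    then show ?case using g(2)[of x] \<open>w \<notin> B\<close> by (auto simp: g.add g.scale)
  qed
  then have "pairing l x = 0" if "x \<in> S" for x
    using that \<open>vec.span B = vec.span S\<close> gl vec.span_base by metis
  moreover have "pairing l w = 1" using g(2)[of w] gl by simp
  ultimately show ?thesis by blast
qed

text \<open>
  A proper subspace of the space of linear forms vanishing at \<open>P\<close> would itself vanish at some \<open>v\<close>
  outside the line of \<open>P\<close>. Hence a family that avoids each such \<open>v\<close> at least once spans.
\<close>

lemma forms_span_annihilator:
  fixes P :: "'a::field ^ 'v::finite"
  assumes "\<And>v. v \<notin> vec.span {P} \<Longrightarrow> \<exists>l\<in>\<Gamma>. pairing l P = 0 \<and> pairing l v \<noteq> 0"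
    and "pairing k P = 0"
  shows "k \<in> vec.span {l\<in>\<Gamma>. pairing l P = 0}"
proof (rule ccontr)
  assume "\<not> ?thesis"
  from exists_separating_form[OF this] obtain v where
    v: "\<And>l. l \<in> \<Gamma> \<Longrightarrow> pairing l P = 0 \<Longrightarrow> pairing l v = 0" "pairing k v = 1"
    by (metis (mono_tags, lifting) mem_Collect_eq pairing_commute)
  have "v \<notin> vec.span {P}"
  proof
    assume "v \<in> vec.span {P}"
    then obtain a where "v = a *s P" by (auto simp: vec.span_singleton)
    then have "pairing k v = a * pairing k P" by (metis pairing_commute pairing_scale)
    then show False using v(2) assms(2) by simp
  qed
  then show False using assms(1) v(1) by blast
qed

lemma dim_submodular:
  fixes S T :: "('a::field ^ 'v::finite) set"
  shows "vec.dim (S \<union> T) + vec.dim (S \<inter> T) \<le> vec.dim S + vec.dim T"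
proof -
  have "vec.dim {x + y |x y. x \<in> vec.span S \<and> y \<in> vec.span T} + vec.dim (vec.span S \<inter> vec.span T)
      = vec.dim (vec.span S) + vec.dim (vec.span T)"
    by (intro vec.dim_sums_Int) auto
  moreover have "{x + y |x y. x \<in> vec.span S \<and> y \<in> vec.span T} = vec.span (S \<union> T)"
    by (auto simp: vec.span_Un)
  moreover have "vec.dim (S \<inter> T) \<le> vec.dim (vec.span S \<inter> vec.span T)"
    by (intro vec.dim_subset) (auto intro: vec.span_base)
  ultimately show ?thesis by simp
qed

lemma dim_insert_le: "vec.dim (insert x S) \<le> vec.dim S + 1"
  by (simp add: vec.dim_insert)


text \<open>
  Here \<open>dim (insert P (pt ` X)) - 1\<close> is the rank of the points of \<open>X\<close> after projection from \<open>P\<close>.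
  For \<open>c = 0\<close> the hyperplane \<open>l = 0\<close> avoids \<open>P\<close>. For \<open>c \<ge> 1\<close> it contains \<open>P\<close> and avoids a
  prescribed further vector \<open>w\<close>. The points of the layer \<open>A\<close> are independent modulo \<open>G\<close> and \<open>w\<close>,
  which is what makes such a hyperplane through \<open>A\<close> exist; the remaining points satisfy the
  hypothesis with \<open>b\<close> for \<open>b + 1\<close> and, for \<open>c \<ge> 1\<close>, with \<open>c - 1\<close> for \<open>c\<close>.
\<close>

lemma extract_hyperplane:
  fixes pt :: "'e \<Rightarrow> 'a::field ^ 'v::finite"
  assumes fin: "finite E" and P: "P \<noteq> 0"
    and pt: "\<And>x. x \<in> E \<Longrightarrow> pt x \<notin> vec.span {P}"
    and bound: "\<And>X. X \<subseteq> E \<Longrightarrow> X \<noteq> {} \<Longrightarrow> card X + c \<le> Suc b * (vec.dim (insert P (pt ` X)) - 1)"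
    and E: "E \<noteq> {}"
    and G: "G = {} \<and> w = P \<and> c = 0 \<or> G = {P} \<and> w \<notin> vec.span {P} \<and> 1 \<le> c"
  shows "\<exists>A l. A \<subseteq> E \<and> inj_on pt A \<and> (\<forall>x\<in>G \<union> pt ` A. pairing l x = 0) \<and> pairing l w = 1 \<and>
    (\<forall>X\<subseteq>E - A. X \<noteq> {} \<longrightarrow> card X + (c - card G) \<le> b * (vec.dim (insert P (pt ` X)) - 1))"
proof -
  define r where "r X = int (vec.dim (insert P (pt ` X))) - 1" for X
  define f where "f X = int (vec.dim (insert w (G \<union> pt ` X))) - int (vec.dim (insert w G))" for X
  have dimP: "vec.dim {P} = 1" using P by (simp add: vec.dim_insert vec.span_empty)
  have dim1: "1 \<le> vec.dim (insert P S)" for S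
    using vec.dim_subset[of "{P}" "insert P S"] dimP by simp
  have dimG: "vec.dim (insert w G) = card G + 1"
    using G dimP P by (auto simp: vec.dim_insert)
  have r_sub: "r (S \<union> T) + r (S \<inter> T) \<le> r S + r T" for S T
  proof -
    have "vec.dim (insert P (pt ` (S \<inter> T))) \<le> vec.dim (insert P (pt ` S) \<inter> insert P (pt ` T))"
      by (intro vec.dim_subset) auto
    then show ?thesis
      using dim_submodular[of "insert P (pt ` S)" "insert P (pt ` T)"]
      by (simp add: r_def image_Un)
  qed
  have f_sub: "f (S \<union> T) + f (S \<inter> T) \<le> f S + f T" for S T
  proof -
    let ?D = "\<lambda>S. insert w (G \<union> pt ` S)"
    have "vec.dim (?D (S \<inter> T)) \<le> vec.dim (?D S \<inter> ?D T)" by (intro vec.dim_subset) auto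
    moreover have "?D (S \<union> T) = ?D S \<union> ?D T" by auto
    ultimately show ?thesis
      using dim_submodular[of "?D S" "?D T"] by (simp add: f_def)
  qed
  have f_ge: "r X - int (card G) \<le> f X" for X
  proof -
    have "vec.dim (insert P (pt ` X)) \<le> vec.dim (insert w (G \<union> pt ` X))"
      using G by (intro vec.dim_subset) auto
    then show ?thesis using dimG by (simp add: r_def f_def)
  qed
  have r_nat: "int (vec.dim (insert P (pt ` X)) - 1) = r X" for X
    using dim1[of "pt ` X"] by (simp add: r_def of_nat_diff)
  have bound': "int (card X) + int c \<le> (int b + 1) * r X" if "X \<subseteq> E" "X \<noteq> {}" for X
    using bound[OF that] unfolding r_nat[symmetric] by (metis of_nat_Suc of_nat_add of_nat_le_iff of_nat_mult add.commute)
  obtain x where x: "x \<in> E" using E by blast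
  have "vec.dim {P, pt x} = 2"
  proof -
    have "vec.dim {pt x, P} = 2" using pt[OF x] dimP by (simp add: vec.dim_insert)
    then show ?thesis by (simp add: insert_commute)
  qed
  then have cb: "c \<le> b" using bound[of "{x}"] x by simp
  have "\<exists>A\<subseteq>E. (\<forall>X\<subseteq>A. int (card X) \<le> f X) \<and>
    (\<forall>X\<subseteq>E - A. X \<noteq> {} \<longrightarrow> int (card X) + (int c - int (card G)) \<le> (int b + 1 - 1) * r X)"
  proof (rule extract_layer[OF fin r_sub f_sub _ f_ge])
    show "f {} = 0" by (simp add: f_def)
    show "int (card G) = 0 \<and> int c = 0 \<or> int (card G) = 1 \<and> 1 \<le> int c" using G by auto
    show "r {} = 0" using dimP by (simp add: r_def)
  qed (use cb bound' in auto)
  then obtain A where A: "A \<subseteq> E" "\<And>X. X \<subseteq> A \<Longrightarrow> int (card X) \<le> f X"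
    "\<And>X. X \<subseteq> E - A \<Longrightarrow> X \<noteq> {} \<Longrightarrow> int (card X) + (int c - int (card G)) \<le> int b * r X"
    by auto
  have finA: "finite A" using A(1) fin finite_subset by blast
  have inj: "inj_on pt A"
  proof (rule inj_onI, rule ccontr)
    fix x y assume xy: "x \<in> A" "y \<in> A" "pt x = pt y" "x \<noteq> y"
    have "2 \<le> f {x, y}" using A(2)[of "{x, y}"] xy by simp
    moreover have "insert w (G \<union> pt ` {x, y}) = insert (pt x) (insert w G)" using xy by auto
    ultimately show False using dim_insert_le[of "pt x" "insert w G"] by (simp add: f_def)
  qed
  have "w \<notin> vec.span (G \<union> pt ` A)"
  proof
    assume "w \<in> vec.span (G \<union> pt ` A)"
    then have "vec.dim (insert w (G \<union> pt ` A)) = vec.dim (G \<union> pt ` A)" by (simp add: vec.dim_insert)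
    also have "\<dots> \<le> card (G \<union> pt ` A)" using finA G by (intro vec.dim_le_card') auto
    also have "\<dots> \<le> card G + card A"
      using card_Un_le[of G "pt ` A"] card_image_le[OF finA, of pt] by linarith
    finally show False using A(2)[of A] dimG by (simp add: f_def)
  qed
  from exists_separating_form[OF this] obtain l where
    "\<forall>x\<in>G \<union> pt ` A. pairing l x = 0" "pairing l w = 1" by blast
  moreover have "card X + (c - card G) \<le> b * (vec.dim (insert P (pt ` X)) - 1)"
    if "X \<subseteq> E - A" "X \<noteq> {}" for X
  proof -
    have "card G \<le> c" using G by auto
    then have "int (card X + (c - card G)) \<le> int (b * (vec.dim (insert P (pt ` X)) - 1))"
      using A(3)[OF that] unfolding of_nat_mult r_nat by (simp add: of_nat_diff)
    then show ?thesis by linarith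
  qed
  ultimately show ?thesis using A(1) inj by blast
qed


section \<open>Substitution and graded pieces\<close>

definition exponent_degree :: "('v::finite \<Rightarrow>\<^sub>0 nat) \<Rightarrow> nat" where
  "exponent_degree t = (\<Sum>v\<in>UNIV. Poly_Mapping.lookup t v)"

lemma exponent_degree_add: "exponent_degree (t + u) = exponent_degree t + exponent_degree u"
  by (simp add: exponent_degree_def lookup_add sum.distrib)

lemma exponent_degree_zero [simp]: "exponent_degree 0 = 0"
  by (simp add: exponent_degree_def)

lemma forms_iff: "f \<in> forms j \<longleftrightarrow> (\<forall>t\<in>Poly_Mapping.keys f. exponent_degree t = j)"
  by (simp add: forms_def exponent_degree_def)

lemma polynomial_expansion:
  "f = (\<Sum>t\<in>Poly_Mapping.keys f. Poly_Mapping.single t (Poly_Mapping.lookup f t))"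
proof (rule poly_mapping_eqI)
  fix u
  have "Poly_Mapping.lookup (\<Sum>t\<in>Poly_Mapping.keys f. Poly_Mapping.single t (Poly_Mapping.lookup f t)) u
    = (\<Sum>t\<in>Poly_Mapping.keys f. if t = u then Poly_Mapping.lookup f t else 0)"
    by (simp add: lookup_sum lookup_single when_def)
  also have "\<dots> = Poly_Mapping.lookup f u"
    by (simp add: in_keys_iff)
  finally show "Poly_Mapping.lookup f u =
    Poly_Mapping.lookup (\<Sum>t\<in>Poly_Mapping.keys f. Poly_Mapping.single t (Poly_Mapping.lookup f t)) u" by simp
qed

definition monomial_value :: "('v::finite \<Rightarrow> 'b::comm_ring_1) \<Rightarrow> ('v \<Rightarrow>\<^sub>0 nat) \<Rightarrow> 'b" where
  "monomial_value \<sigma> t = (\<Prod>v\<in>UNIV. \<sigma> v ^ Poly_Mapping.lookup t v)"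

lemma monomial_value_add: "monomial_value \<sigma> (t + u) = monomial_value \<sigma> t * monomial_value \<sigma> u"
  by (simp add: monomial_value_def lookup_add power_add prod.distrib)

lemma monomial_value_zero [simp]: "monomial_value \<sigma> 0 = 1"
  by (simp add: monomial_value_def)

lemma monomial_value_single: "monomial_value \<sigma> (Poly_Mapping.single v 1) = \<sigma> v"
proof -
  have "monomial_value \<sigma> (Poly_Mapping.single v 1) = (\<Prod>u\<in>UNIV. if u = v then \<sigma> u else 1)"
    unfolding monomial_value_def by (intro prod.cong) (auto simp: lookup_single when_def)
  then show ?thesis by simp
qed

text \<open>
  Evaluation at a point, Taylor expansion at a point and restriction to a curve are instances.
\<close>

definition substitute ::
  "('a::field \<Rightarrow> 'b::comm_ring_1) \<Rightarrow> ('v::finite \<Rightarrow> 'b) \<Rightarrow> ('v, 'a) polynomial \<Rightarrow> 'b" where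
  "substitute \<phi> \<sigma> f = (\<Sum>t\<in>Poly_Mapping.keys f. \<phi> (Poly_Mapping.lookup f t) * monomial_value \<sigma> t)"

lemma poly_eval_eq_substitute: "poly_eval f x = substitute (\<lambda>c. c) (\<lambda>v. x $ v) f"
  by (simp add: poly_eval_def substitute_def monomial_value_def)

definition variable :: "'v::finite \<Rightarrow> ('v, 'a::field) polynomial" where
  "variable v = Poly_Mapping.single (Poly_Mapping.single v 1) 1"

locale coefficient_hom =
  fixes \<phi> :: "'a::field \<Rightarrow> 'b::comm_ring_1"
  assumes \<phi>_add: "\<phi> (a + b) = \<phi> a + \<phi> b" and \<phi>_mult: "\<phi> (a * b) = \<phi> a * \<phi> b"
    and \<phi>_zero: "\<phi> 0 = 0" and \<phi>_one: "\<phi> 1 = 1"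
begin

lemma substitute_superset:
  assumes "finite S" "Poly_Mapping.keys f \<subseteq> S"
  shows "substitute \<phi> \<sigma> f = (\<Sum>t\<in>S. \<phi> (Poly_Mapping.lookup f t) * monomial_value \<sigma> t)"
  unfolding substitute_def
  using assms by (intro sum.mono_neutral_left) (auto simp: in_keys_iff \<phi>_zero)

lemma substitute_zero [simp]: "substitute \<phi> \<sigma> 0 = 0"
  by (simp add: substitute_def)

lemma substitute_add: "substitute \<phi> \<sigma> (f + g) = substitute \<phi> \<sigma> f + substitute \<phi> \<sigma> g"
proof -
  let ?S = "Poly_Mapping.keys f \<union> Poly_Mapping.keys g"
  have "substitute \<phi> \<sigma> h = (\<Sum>t\<in>?S. \<phi> (Poly_Mapping.lookup h t) * monomial_value \<sigma> t)"
    if "h = f \<or> h = g \<or> h = f + g" for h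
    using that keys_add[of f g] by (intro substitute_superset) auto
  then show ?thesis
    by (simp add: lookup_add \<phi>_add distrib_right sum.distrib)
qed

lemma substitute_sum: "substitute \<phi> \<sigma> (sum F A) = (\<Sum>x\<in>A. substitute \<phi> \<sigma> (F x))"
  by (induction A rule: infinite_finite_induct) (simp_all add: substitute_add)

lemma substitute_single: "substitute \<phi> \<sigma> (Poly_Mapping.single t c) = \<phi> c * monomial_value \<sigma> t"
  by (simp add: substitute_def \<phi>_zero)

lemma substitute_const: "substitute \<phi> \<sigma> (poly_const c) = \<phi> c"
  by (simp add: substitute_single)

lemma substitute_one: "substitute \<phi> \<sigma> 1 = 1"
  using substitute_const[of \<sigma> 1] by (simp add: \<phi>_one)

lemma substitute_variable: "substitute \<phi> \<sigma> (variable v) = \<sigma> v"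
  by (simp only: variable_def substitute_single monomial_value_single \<phi>_one mult_1)

lemma substitute_mult: "substitute \<phi> \<sigma> (f * g) = substitute \<phi> \<sigma> f * substitute \<phi> \<sigma> g"
proof -
  have "f * g = (\<Sum>t\<in>Poly_Mapping.keys f. \<Sum>u\<in>Poly_Mapping.keys g.
      Poly_Mapping.single t (Poly_Mapping.lookup f t) * Poly_Mapping.single u (Poly_Mapping.lookup g u))"
    unfolding sum_product[symmetric] polynomial_expansion[symmetric] ..
  then have "substitute \<phi> \<sigma> (f * g) = (\<Sum>t\<in>Poly_Mapping.keys f. \<Sum>u\<in>Poly_Mapping.keys g.
      (\<phi> (Poly_Mapping.lookup f t) * monomial_value \<sigma> t) * (\<phi> (Poly_Mapping.lookup g u) * monomial_value \<sigma> u))"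
    by (simp add: substitute_sum mult_single substitute_single \<phi>_mult monomial_value_add mult.assoc mult.left_commute)
  also have "\<dots> = substitute \<phi> \<sigma> f * substitute \<phi> \<sigma> g"
    unfolding substitute_def by (simp only: sum_product)
  finally show ?thesis .
qed

lemma substitute_diff: "substitute \<phi> \<sigma> (f - g) = substitute \<phi> \<sigma> f - substitute \<phi> \<sigma> g"
  using substitute_add[of \<sigma> "f - g" g] by (simp add: algebra_simps)

lemma substitute_power: "substitute \<phi> \<sigma> (f ^ k) = substitute \<phi> \<sigma> f ^ k"
  by (induction k) (simp_all add: substitute_one substitute_mult)

lemma substitute_monomial_value:
  "substitute \<phi> \<sigma> (monomial_value \<tau> t) = monomial_value (\<lambda>v. substitute \<phi> \<sigma> (\<tau> v)) t"
proof -
  have "substitute \<phi> \<sigma> (\<Prod>v\<in>A. \<tau> v ^ Poly_Mapping.lookup t v)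
    = (\<Prod>v\<in>A. substitute \<phi> \<sigma> (\<tau> v) ^ Poly_Mapping.lookup t v)" for A
    by (induction A rule: infinite_finite_induct) (simp_all add: substitute_one substitute_mult substitute_power)
  then show ?thesis by (simp add: monomial_value_def)
qed

end

interpretation eval_hom: coefficient_hom "\<lambda>c::'a::field. c"
  by unfold_locales simp_all

interpretation const_hom: coefficient_hom "\<lambda>c::'a::field. poly_const c :: ('v::finite, 'a) polynomial"
  by unfold_locales (simp_all add: single_add mult_single)

lemmas poly_eval_simps =
  eval_hom.substitute_add[where \<sigma> = "\<lambda>v. x $ v" for x, folded poly_eval_eq_substitute]
  eval_hom.substitute_diff[where \<sigma> = "\<lambda>v. x $ v" for x, folded poly_eval_eq_substitute]
  eval_hom.substitute_mult[where \<sigma> = "\<lambda>v. x $ v" for x, folded poly_eval_eq_substitute]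
  eval_hom.substitute_power[where \<sigma> = "\<lambda>v. x $ v" for x, folded poly_eval_eq_substitute]
  eval_hom.substitute_sum[where \<sigma> = "\<lambda>v. x $ v" for x, folded poly_eval_eq_substitute]
  eval_hom.substitute_const[where \<sigma> = "\<lambda>v. x $ v" for x, folded poly_eval_eq_substitute]
  eval_hom.substitute_variable[where \<sigma> = "\<lambda>v. x $ v" for x, folded poly_eval_eq_substitute]

lemma monomial_value_variable:
  "monomial_value (variable :: 'v \<Rightarrow> ('v::finite, 'a::field) polynomial) t = Poly_Mapping.single t 1"
proof -
  have power: "(variable v :: ('v, 'a) polynomial) ^ k = Poly_Mapping.single (Poly_Mapping.single v k) 1" for v k
    by (induction k) (simp_all add: variable_def mult_single single_add[symmetric] add.commute)
  have "(\<Prod>v\<in>A. (variable v :: ('v, 'a) polynomial) ^ Poly_Mapping.lookup t v)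
    = Poly_Mapping.single (\<Sum>v\<in>A. Poly_Mapping.single v (Poly_Mapping.lookup t v)) 1" for A
    by (induction A rule: infinite_finite_induct) (simp_all add: power mult_single)
  moreover have "(\<Sum>v\<in>UNIV. Poly_Mapping.single v (Poly_Mapping.lookup t v)) = t"
    by (rule poly_mapping_eqI) (simp add: lookup_sum lookup_single when_def)
  ultimately show ?thesis by (simp add: monomial_value_def)
qed

lemma substitute_const_variable: "substitute poly_const variable f = f"
proof -
  have "substitute poly_const variable f
    = (\<Sum>t\<in>Poly_Mapping.keys f. Poly_Mapping.single t (Poly_Mapping.lookup f t))"
    by (simp add: substitute_def monomial_value_variable mult_single)
  then show ?thesis using polynomial_expansion[of f] by simp
qed

interpretation pv: vector_space "\<lambda>(c::'a::field) (f::('v::finite, 'a) polynomial). poly_const c * f"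
  by unfold_locales (simp_all add: algebra_simps single_add mult_single flip: mult.assoc)

interpretation ideal: module "(*) :: ('v::finite, 'a::field) polynomial \<Rightarrow> _ \<Rightarrow> _"
  by unfold_locales (simp_all add: algebra_simps)

lemma forms_zero [simp]: "0 \<in> forms j"
  by (simp add: forms_iff)

lemma forms_add: "f \<in> forms j \<Longrightarrow> g \<in> forms j \<Longrightarrow> f + g \<in> forms j"
  using keys_add[of f g] by (fastforce simp: forms_iff)

lemma forms_mult: "f \<in> forms i \<Longrightarrow> g \<in> forms j \<Longrightarrow> f * g \<in> forms (i + j)"
  using keys_mult[of f g] by (fastforce simp: forms_iff exponent_degree_add)

lemma forms_const: "poly_const c \<in> forms 0"
  by (simp add: forms_iff)

lemma forms_one: "1 \<in> forms 0"
  by (simp add: forms_iff)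

lemma forms_scale: "f \<in> forms j \<Longrightarrow> poly_const c * f \<in> forms j"
  using forms_mult[OF forms_const] by fastforce

lemma forms_subspace: "pv.subspace (forms j)"
  by (intro pv.subspaceI forms_zero forms_add forms_scale)

lemma forms_diff: "f \<in> forms j \<Longrightarrow> g \<in> forms j \<Longrightarrow> f - g \<in> forms j"
  by (rule pv.subspace_diff[OF forms_subspace])

lemma forms_sum: "(\<And>x. x \<in> A \<Longrightarrow> F x \<in> forms j) \<Longrightarrow> sum F A \<in> forms j"
  by (rule pv.subspace_sum[OF forms_subspace])

lemma forms_power: "f \<in> forms i \<Longrightarrow> f ^ k \<in> forms (i * k)"
  by (induction k) (simp_all add: forms_one forms_mult)

lemma forms_variable: "variable v \<in> forms 1"
  by (simp add: variable_def forms_iff exponent_degree_def lookup_single when_def)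

lemma forms_monomial_value:
  assumes "\<And>v. \<tau> v \<in> forms 1"
  shows "monomial_value \<tau> t \<in> forms (exponent_degree t)"
proof -
  have "(\<Prod>v\<in>A. \<tau> v ^ Poly_Mapping.lookup t v) \<in> forms (\<Sum>v\<in>A. Poly_Mapping.lookup t v)" for A
  proof (induction A rule: infinite_finite_induct)
    case (insert x A)
    then show ?case using forms_mult[OF forms_power[OF assms, of x "Poly_Mapping.lookup t x"]] by simp
  qed (simp_all add: forms_one)
  then show ?thesis by (simp add: monomial_value_def exponent_degree_def)
qed

definition component :: "nat \<Rightarrow> ('v::finite, 'a::field) polynomial \<Rightarrow> ('v, 'a) polynomial" where
  "component j f = (\<Sum>t | t \<in> Poly_Mapping.keys f \<and> exponent_degree t = j.
     Poly_Mapping.single t (Poly_Mapping.lookup f t))"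

lemma lookup_component:
  "Poly_Mapping.lookup (component j f) t = (if exponent_degree t = j then Poly_Mapping.lookup f t else 0)"
proof -
  have "Poly_Mapping.lookup (component j f) t =
    (\<Sum>u | u \<in> Poly_Mapping.keys f \<and> exponent_degree u = j. if u = t then Poly_Mapping.lookup f u else 0)"
    by (simp add: component_def lookup_sum lookup_single when_def)
  also have "\<dots> = (if exponent_degree t = j then Poly_Mapping.lookup f t else 0)"
    by (simp add: in_keys_iff)
  finally show ?thesis .
qed

lemma component_add: "component j (f + g) = component j f + component j g"
  by (rule poly_mapping_eqI) (simp add: lookup_component lookup_add)

lemma component_zero [simp]: "component j 0 = 0"
  by (rule poly_mapping_eqI) (simp add: lookup_component)

lemma component_sum: "component j (sum F A) = (\<Sum>x\<in>A. component j (F x))"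
  by (induction A rule: infinite_finite_induct) (simp_all add: component_add)

lemma component_in_forms: "component j f \<in> forms j"
  by (auto simp: forms_iff in_keys_iff lookup_component split: if_splits)

lemma component_of_form: "f \<in> forms i \<Longrightarrow> component j f = (if i = j then f else 0)"
  by (rule poly_mapping_eqI) (auto simp: lookup_component forms_iff in_keys_iff)

lemma component_decomposition:
  "f = (\<Sum>j\<in>exponent_degree ` Poly_Mapping.keys f. component j f)"
proof (rule poly_mapping_eqI)
  fix t
  show "Poly_Mapping.lookup f t =
    Poly_Mapping.lookup (\<Sum>j\<in>exponent_degree ` Poly_Mapping.keys f. component j f) t"
    by (auto simp: lookup_sum lookup_component in_keys_iff)
qed

lemma component_mult_form:
  assumes "f \<in> forms d"
  shows "component j (f * g) = (if d \<le> j then f * component (j - d) g else 0)"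
proof -
  let ?D = "exponent_degree ` Poly_Mapping.keys g"
  have "component j (f * g) = component j (\<Sum>i\<in>?D. f * component i g)"
    unfolding sum_distrib_left[symmetric] component_decomposition[symmetric] ..
  also have "\<dots> = (\<Sum>i\<in>?D. if d + i = j then f * component i g else 0)"
    unfolding component_sum
    by (intro sum.cong refl component_of_form forms_mult assms component_in_forms)
  also have "\<dots> = (if d \<le> j then f * component (j - d) g else 0)"
  proof (cases "d \<le> j")
    case True
    have "component (j - d) g = 0" if "j - d \<notin> ?D"
      using that by (intro poly_mapping_eqI) (metis image_eqI in_keys_iff lookup_component lookup_zero)
    moreover have "(\<Sum>i\<in>?D. if d + i = j then f * component i g else 0)
      = (\<Sum>i\<in>?D. if i = j - d then f * component i g else 0)"
      using True by (intro sum.cong) auto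
    ultimately show ?thesis using True by auto
  qed simp
  finally show ?thesis .
qed

section \<open>Powers of the ideal of a point\<close>

definition linear_form :: "'a::field ^ 'v::finite \<Rightarrow> ('v, 'a) polynomial" where
  "linear_form l = (\<Sum>v\<in>UNIV. poly_const (l $ v) * variable v)"

lemma linear_form_in_forms: "linear_form l \<in> forms 1"
  unfolding linear_form_def by (intro forms_sum forms_scale forms_variable)

lemma poly_eval_linear_form [simp]: "poly_eval (linear_form l) x = pairing l x"
  by (simp add: linear_form_def poly_eval_simps pairing_def)

lemma linear_form_add: "linear_form (k + l) = linear_form k + linear_form l"
  by (simp add: linear_form_def single_add distrib_right sum.distrib)

lemma linear_form_scale: "linear_form (c *s l) = poly_const c * linear_form l"
  by (simp add: linear_form_def sum_distrib_left mult_single flip: mult.assoc)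

lemma linear_form_axis: "linear_form (axis v 1) = variable v"
proof -
  have "linear_form (axis v 1) = (\<Sum>u\<in>UNIV. if u = v then variable u else 0)"
    unfolding linear_form_def by (intro sum.cong) (auto simp: axis_def)
  then show ?thesis by simp
qed

lemma pairing_axis: "pairing (axis v 1) x = x $ v"
proof -
  have "pairing (axis v 1) x = (\<Sum>u\<in>UNIV. if u = v then x $ u else 0)"
    unfolding pairing_def by (intro sum.cong) (auto simp: axis_def)
  then show ?thesis by simp
qed

lemma linear_form_diff: "linear_form (k - l) = linear_form k - linear_form l"
  using linear_form_add[of "k - l" l] by (simp add: algebra_simps)

lemma pairing_diff: "pairing (k - l) x = pairing k x - pairing l x"
  using pairing_add[of "k - l" l x] by (simp add: algebra_simps)

lemma ideal_power_subspace: "ideal.subspace (ideal_power I k)"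
  by (cases k) (simp_all add: ideal_generated_def ideal.subspace_UNIV)

lemma point_ideal_subspace: "ideal.subspace (point_ideal P)"
  by (simp add: point_ideal_def ideal_generated_def)

lemma ideal_subspace_imp_pv: "ideal.subspace I \<Longrightarrow> pv.subspace I"
  by (intro pv.subspaceI) (auto simp: ideal.subspace_0 ideal.subspace_add ideal.subspace_scale)

lemma ideal_power_multI:
  assumes "f \<in> I" "g \<in> ideal_power I k"
  shows "f * g \<in> ideal_power I (Suc k)"
  unfolding ideal_power.simps ideal_generated_def using assms by (intro ideal.span_base) blast

lemma ideal_power_absorb: "g \<in> ideal_power I k \<Longrightarrow> f * g \<in> ideal_power I k"
  using ideal.subspace_scale[OF ideal_power_subspace] by blast

lemma ideal_power_Suc_subset: "ideal_power I (Suc k) \<subseteq> ideal_power I k"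
  unfolding ideal_power.simps(2) ideal_generated_def
  by (intro ideal.span_minimal ideal_power_subspace) (auto intro: ideal_power_absorb)

lemma ideal_power_antimono: "j \<le> k \<Longrightarrow> ideal_power I k \<subseteq> ideal_power I j"
  by (induction k rule: dec_induct) (use ideal_power_Suc_subset in blast)+

lemma ideal_power_power: "f \<in> I \<Longrightarrow> f ^ k \<in> ideal_power I k"
  by (induction k) (simp_all only: power_Suc ideal_power_multI ideal_power.simps(1) UNIV_I)

lemma power_congruent:
  assumes "ideal.subspace J" "a - b \<in> J"
  shows "a ^ k - b ^ k \<in> J"
proof (induction k)
  case 0
  then show ?case using assms by (simp add: ideal.subspace_0)
next
  case (Suc k)
  have "a ^ Suc k - b ^ Suc k = a * (a ^ k - b ^ k) + b ^ k * (a - b)" by (simp add: algebra_simps)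
  then show ?case using Suc assms by (metis ideal.subspace_add ideal.subspace_scale)
qed

lemma monomial_value_congruent:
  assumes J: "ideal.subspace J" and "\<And>v. \<sigma> v - \<tau> v \<in> J"
  shows "monomial_value \<sigma> t - monomial_value \<tau> t \<in> J"
proof -
  have "(\<Prod>v\<in>A. \<sigma> v ^ Poly_Mapping.lookup t v) - (\<Prod>v\<in>A. \<tau> v ^ Poly_Mapping.lookup t v) \<in> J" for A
  proof (induction A rule: infinite_finite_induct)
    case (insert x A)
    let ?s = "\<sigma> x ^ Poly_Mapping.lookup t x" and ?t = "\<tau> x ^ Poly_Mapping.lookup t x"
    let ?S = "\<Prod>v\<in>A. \<sigma> v ^ Poly_Mapping.lookup t v" and ?T = "\<Prod>v\<in>A. \<tau> v ^ Poly_Mapping.lookup t v"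
    have "?s * ?S - ?t * ?T = ?s * (?S - ?T) + ?T * (?s - ?t)" by (simp add: algebra_simps)
    then show ?case
      using insert power_congruent[OF J assms(2)[of x], of "Poly_Mapping.lookup t x"] J
      by (simp add: ideal.subspace_add ideal.subspace_scale)
  qed (simp_all add: ideal.subspace_0[OF J])
  then show ?thesis by (simp add: monomial_value_def)
qed

lemma substitute_congruent:
  fixes \<sigma> \<tau> :: "'v::finite \<Rightarrow> ('v, 'a::field) polynomial"
  assumes J: "ideal.subspace J" and "\<And>v. \<sigma> v - \<tau> v \<in> J"
  shows "substitute poly_const \<sigma> f - substitute poly_const \<tau> f \<in> J"
  unfolding substitute_def sum_subtractf[symmetric] right_diff_distrib[symmetric]
  by (intro ideal.subspace_sum[OF J] ideal.subspace_scale[OF J] monomial_value_congruent assms)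

lemma exists_dual_vector:
  fixes P :: "'a::field ^ 'v::finite"
  assumes "P \<noteq> 0"
  shows "\<exists>q. pairing q P = 1"
  using exists_separating_form[of P "{}"] assms by (auto simp: vec.span_empty)

text \<open>
  If \<open>q\<close> is a linear form with \<open>q(P) = 1\<close>, then each variable \<open>x\<^sub>v\<close> is congruent to \<open>P\<^sub>v q\<close>
  modulo the linear forms vanishing at \<open>P\<close>. So a form \<open>f\<close> of degree \<open>j\<close> is congruent to
  \<open>f(P) q\<^sup>j\<close>.
\<close>

lemma form_vanishing_at_point:
  fixes P :: "'a::field ^ 'v::finite"
  assumes P: "P \<noteq> 0" and f: "f \<in> forms j" "poly_eval f P = 0"
  shows "f \<in> ideal.span {linear_form l |l. pairing l P = 0}" (is "f \<in> ?J")
proof -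
  obtain q where q: "pairing q P = 1" using exists_dual_vector[OF P] by blast
  define \<tau> where "\<tau> v = poly_const (P $ v) * linear_form q" for v
  have "variable v - \<tau> v \<in> ?J" for v
  proof -
    have "pairing (axis v 1 - P $ v *s q) P = 0"
      by (simp add: pairing_diff pairing_axis pairing_scale q)
    moreover have "variable v - \<tau> v = linear_form (axis v 1 - P $ v *s q)"
      by (simp add: \<tau>_def linear_form_diff linear_form_scale linear_form_axis)
    ultimately show ?thesis by (metis (mono_tags, lifting) ideal.span_base mem_Collect_eq)
  qed
  then have "substitute poly_const variable f - substitute poly_const \<tau> f \<in> ?J"
    by (intro substitute_congruent ideal.subspace_span)
  moreover have "substitute poly_const \<tau> f = 0"
  proof -
    have mono: "monomial_value \<tau> t = poly_const (monomial_value (\<lambda>v. P $ v) t) * linear_form q ^ exponent_degree t" for t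
    proof -
      have c: "(\<Prod>v\<in>A. (poly_const (P $ v) :: ('v, 'a) polynomial) ^ k v) = poly_const (\<Prod>v\<in>A. (P $ v) ^ k v)" for A k
      proof -
        have "(poly_const x :: ('v, 'a) polynomial) ^ n = poly_const (x ^ n)" for x n
          by (induction n) (simp_all add: mult_single)
        then show ?thesis
          by (induction A rule: infinite_finite_induct) (simp_all add: mult_single)
      qed
      show ?thesis
        by (simp add: monomial_value_def \<tau>_def power_mult_distrib prod.distrib c power_sum exponent_degree_def)
    qed
    have "substitute poly_const \<tau> f = (\<Sum>t\<in>Poly_Mapping.keys f.
        poly_const (Poly_Mapping.lookup f t * monomial_value (\<lambda>v. P $ v) t) * linear_form q ^ j)"
      unfolding substitute_def using f(1)
      by (intro sum.cong) (auto simp: mono forms_iff mult_single simp flip: mult.assoc)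
    also have "\<dots> = poly_const (poly_eval f P) * linear_form q ^ j"
    proof -
      have "(poly_const (sum g A) :: ('v, 'a) polynomial) = (\<Sum>x\<in>A. poly_const (g x))" for g :: "('v \<Rightarrow>\<^sub>0 nat) \<Rightarrow> 'a" and A
        by (induction A rule: infinite_finite_induct) (simp_all add: single_add)
      then show ?thesis by (simp add: poly_eval_eq_substitute substitute_def sum_distrib_right)
    qed
    finally show ?thesis using f(2) by simp
  qed
  ultimately show ?thesis by (simp add: substitute_const_variable)
qed

lemma point_ideal_eq:
  assumes "P \<noteq> 0"
  shows "point_ideal P = ideal.span {linear_form l |l. pairing l P = 0}"
proof
  show "point_ideal P \<subseteq> ideal.span {linear_form l |l. pairing l P = 0}"
    unfolding point_ideal_def ideal_generated_def
    using form_vanishing_at_point[OF assms] by (intro ideal.span_minimal ideal.subspace_span) blast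
  show "ideal.span {linear_form l |l. pairing l P = 0} \<subseteq> point_ideal P"
    unfolding point_ideal_def ideal_generated_def
    by (intro ideal.span_mono) (auto intro: linear_form_in_forms)
qed

lemma form_in_point_ideal:
  assumes "f \<in> forms j" "poly_eval f P = 0"
  shows "f \<in> point_ideal P"
  unfolding point_ideal_def ideal_generated_def using assms by (intro ideal.span_base) blast

lemma ideal_power_point_Suc:
  assumes "P \<noteq> 0" "f \<in> ideal_power (point_ideal P) (Suc k)"
  shows "f \<in> ideal.span {linear_form l * g |l g. pairing l P = 0 \<and> g \<in> ideal_power (point_ideal P) k}"
    (is "f \<in> ?J")
proof -
  have "x * g \<in> ?J" if "x \<in> point_ideal P" "g \<in> ideal_power (point_ideal P) k" for x g
  proof -
    from that(1) have "x \<in> ideal.span {linear_form l |l. pairing l P = 0}"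
      by (simp only: point_ideal_eq[OF assms(1)])
    then show ?thesis
    proof (induction rule: ideal.span_induct_alt)
      case base
      then show ?case by (simp add: ideal.span_zero)
    next
      case (step c x y)
      then obtain l where l: "x = linear_form l" "pairing l P = 0" by blast
      have "linear_form l * g \<in> ?J" using l that(2) by (intro ideal.span_base) blast
      then have "c * (linear_form l * g) + y * g \<in> ?J"
        by (rule ideal.span_add[OF ideal.span_scale step(2)])
      then show ?case by (simp only: l(1) distrib_right mult.assoc)
    qed
  qed
  then have "ideal_power (point_ideal P) (Suc k) \<subseteq> ?J"
    unfolding ideal_power.simps ideal_generated_def
    by (intro ideal.span_minimal ideal.subspace_span) blast
  then show ?thesis using assms(2) by blast
qed

text \<open>
  Powers of the ideal of a point are homogeneous. This is what lets the ideal-theoretic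
  definitions be replaced by statements about forms of a fixed degree.
\<close>

lemma component_ideal_power:
  assumes "P \<noteq> 0" "f \<in> ideal_power (point_ideal P) k"
  shows "component j f \<in> ideal_power (point_ideal P) k"
  using assms(2)
proof (induction k arbitrary: f j)
  case 0
  then show ?case by simp
next
  case (Suc k)
  from ideal_power_point_Suc[OF assms(1) Suc.prems] show ?case
  proof (induction rule: ideal.span_induct_alt)
    case base
    then show ?case using ideal.subspace_0[OF ideal_power_subspace] by (simp only: component_zero)
  next
    case (step c x y)
    then obtain l g where x: "x = linear_form l * g" "pairing l P = 0" "g \<in> ideal_power (point_ideal P) k"
      by blast
    have "component j (linear_form l * (c * g)) \<in> ideal_power (point_ideal P) (Suc k)"
    proof (cases "1 \<le> j")
      case True
      have "linear_form l * component (j - 1) (c * g) \<in> ideal_power (point_ideal P) (Suc k)"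
        using x by (intro ideal_power_multI Suc.IH ideal_power_absorb
            form_in_point_ideal[OF linear_form_in_forms]) auto
      then show ?thesis using True by (simp only: component_mult_form[OF linear_form_in_forms] if_True)
    next
      case False
      then show ?thesis using ideal.subspace_0[OF ideal_power_subspace]
        by (simp only: component_mult_form[OF linear_form_in_forms] if_False)
    qed
    moreover have "c * x + y = linear_form l * (c * g) + y" by (simp add: x mult.left_commute)
    ultimately show ?case
      using step ideal.subspace_add[OF ideal_power_subspace] by (simp only: component_add)
  qed
qed

text \<open>
  In degree \<open>j + 1\<close> the power \<open>k + 1\<close> of the ideal is spanned over the field by products of a linear
  form through \<open>P\<close> with forms of degree \<open>j\<close> in the power \<open>k\<close>. This carries the induction in
  \<open>lift_layer\<close>.
\<close>

lemma form_in_ideal_power_Suc: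
  assumes P: "P \<noteq> 0" and f: "f \<in> ideal_power (point_ideal P) (Suc k)" "f \<in> forms (Suc j)"
  shows "f \<in> pv.span {linear_form l * g |l g. pairing l P = 0 \<and>
    g \<in> forms j \<and> g \<in> ideal_power (point_ideal P) k}" (is "f \<in> ?J")
proof -
  from ideal_power_point_Suc[OF P f(1)] have "component (Suc j) f \<in> ?J"
  proof (induction rule: ideal.span_induct_alt)
    case base
    then show ?case using pv.span_zero by (simp only: component_zero)
  next
    case (step c x y)
    then obtain l g where x: "x = linear_form l * g" "pairing l P = 0" "g \<in> ideal_power (point_ideal P) k"
      by blast
    have "c * x = linear_form l * (c * g)" by (simp add: x mult.left_commute)
    moreover have "component (Suc j) (linear_form l * (c * g)) = linear_form l * component j (c * g)"
      using component_mult_form[OF linear_form_in_forms, of "Suc j" l "c * g"] by simp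
    ultimately have "component (Suc j) (c * x + y) = linear_form l * component j (c * g) + component (Suc j) y"
      by (simp only: component_add)
    moreover have "linear_form l * component j (c * g) \<in> ?J"
      using x by (intro pv.span_base) (auto intro: component_in_forms component_ideal_power[OF P] ideal_power_absorb)
    ultimately show ?case using step by (simp only: pv.span_add)
  qed
  then show ?thesis using component_of_form[OF f(2), of "Suc j"] by simp
qed

section \<open>Solving congruences in the degree of the Segre bound\<close>

text \<open>
  The layer contains each point at most once, so one factor vanishing on it makes up for the lost
  multiplicity.
\<close>

lemma linear_form_times_residual:
  assumes fin: "finite E" and A: "A \<subseteq> E" "inj_on pt A" and l: "\<And>x. x \<in> A \<Longrightarrow> pairing l (pt x) = 0"
    and e: "e \<in> ideal_power (point_ideal Q) (card {x \<in> E - A. pt x = Q})"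
  shows "linear_form l * e \<in> ideal_power (point_ideal Q) (card {x \<in> E. pt x = Q})"
proof (cases "Q \<in> pt ` A")
  case True
  then obtain y where y: "y \<in> A" "Q = pt y" by blast
  have "{x \<in> E. pt x = Q} \<subseteq> insert y {x \<in> E - A. pt x = Q}"
    using A(2) y by (auto dest: inj_onD)
  then have "card {x \<in> E. pt x = Q} \<le> card (insert y {x \<in> E - A. pt x = Q})"
    using fin by (intro card_mono) auto
  then have "card {x \<in> E. pt x = Q} \<le> Suc (card {x \<in> E - A. pt x = Q})"
    using y fin by simp
  moreover have "linear_form l * e \<in> ideal_power (point_ideal Q) (Suc (card {x \<in> E - A. pt x = Q}))"
    using y l e by (intro ideal_power_multI form_in_point_ideal[OF linear_form_in_forms]) auto
  ultimately show ?thesis using ideal_power_antimono by blast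
next
  case False
  then have "{x \<in> E. pt x = Q} = {x \<in> E - A. pt x = Q}" by auto
  then show ?thesis using ideal_power_absorb[OF e] by simp
qed

text \<open>
  Among the forms of degree \<open>b\<close> vanishing to order \<open>c\<close> at \<open>P\<close>, all leading terms at \<open>P\<close> are still
  attained under the vanishing conditions imposed by \<open>E\<close>. A hyperplane takes away a layer of
  \<open>E\<close>, and the inductive hypothesis supplies a cofactor in degree \<open>b - 1\<close>. For \<open>c \<ge> 1\<close> the hyperplanes that
  can be used span all linear forms through \<open>P\<close>, and their products with forms of order \<open>c - 1\<close>
  therefore span everything.
\<close>

lemma lift_layer:
  fixes pt :: "'e \<Rightarrow> 'a::field ^ 'v::finite"
  assumes "finite E" and P: "P \<noteq> 0"
    and "\<And>x. x \<in> E \<Longrightarrow> pt x \<notin> vec.span {P}"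
    and "\<And>X. X \<subseteq> E \<Longrightarrow> X \<noteq> {} \<Longrightarrow> card X + c \<le> b * (vec.dim (insert P (pt ` X)) - 1)"
    and "G \<in> forms b" "G \<in> ideal_power (point_ideal P) c"
  shows "\<exists>e\<in>forms b. e - G \<in> ideal_power (point_ideal P) (Suc c) \<and>
    (\<forall>Q. e \<in> ideal_power (point_ideal Q) (card {x \<in> E. pt x = Q}))"
  using assms(1,3-)
proof (induction b arbitrary: E c G)
  case 0
  have "E = {}"
  proof (rule ccontr)
    assume "E \<noteq> {}"
    then have "card E + c \<le> 0" using "0.prems"(3)[of E] by simp
    then show False using "0.prems"(1) \<open>E \<noteq> {}\<close> by simp
  qed
  then show ?case
    using "0.prems" by (intro bexI[of _ G]) (simp_all add: ideal.subspace_0[OF ideal_power_subspace] del: ideal_power.simps(2))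
next
  case (Suc b)
  show ?case
  proof (cases "E = {}")
    case True
    then show ?thesis
      using Suc.prems by (intro bexI[of _ G]) (simp_all add: ideal.subspace_0[OF ideal_power_subspace] del: ideal_power.simps(2))
  next
    case False
    show ?thesis
    proof (cases c)
      case 0
      from extract_hyperplane[OF Suc.prems(1) P Suc.prems(2,3) False, of "{}" P]
      obtain A l where A: "A \<subseteq> E" "inj_on pt A" "\<And>x. x \<in> A \<Longrightarrow> pairing l (pt x) = 0" "pairing l P = 1"
        "\<And>X. X \<subseteq> E - A \<Longrightarrow> X \<noteq> {} \<Longrightarrow> card X + 0 \<le> b * (vec.dim (insert P (pt ` X)) - 1)"
        using 0 by auto
      \<comment> \<open>modulo the ideal of \<open>P\<close> only the value at \<open>P\<close> counts, and \<open>l(P) = 1\<close>\<close>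
      define H where "H = poly_const (poly_eval G P) * linear_form l ^ b"
      have "H \<in> forms b"
        unfolding H_def using forms_power[OF linear_form_in_forms, of l b] by (intro forms_scale) simp
      then obtain e where e: "e \<in> forms b" "e - H \<in> ideal_power (point_ideal P) (Suc 0)"
        "\<And>Q. e \<in> ideal_power (point_ideal Q) (card {x \<in> E - A. pt x = Q})"
        using Suc.IH[of "E - A" 0 H] Suc.prems(1,2) A(5) by auto
      have "e - H \<in> point_ideal P"
      proof -
        have "ideal_power (point_ideal P) (Suc 0) \<subseteq> point_ideal P"
          unfolding ideal_power.simps ideal_generated_def
          using ideal.subspace_scale[OF point_ideal_subspace, of _ P]
          by (intro ideal.span_minimal point_ideal_subspace) (auto simp: mult.commute)
        then show ?thesis using e(2) by blast
      qed
      have vanish: "poly_eval f P = 0" if "f \<in> point_ideal P" for f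
      proof -
        from that have "f \<in> ideal.span {linear_form l |l. pairing l P = 0}"
          by (simp only: point_ideal_eq[OF P])
        then show ?thesis
          by (induction rule: ideal.span_induct_alt)
            (auto simp: poly_eval_simps poly_eval_linear_form, simp add: poly_eval_def)
      qed
      have "poly_eval e P = poly_eval G P"
        using vanish[OF \<open>e - H \<in> point_ideal P\<close>] A(4) by (simp add: H_def poly_eval_simps)
      then have "poly_eval (linear_form l * e - G) P = 0"
        using A(4) by (simp add: poly_eval_simps)
      moreover have le: "linear_form l * e \<in> forms (Suc b)"
        using forms_mult[OF linear_form_in_forms e(1), of l] by simp
      ultimately have "linear_form l * e - G \<in> point_ideal P"
        using Suc.prems(4) by (intro form_in_point_ideal[OF forms_diff])
      then have "(linear_form l * e - G) * 1 \<in> ideal_power (point_ideal P) (Suc c)"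
        unfolding 0 by (intro ideal_power_multI) auto
      then have "linear_form l * e - G \<in> ideal_power (point_ideal P) (Suc c)"
        by (simp only: mult_1_right)
      moreover have "linear_form l * e \<in> ideal_power (point_ideal Q) (card {x \<in> E. pt x = Q})" for Q
        using linear_form_times_residual[OF Suc.prems(1) A(1-3) e(3)] .
      ultimately show ?thesis using le by blast
    next
      case c: (Suc c')
      let ?I = "ideal_power (point_ideal P)"
      define good where "good = {G. \<exists>e\<in>forms (Suc b). e - G \<in> ?I (Suc c) \<and>
        (\<forall>Q. e \<in> ideal_power (point_ideal Q) (card {x \<in> E. pt x = Q}))}"
      have pvI: "pv.subspace (ideal_power (point_ideal Q) k)" for Q :: "'a ^ 'v" and k
        by (intro ideal_subspace_imp_pv ideal_power_subspace)
      have good_subspace: "pv.subspace good"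
      proof (rule pv.subspaceI)
        show "0 \<in> good"
          using pv.subspace_0[OF pvI] unfolding good_def by (auto intro!: bexI[of _ 0] simp del: ideal_power.simps)
        show "F + G \<in> good" if FG: "F \<in> good" "G \<in> good" for F G
        proof -
          from FG obtain e f where ef: "e \<in> forms (Suc b)" "f \<in> forms (Suc b)"
            "e - F \<in> ?I (Suc c)" "f - G \<in> ?I (Suc c)"
            "\<And>Q. e \<in> ideal_power (point_ideal Q) (card {x \<in> E. pt x = Q})"
            "\<And>Q. f \<in> ideal_power (point_ideal Q) (card {x \<in> E. pt x = Q})"
            unfolding good_def by blast
          have "(e - F) + (f - G) = e + f - (F + G)" by simp
          then have "e + f - (F + G) \<in> ?I (Suc c)" using pv.subspace_add[OF pvI ef(3,4)] by (simp only:)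
          then show ?thesis unfolding good_def
            using forms_add[OF ef(1,2)] pv.subspace_add[OF pvI ef(5,6)] by blast
        qed
        show "poly_const a * F \<in> good" if F: "F \<in> good" for a F
        proof -
          from F obtain e where e: "e \<in> forms (Suc b)" "e - F \<in> ?I (Suc c)"
            "\<And>Q. e \<in> ideal_power (point_ideal Q) (card {x \<in> E. pt x = Q})"
            unfolding good_def by blast
          have "poly_const a * e - poly_const a * F \<in> ?I (Suc c)"
            using pv.subspace_scale[OF pvI e(2), of a] by (simp only: right_diff_distrib)
          then show ?thesis unfolding good_def
            using forms_scale[OF e(1)] pv.subspace_scale[OF pvI e(3)] by blast
        qed
      qed
      \<comment> \<open>the linear forms whose products with all lower forms can be lifted\<close>
      define \<Gamma> where "\<Gamma> = {l. \<forall>g\<in>forms b \<inter> ?I c'. linear_form l * g \<in> good}"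
      have "vec.subspace \<Gamma>"
      proof (rule vec.subspaceI)
        show "0 \<in> \<Gamma>"
          using pv.subspace_0[OF good_subspace] by (simp add: \<Gamma>_def linear_form_def)
        show "k + l \<in> \<Gamma>" if "k \<in> \<Gamma>" "l \<in> \<Gamma>" for k l
          using that pv.subspace_add[OF good_subspace]
          unfolding \<Gamma>_def mem_Collect_eq linear_form_add distrib_right by blast
        show "a *s l \<in> \<Gamma>" if "l \<in> \<Gamma>" for a l
          using that pv.subspace_scale[OF good_subspace]
          unfolding \<Gamma>_def mem_Collect_eq linear_form_scale mult.assoc by blast
      qed
      have available: "\<exists>l\<in>\<Gamma>. pairing l P = 0 \<and> pairing l v \<noteq> 0" if v: "v \<notin> vec.span {P}" for v
      proof -
        from extract_hyperplane[OF Suc.prems(1) P Suc.prems(2,3) False, of "{P}" v]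
        obtain A l where A: "A \<subseteq> E" "inj_on pt A" "\<And>x. x \<in> A \<Longrightarrow> pairing l (pt x) = 0"
          "pairing l P = 0" "pairing l v = 1"
          "\<And>X. X \<subseteq> E - A \<Longrightarrow> X \<noteq> {} \<Longrightarrow> card X + c' \<le> b * (vec.dim (insert P (pt ` X)) - 1)"
          using c v by auto
        have "linear_form l * g \<in> good" if g: "g \<in> forms b" "g \<in> ?I c'" for g
        proof -
          obtain e where e: "e \<in> forms b" "e - g \<in> ?I (Suc c')"
            "\<And>Q. e \<in> ideal_power (point_ideal Q) (card {x \<in> E - A. pt x = Q})"
            using Suc.IH[of "E - A" c' g] Suc.prems(1,2) A(6) g by auto
          have "linear_form l * (e - g) \<in> ?I (Suc (Suc c'))"
            using A(4) e(2) by (intro ideal_power_multI form_in_point_ideal[OF linear_form_in_forms]) auto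
          then have "linear_form l * e - linear_form l * g \<in> ?I (Suc c)"
            unfolding c by (simp only: right_diff_distrib)
          moreover have "linear_form l * e \<in> ideal_power (point_ideal Q) (card {x \<in> E. pt x = Q})" for Q
            using linear_form_times_residual[OF Suc.prems(1) A(1-3) e(3)] .
          moreover have "linear_form l * e \<in> forms (Suc b)"
            using forms_mult[OF linear_form_in_forms e(1), of l] by simp
          ultimately show ?thesis unfolding good_def by blast
        qed
        then have "l \<in> \<Gamma>" unfolding \<Gamma>_def by blast
        then show ?thesis using A(4,5) by auto
      qed
      have "linear_form l * g \<in> good" if "pairing l P = 0" "g \<in> forms b" "g \<in> ?I c'" for l g
      proof -
        have "l \<in> vec.span {l \<in> \<Gamma>. pairing l P = 0}"
          by (rule forms_span_annihilator[OF available that(1)])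
        also have "\<dots> \<subseteq> \<Gamma>" by (intro vec.span_minimal \<open>vec.subspace \<Gamma>\<close>) auto
        finally show ?thesis using that unfolding \<Gamma>_def by blast
      qed
      then have "pv.span {linear_form l * g |l g. pairing l P = 0 \<and> g \<in> forms b \<and> g \<in> ?I c'} \<subseteq> good"
        by (intro pv.span_minimal good_subspace) blast
      moreover have "G \<in> pv.span {linear_form l * g |l g. pairing l P = 0 \<and> g \<in> forms b \<and> g \<in> ?I c'}"
        using Suc.prems(4,5) form_in_ideal_power_Suc[OF P] unfolding c by blast
      ultimately show ?thesis unfolding good_def by blast
    qed
  qed
qed

text \<open>
  The multiplicities are built up one at a time. Raising the multiplicity of \<open>P i\<close> from \<open>c\<close> to
  \<open>c + 1\<close> needs a correction of order \<open>c\<close> at \<open>P i\<close> that does not disturb the other points, so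
  \<open>lift_layer\<close> is applied to the multiset in which each \<open>P k\<close> with \<open>k \<noteq> i\<close> occurs \<open>m k\<close>
  times. For the subspace \<open>U\<close> spanned by \<open>P i\<close> and a part of this multiset, the weight bound for \<open>U\<close>
  is the hypothesis of \<open>lift_layer\<close>: the \<open>c + 1\<close> copies of \<open>P i\<close> account for \<open>+ c\<close> on one side
  and for the \<open>+ 1\<close> on the other.
\<close>

theorem simultaneous_congruences:
  fixes P :: "'i \<Rightarrow> 'a::field ^ 'v::finite"
  assumes fin: "finite S"
    and P: "\<And>i. i \<in> S \<Longrightarrow> P i \<noteq> 0"
    and distinct: "\<And>i k. i \<in> S \<Longrightarrow> k \<in> S \<Longrightarrow> i \<noteq> k \<Longrightarrow> P i \<notin> vec.span {P k}"
    and "\<And>U. vec.subspace U \<Longrightarrow> 2 \<le> vec.dim U \<Longrightarrow> (\<Sum>i | i \<in> S \<and> P i \<in> U. m i) \<le> b * (vec.dim U - 1) + 1"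
    and g: "\<And>i. i \<in> S \<Longrightarrow> g i \<in> forms b"
  shows "\<exists>f\<in>forms b. \<forall>i\<in>S. f - g i \<in> ideal_power (point_ideal (P i)) (m i)"
  using assms(4)
proof (induction "\<Sum>i\<in>S. m i" arbitrary: m)
  case 0
  then have "m i = 0" if "i \<in> S" for i using fin that by simp
  then show ?case by (intro bexI[of _ 0]) simp_all
next
  case (Suc N)
  then obtain i where i: "i \<in> S" "m i \<noteq> 0" by (metis Zero_not_Suc sum.neutral)
  then obtain c where c: "m i = Suc c" using not0_implies_Suc by blast
  define m' where "m' = m(i := c)"
  have sum_m: "(\<Sum>k\<in>S. m k) = Suc c + (\<Sum>k\<in>S - {i}. m k)"
    using fin i c by (simp add: sum.remove)
  moreover have "(\<Sum>k\<in>S. m' k) = c + (\<Sum>k\<in>S - {i}. m k)"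
    using fin i by (simp add: sum.remove m'_def)
  ultimately have "N = (\<Sum>k\<in>S. m' k)" using Suc.hyps(2) by simp
  moreover have "(\<Sum>k | k \<in> S \<and> P k \<in> U. m' k) \<le> b * (vec.dim U - 1) + 1"
    if "vec.subspace U" "2 \<le> vec.dim U" for U
    using Suc.prems[OF that] sum_mono[of "{k \<in> S. P k \<in> U}" m' m] c
    by (fastforce simp: m'_def)
  ultimately obtain f' where f': "f' \<in> forms b"
    "\<And>k. k \<in> S \<Longrightarrow> f' - g k \<in> ideal_power (point_ideal (P k)) (m' k)"
    using Suc.hyps(1)[of m'] by blast
  define E where "E = Sigma (S - {i}) (\<lambda>k. {..<m k})"
  define pt where "pt x = P (fst x)" for x :: "'i \<times> nat"
  have finE: "finite E" unfolding E_def using fin by auto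
  have "\<exists>e\<in>forms b. e - (g i - f') \<in> ideal_power (point_ideal (P i)) (Suc c) \<and>
    (\<forall>Q. e \<in> ideal_power (point_ideal Q) (card {x \<in> E. pt x = Q}))"
  proof (rule lift_layer[OF finE P[OF i(1)]])
    show "pt x \<notin> vec.span {P i}" if "x \<in> E" for x
      using that distinct[of "fst x" i] i(1) by (auto simp: E_def pt_def)
    show "g i - f' \<in> forms b" using forms_diff g i f' by blast
    have "- (f' - g i) \<in> ideal_power (point_ideal (P i)) c"
      using f'(2)[OF i(1)] ideal.subspace_neg[OF ideal_power_subspace] unfolding m'_def by (metis fun_upd_same)
    then show "g i - f' \<in> ideal_power (point_ideal (P i)) c" by simp
  next
    fix X assume X: "X \<subseteq> E" "X \<noteq> {}"
    define U where "U = vec.span (insert (P i) (pt ` X))"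
    obtain x where x: "x \<in> X" using X by blast
    have "vec.dim {pt x, P i} = 2"
    proof -
      have "pt x \<notin> vec.span {P i}"
        using subsetD[OF X(1) x] distinct[of "fst x" i] i(1) by (auto simp: E_def pt_def)
      then show ?thesis using P[OF i(1)] by (simp add: vec.dim_insert vec.span_empty)
    qed
    moreover have "vec.dim {pt x, P i} \<le> vec.dim (insert (P i) (pt ` X))"
      using x by (intro vec.dim_subset) auto
    ultimately have dimU: "2 \<le> vec.dim U" by (simp add: U_def)
    have inU: "P i \<in> U" "\<And>y. y \<in> X \<Longrightarrow> P (fst y) \<in> U"
      by (auto simp: U_def pt_def intro!: vec.span_base)
    have "X \<subseteq> Sigma {k \<in> S - {i}. P k \<in> U} (\<lambda>k. {..<m k})"
      using X inU by (force simp: E_def)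
    then have "card X \<le> card (Sigma {k \<in> S - {i}. P k \<in> U} (\<lambda>k. {..<m k}))"
      using fin by (intro card_mono) auto
    also have "\<dots> = (\<Sum>k\<in>{k \<in> S - {i}. P k \<in> U}. m k)" using fin by simp
    finally have cardX: "card X \<le> (\<Sum>k\<in>{k \<in> S - {i}. P k \<in> U}. m k)" .
    have "card X + Suc c \<le> (\<Sum>k | k \<in> S \<and> P k \<in> U. m k)"
    proof -
      have "{k. k \<in> S \<and> P k \<in> U} = insert i {k \<in> S - {i}. P k \<in> U}" using i(1) inU by auto
      then have "(\<Sum>k | k \<in> S \<and> P k \<in> U. m k) = Suc c + (\<Sum>k\<in>{k \<in> S - {i}. P k \<in> U}. m k)"
        using fin c by simp
      then show ?thesis using cardX by simp
    qed
    also have "\<dots> \<le> b * (vec.dim U - 1) + 1"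
      using Suc.prems[of U] dimU by (simp add: U_def)
    finally show "card X + c \<le> b * (vec.dim (insert (P i) (pt ` X)) - 1)"
      by (simp add: U_def)
  qed
  then obtain e where e: "e \<in> forms b" "e - (g i - f') \<in> ideal_power (point_ideal (P i)) (Suc c)"
    "\<And>Q. e \<in> ideal_power (point_ideal Q) (card {x \<in> E. pt x = Q})" by blast
  have "f' + e - g k \<in> ideal_power (point_ideal (P k)) (m k)" if k: "k \<in> S" for k
  proof (cases "k = i")
    case True
    have "f' + e - g i = e - (g i - f')" by simp
    then show ?thesis unfolding True c using e(2) by (simp only:)
  next
    case False
    have "{k} \<times> {..<m k} \<subseteq> {x \<in> E. pt x = P k}" using False k by (auto simp: E_def pt_def)
    then have "card ({k} \<times> {..<m k}) \<le> card {x \<in> E. pt x = P k}" using finE by (intro card_mono) auto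
    then have "m k \<le> card {x \<in> E. pt x = P k}" by simp
    then have "e \<in> ideal_power (point_ideal (P k)) (m k)" using e(3) ideal_power_antimono by blast
    moreover have "f' - g k \<in> ideal_power (point_ideal (P k)) (m k)"
      using f'(2)[OF k] False by (simp add: m'_def)
    ultimately have "(f' - g k) + e \<in> ideal_power (point_ideal (P k)) (m k)"
      by (intro ideal.subspace_add[OF ideal_power_subspace])
    then show ?thesis by (simp add: algebra_simps)
  qed
  then show ?case using forms_add[OF f'(1) e(1)] by blast
qed


section \<open>Counting dimensions modulo a subspace\<close>

text \<open>
  The exchange lemma in a quotient space, without forming the quotient: a basis of \<open>N\<close> is added
  to both families, and only finitely many of its elements are relevant.
\<close>

lemma (in vector_space) card_independent_modulo_le:
  assumes N: "subspace N" and B: "finite B"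
    and indep: "\<And>c. (\<Sum>b\<in>B. scale (c b) b) \<in> N \<Longrightarrow> \<forall>b\<in>B. c b = 0"
    and S: "finite S" and BS: "B \<subseteq> span (S \<union> N)"
  shows "card B \<le> card S"
proof -
  obtain N0 where N0: "N0 \<subseteq> N" "independent N0" "N \<subseteq> span N0"
    by (rule maximal_independent_subset[of N])
  have "span (S \<union> N) \<subseteq> span (S \<union> N0)"
  proof (intro span_minimal subspace_span)
    have "span N0 \<subseteq> span (S \<union> N0)" "S \<subseteq> span (S \<union> N0)"
      by (auto intro: span_mono[THEN subsetD] span_base)
    then show "S \<union> N \<subseteq> span (S \<union> N0)" using N0(3) by blast
  qed
  have "\<exists>T. finite T \<and> T \<subseteq> S \<union> N0 \<and> b \<in> span T" if "b \<in> B" for b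
  proof -
    have "b \<in> span (S \<union> N0)" using that BS \<open>span (S \<union> N) \<subseteq> span (S \<union> N0)\<close> by blast
    then obtain T r where T: "finite T" "T \<subseteq> S \<union> N0" "b = (\<Sum>a\<in>T. scale (r a) a)"
      unfolding span_explicit by blast
    then have "b \<in> span T" by (auto intro: span_sum span_scale span_base)
    then show ?thesis using T by blast
  qed
  then obtain T where T: "\<And>b. b \<in> B \<Longrightarrow> finite (T b) \<and> T b \<subseteq> S \<union> N0 \<and> b \<in> span (T b)"
    by metis
  define M where "M = (\<Union>b\<in>B. T b) \<inter> N0"
  have M: "finite M" "M \<subseteq> N0" using B T by (auto simp: M_def)
  have BM: "B \<subseteq> span (S \<union> M)"
  proof
    fix b assume b: "b \<in> B"
    then have "T b \<subseteq> S \<union> M" using T by (fastforce simp: M_def)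
    then show "b \<in> span (S \<union> M)" using span_mono T[OF b] by blast
  qed
  have indM: "independent M" using N0(2) M(2) by (rule independent_mono)
  have disj: "B \<inter> M = {}"
  proof (rule ccontr)
    assume "B \<inter> M \<noteq> {}"
    then obtain b where b: "b \<in> B" "b \<in> N" using M N0 by blast
    have "(\<Sum>x\<in>B. scale (if x = b then 1 else 0) x) = (\<Sum>x\<in>B. if x = b then x else 0)"
      by (intro sum.cong) auto
    then have "(\<Sum>x\<in>B. scale (if x = b then 1 else 0) x) \<in> N" using b B by simp
    then show False using indep[of "\<lambda>x. if x = b then 1 else 0"] b by auto
  qed
  have "independent (B \<union> M)"
  proof (rule independent_if_scalars_zero)
    show "finite (B \<union> M)" using B M by blast
    fix u x assume u: "(\<Sum>x\<in>B \<union> M. scale (u x) x) = 0" and x: "x \<in> B \<union> M"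
    have sum0: "(\<Sum>x\<in>B. scale (u x) x) + (\<Sum>x\<in>M. scale (u x) x) = 0"
      using u B M(1) disj by (simp add: sum.union_disjoint)
    have "(\<Sum>x\<in>M. scale (u x) x) \<in> N"
      using M(2) N0(1) by (intro subspace_sum[OF N] subspace_scale[OF N]) auto
    moreover have "(\<Sum>x\<in>B. scale (u x) x) = - (\<Sum>x\<in>M. scale (u x) x)"
      using sum0 by (simp add: eq_neg_iff_add_eq_0)
    ultimately have "(\<Sum>x\<in>B. scale (u x) x) \<in> N" using subspace_neg[OF N] by simp
    then have zero: "\<forall>b\<in>B. u b = 0" by (rule indep)
    then have "(\<Sum>x\<in>M. scale (u x) x) = 0" using sum0 by simp
    then show "u x = 0"
      using x zero independentD[OF indM M(1) order_refl, of u] by blast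
  qed
  moreover have "B \<union> M \<subseteq> span (S \<union> M)" using BM by (auto intro: span_base)
  ultimately have "card (B \<union> M) \<le> card (S \<union> M)"
    using independent_span_bound[of "S \<union> M" "B \<union> M"] S M(1) by blast
  also have "\<dots> \<le> card S + card M" by (rule card_Un_le)
  finally show ?thesis using B M(1) disj by (simp add: card_Un_disjoint)
qed

definition exponents :: "nat \<Rightarrow> ('v::finite \<Rightarrow>\<^sub>0 nat) set" where
  "exponents k = {t. exponent_degree t = k}"

lemma card_exponents:
  "card (exponents k :: ('v::finite \<Rightarrow>\<^sub>0 nat) set) = (k + CARD('v) - 1) choose k"
  and finite_exponents: "finite (exponents k :: ('v::finite \<Rightarrow>\<^sub>0 nat) set)"
proof -
  let ?N = "CARD('v)"
  let ?L = "{l :: nat list. length l = ?N \<and> sum_list l = k}"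
  obtain f where f: "bij_betw f {..<?N} (UNIV :: 'v set)"
    using ex_bij_betw_nat_finite[of "UNIV :: 'v set"] by (auto simp: atLeast0LessThan)
  define F where "F t = map (\<lambda>i. Poly_Mapping.lookup t (f i)) [0..<?N]" for t :: "'v \<Rightarrow>\<^sub>0 nat"
  have sumF: "sum_list (F t) = exponent_degree t" for t
  proof -
    have "sum_list (F t) = (\<Sum>i\<in>{..<?N}. Poly_Mapping.lookup t (f i))"
      by (simp add: F_def interv_sum_list_conv_sum_set_nat atLeast0LessThan)
    also have "\<dots> = exponent_degree t"
      unfolding exponent_degree_def by (rule sum.reindex_bij_betw[OF f])
    finally show ?thesis .
  qed
  have "bij_betw F (exponents k) ?L"
  proof (rule bij_betw_imageI)
    show "inj_on F (exponents k)"
    proof (rule inj_onI, rule poly_mapping_eqI)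
      fix t u v assume "F t = F u"
      moreover obtain i where "i < ?N" "v = f i" using f by (metis UNIV_I bij_betw_def imageE lessThan_iff)
      ultimately show "Poly_Mapping.lookup t v = Poly_Mapping.lookup u v" by (simp add: F_def)
    qed
    show "F ` exponents k = ?L"
    proof
      show "F ` exponents k \<subseteq> ?L" using sumF by (auto simp: exponents_def F_def)
      show "?L \<subseteq> F ` exponents k"
      proof
        fix l assume l: "l \<in> ?L"
        define t where "t = Abs_poly_mapping (\<lambda>v. l ! (the_inv_into {..<?N} f v))"
        have "Poly_Mapping.lookup t (f i) = l ! i" if "i < ?N" for i
          using f that by (simp add: t_def the_inv_into_f_f bij_betw_def)
        then have "F t = l" using l by (intro nth_equalityI) (auto simp: F_def)
        moreover from this have "t \<in> exponents k" using l sumF[of t] by (simp add: exponents_def)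
        ultimately show "l \<in> F ` exponents k" by blast
      qed
    qed
  qed
  note bij = this
  have "finite ?L"
  proof (rule finite_subset)
    show "?L \<subseteq> {l. set l \<subseteq> {..k} \<and> length l = ?N}" using member_le_sum_list by fastforce
    show "finite {l. set l \<subseteq> {..k} \<and> length l = ?N}" by (rule finite_lists_length_eq) simp
  qed
  then show "finite (exponents k :: ('v \<Rightarrow>\<^sub>0 nat) set)"
    using bij_betw_finite[OF bij] by simp
  show "card (exponents k :: ('v \<Rightarrow>\<^sub>0 nat) set) = (k + ?N - 1) choose k"
    using bij_betw_same_card[OF bij] card_length_sum_list[of ?N k] by simp
qed

lemma card_exponents_pred:
  assumes "1 \<le> m"
  shows "card (exponents (m - 1) :: ('v::finite \<Rightarrow>\<^sub>0 nat) set) = (m + (CARD('v) - 1) - 1) choose (CARD('v) - 1)"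
proof -
  have "1 \<le> CARD('v)" by (simp add: Suc_leI)
  have "card (exponents (m - 1) :: ('v \<Rightarrow>\<^sub>0 nat) set) = (m - 1 + CARD('v) - 1) choose (m - 1)"
    by (rule card_exponents)
  also have "\<dots> = (m - 1 + CARD('v) - 1) choose (CARD('v) - 1)"
  proof -
    have "m - 1 \<le> m - 1 + CARD('v) - 1" "m - 1 + CARD('v) - 1 - (m - 1) = CARD('v) - 1"
      using \<open>1 \<le> CARD('v)\<close> by linarith+
    then show ?thesis using binomial_symmetric[of "m - 1" "m - 1 + CARD('v) - 1"] by simp
  qed
  finally show ?thesis using assms \<open>1 \<le> CARD('v)\<close> by simp
qed

lemma card_exponents_strict_mono:
  assumes "2 \<le> CARD('v::finite)" "k < l"
  shows "card (exponents k :: ('v \<Rightarrow>\<^sub>0 nat) set) < card (exponents l :: ('v \<Rightarrow>\<^sub>0 nat) set)"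
proof -
  obtain n where n: "CARD('v) = Suc (Suc n)" using assms(1) by (metis Suc_le_D numeral_2_eq_2 Suc_le_D Suc_le_mono)
  have step: "card (exponents k :: ('v \<Rightarrow>\<^sub>0 nat) set) < card (exponents (Suc k) :: ('v \<Rightarrow>\<^sub>0 nat) set)" for k
  proof -
    have "(k + n + 2) choose (Suc k) = ((k + n + 1) choose k) + ((k + n + 1) choose (Suc k))" by simp
    moreover have "(k + n + 1) choose (Suc k) > 0" by (simp add: zero_less_binomial_iff)
    ultimately show ?thesis unfolding card_exponents n by simp
  qed
  show ?thesis using lift_Suc_mono_less[of "\<lambda>k. card (exponents k :: ('v \<Rightarrow>\<^sub>0 nat) set)", OF step assms(2)] .
qed

section \<open>Forms modulo a power of the ideal of a point\<close>

lemma ideal_power_power_mult: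
  assumes "f \<in> I" "g \<in> ideal_power I k"
  shows "f ^ i * g \<in> ideal_power I (i + k)"
proof (induction i)
  case (Suc i)
  from ideal_power_multI[OF assms(1) Suc] show ?case
    unfolding power_Suc add_Suc mult.assoc .
qed (use assms in simp)

text \<open>
  The \<open>m\<close>-th power of the ideal generated by the variables.
\<close>

definition order_at_least :: "nat \<Rightarrow> ('v::finite, 'a::field) polynomial set" where
  "order_at_least m = {f. \<forall>t\<in>Poly_Mapping.keys f. m \<le> exponent_degree t}"

lemma order_at_least_zero: "0 \<in> order_at_least m"
  by (simp add: order_at_least_def)

lemma order_at_least_add:
  "f \<in> order_at_least m \<Longrightarrow> g \<in> order_at_least m \<Longrightarrow> f + g \<in> order_at_least m"
  using keys_add[of f g] by (auto simp: order_at_least_def)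

lemma order_at_least_mult:
  "f \<in> order_at_least i \<Longrightarrow> g \<in> order_at_least k \<Longrightarrow> f * g \<in> order_at_least (i + k)"
  using keys_mult[of f g] by (fastforce simp: order_at_least_def exponent_degree_add intro: add_mono)

lemma order_at_least_absorb: "g \<in> order_at_least k \<Longrightarrow> f * g \<in> order_at_least k"
  using order_at_least_mult[of f 0 g k] by (simp add: order_at_least_def)

lemma order_at_least_sum: "(\<And>x. x \<in> A \<Longrightarrow> F x \<in> order_at_least m) \<Longrightarrow> sum F A \<in> order_at_least m"
  by (induction A rule: infinite_finite_induct) (auto simp: order_at_least_zero order_at_least_add)

lemma order_at_least_variable: "variable v \<in> order_at_least 1"
  using forms_variable[of v] unfolding forms_iff order_at_least_def by auto

lemma monomials_in_linear_forms_span: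
  fixes g :: "'v::finite \<Rightarrow> ('v, 'a::field) polynomial"
  assumes span: "\<And>v. variable v \<in> pv.span (range g)"
  shows "forms b \<subseteq> pv.span (monomial_value g ` exponents b)"
proof -
  define W where "W k = pv.span (monomial_value g ` exponents k)" for k
  have W_sub: "pv.subspace (W k)" for k by (simp add: W_def)
  have W_mult: "f * h \<in> W (i + k)" if f: "f \<in> W i" and h: "h \<in> W k" for f h i k
  proof -
    have gen: "x * h \<in> W (i + k)" if x: "x \<in> monomial_value g ` exponents i" for x
      using h unfolding W_def[of k]
    proof (induction rule: pv.span_induct_alt)
      case base
      then show ?case using pv.subspace_0[OF W_sub] by simp
    next
      case (step c y z)
      then obtain t u where tu: "t \<in> exponents i" "u \<in> exponents k" "x = monomial_value g t" "y = monomial_value g u"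
        using x by blast
      have "x * y \<in> W (i + k)"
        unfolding W_def tu monomial_value_add[symmetric] using tu(1,2)
        by (intro pv.span_base imageI) (simp add: exponents_def exponent_degree_add)
      then have "poly_const c * (x * y) + x * z \<in> W (i + k)"
        using step.IH by (intro pv.subspace_add[OF W_sub] pv.subspace_scale[OF W_sub])
      then show ?case by (simp only: distrib_left mult.left_commute)
    qed
    from f[unfolded W_def] show ?thesis
    proof (induction rule: pv.span_induct_alt)
      case base
      then show ?case using pv.subspace_0[OF W_sub] by simp
    next
      case (step c x y)
      have "poly_const c * (x * h) + y * h \<in> W (i + k)"
        using gen[OF step.hyps(1)] step.IH by (intro pv.subspace_add[OF W_sub] pv.subspace_scale[OF W_sub])
      then show ?case by (simp only: distrib_right mult.assoc)
    qed
  qed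
  have W_one: "1 \<in> W 0"
    unfolding W_def by (rule pv.span_base) (auto intro!: image_eqI[of _ _ 0] simp: exponents_def)
  have W_var: "variable v \<in> W 1" for v
  proof -
    have "range g \<subseteq> W 1"
    proof
      fix x assume "x \<in> range g"
      then obtain u where "x = monomial_value g (Poly_Mapping.single u 1)" unfolding monomial_value_single by blast
      moreover have "Poly_Mapping.single u 1 \<in> exponents 1"
        by (simp add: exponents_def exponent_degree_def lookup_single when_def)
      ultimately show "x \<in> W 1" unfolding W_def by (auto intro: pv.span_base)
    qed
    then have "pv.span (range g) \<subseteq> W 1" by (intro pv.span_minimal W_sub)
    then show ?thesis using span by blast
  qed
  have W_power: "variable v ^ k \<in> W k" for v k
    using W_mult[OF W_var[of v]] by (induction k) (simp_all add: W_one)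
  have "(\<Prod>v\<in>A. variable v ^ Poly_Mapping.lookup t v) \<in> W (\<Sum>v\<in>A. Poly_Mapping.lookup t v)" for A t
    by (induction A rule: infinite_finite_induct) (simp_all add: W_one W_mult W_power)
  then have mono: "Poly_Mapping.single t 1 \<in> W (exponent_degree t)" for t
    unfolding monomial_value_variable[symmetric] monomial_value_def exponent_degree_def .
  show ?thesis
  proof
    fix f :: "('v, 'a) polynomial" assume f: "f \<in> forms b"
    have "f = (\<Sum>t\<in>Poly_Mapping.keys f. poly_const (Poly_Mapping.lookup f t) * Poly_Mapping.single t 1)"
      using polynomial_expansion[of f] by (simp add: mult_single)
    also have "\<dots> \<in> W b"
      using f mono by (intro pv.subspace_sum[OF W_sub] pv.subspace_scale[OF W_sub]) (auto simp: forms_iff)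
    finally show "f \<in> pv.span (monomial_value g ` exponents b)" by (simp add: W_def)
  qed
qed

text \<open>
  Let \<open>q, h\<^sub>1, \<dots>, h\<^sub>n\<close> be a basis of the linear forms with \<open>q(P) = 1\<close> and \<open>h\<^sub>i(P) = 0\<close>. A monomial of
  degree \<open>b\<close> in them lies in the \<open>m\<close>-th power of the ideal if its degree in the \<open>h\<^sub>i\<close> is at least
  \<open>m\<close>; the others are divisible by \<open>q\<^sup>b\<^sup>-\<^sup>k\<close>, so the monomials of degree \<open>k\<close> index a spanning set.
  It is independent if \<open>k = m - 1\<close>: the translation of \<open>P\<close> to the origin with \<open>q\<close> set to \<open>1\<close> sends
  it to distinct monomials of degree less than \<open>m\<close> and the ideal power to terms of degree at
  least \<open>m\<close>.
\<close>

lemma local_basis: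
  fixes P :: "'a::field ^ 'v::finite" and m b :: nat
  assumes P: "P \<noteq> 0" and m: "1 \<le> m"
  defines "k \<equiv> min b (m - 1)"
  shows "\<exists>\<beta> :: ('v \<Rightarrow>\<^sub>0 nat) \<Rightarrow> ('v, 'a) polynomial. (\<forall>t\<in>exponents k. \<beta> t \<in> forms b) \<and>
    (\<forall>f\<in>forms b. \<exists>c. f - (\<Sum>t\<in>exponents k. poly_const (c t) * \<beta> t) \<in> ideal_power (point_ideal P) m) \<and>
    (m - 1 \<le> b \<longrightarrow> (\<forall>c. (\<Sum>t\<in>exponents k. poly_const (c t) * \<beta> t) \<in> ideal_power (point_ideal P) m \<longrightarrow>
      (\<forall>t\<in>exponents k. c t = 0)))"
proof -
  let ?I = "ideal_power (point_ideal P)"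
  obtain v0 where v0: "P $ v0 \<noteq> 0" using P by (metis vec_eq_iff zero_index)
  define q where "q = (1 / P $ v0) *s (axis v0 1 :: 'a ^ 'v)"
  have qP: "pairing q P = 1" using v0 by (simp add: q_def pairing_scale pairing_axis)
  define l where "l v = (if v = v0 then q else axis v 1 - P $ v *s q)" for v
  define g where "g v = linear_form (l v)" for v
  have lP: "pairing (l v) P = 0" if "v \<noteq> v0" for v
    using that by (simp add: l_def pairing_diff pairing_axis pairing_scale qP)
  have g_forms: "g v \<in> forms 1" for v unfolding g_def by (rule linear_form_in_forms)
  have var_g: "variable v = (if v = v0 then poly_const (P $ v0) * g v0 else g v + poly_const (P $ v) * g v0)" for v
  proof (cases "v = v0")
    case True
    have "axis v0 1 = P $ v0 *s q" using v0 by (simp add: q_def)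
    then have "variable v0 = linear_form (P $ v0 *s q)" by (metis linear_form_axis)
    then show ?thesis using True by (simp add: g_def l_def linear_form_scale)
  next
    case False
    then show ?thesis by (simp add: g_def l_def linear_form_diff linear_form_scale linear_form_axis)
  qed
  have g_span: "g v \<in> pv.span (range g)" for v by (simp add: pv.span_base)
  have "variable v \<in> pv.span (range g)" for v
    unfolding var_g[of v] by (simp add: pv.span_add[OF g_span pv.span_scale[OF g_span]] pv.span_scale[OF g_span])
  then have spanning: "forms b \<subseteq> pv.span (monomial_value g ` exponents b)"
    by (rule monomials_in_linear_forms_span)
  define \<beta> where "\<beta> t = g v0 ^ (b - k) * monomial_value g t" for t
  have \<beta>_forms: "\<beta> t \<in> forms b" if "t \<in> exponents k" for t
  proof -
    have "\<beta> t \<in> forms (1 * (b - k) + exponent_degree t)"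
      unfolding \<beta>_def by (intro forms_mult forms_power forms_monomial_value g_forms)
    then show ?thesis using that by (simp add: exponents_def k_def)
  qed
  define W where "W = {f. \<exists>c. f - (\<Sum>t\<in>exponents k. poly_const (c t) * \<beta> t) \<in> ?I m}"
  have I_sub: "pv.subspace (?I m)" by (intro ideal_subspace_imp_pv ideal_power_subspace)
  have W_sub: "pv.subspace W"
  proof (rule pv.subspaceI)
    show "0 \<in> W" unfolding W_def using pv.subspace_0[OF I_sub]
      by (auto intro!: exI[of _ "\<lambda>_. 0"])
    show "f + h \<in> W" if fh: "f \<in> W" "h \<in> W" for f h
    proof -
      from fh obtain c d where "f - (\<Sum>t\<in>exponents k. poly_const (c t) * \<beta> t) \<in> ?I m"
        "h - (\<Sum>t\<in>exponents k. poly_const (d t) * \<beta> t) \<in> ?I m" unfolding W_def by blast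
      from pv.subspace_add[OF I_sub this]
      have "f + h - (\<Sum>t\<in>exponents k. poly_const (c t + d t) * \<beta> t) \<in> ?I m"
        by (simp add: single_add distrib_right sum.distrib algebra_simps)
      then show ?thesis unfolding W_def mem_Collect_eq by (rule exI[of _ "\<lambda>t. c t + d t"])
    qed
    show "poly_const a * f \<in> W" if f: "f \<in> W" for a f
    proof -
      from f obtain c where "f - (\<Sum>t\<in>exponents k. poly_const (c t) * \<beta> t) \<in> ?I m" unfolding W_def by blast
      from pv.subspace_scale[OF I_sub this, of a]
      have "poly_const a * f - (\<Sum>t\<in>exponents k. poly_const (a * c t) * \<beta> t) \<in> ?I m"
        by (simp add: right_diff_distrib sum_distrib_left mult_single flip: mult.assoc)
      then show ?thesis unfolding W_def mem_Collect_eq by (rule exI[of _ "\<lambda>t. a * c t"])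
    qed
  qed
  have "monomial_value g u \<in> W" if u: "u \<in> exponents b" for u
  proof (cases "b - k \<le> Poly_Mapping.lookup u v0")
    case True
    define t where "t = u - Poly_Mapping.single v0 (b - k)"
    have ut: "u = Poly_Mapping.single v0 (b - k) + t"
      by (rule poly_mapping_eqI) (use True in \<open>auto simp: t_def lookup_add lookup_minus lookup_single when_def\<close>)
    have deg: "exponent_degree (Poly_Mapping.single v0 j) = j" for j
      by (simp add: exponent_degree_def lookup_single when_def)
    have mono: "monomial_value g (Poly_Mapping.single v0 j) = g v0 ^ j" for j
    proof -
      have "monomial_value g (Poly_Mapping.single v0 j) = (\<Prod>v\<in>UNIV. if v = v0 then g v ^ j else 1)"
        unfolding monomial_value_def by (intro prod.cong) (auto simp: lookup_single when_def)
      then show ?thesis by simp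
    qed
    have t: "t \<in> exponents k"
      using u arg_cong[OF ut, of exponent_degree] by (simp add: exponents_def exponent_degree_add deg k_def)
    have "monomial_value g u = \<beta> t"
      unfolding \<beta>_def by (subst ut) (simp add: monomial_value_add mono)
    also have "\<dots> = (\<Sum>x\<in>exponents k. poly_const (if x = t then 1 else 0) * \<beta> x)"
    proof -
      have "(\<Sum>x\<in>exponents k. poly_const (if x = t then 1 else 0) * \<beta> x) = (\<Sum>x\<in>exponents k. if x = t then \<beta> x else 0)"
        by (intro sum.cong) auto
      then show ?thesis using t by (simp add: finite_exponents)
    qed
    finally have "monomial_value g u - (\<Sum>x\<in>exponents k. poly_const (if x = t then 1 else 0) * \<beta> x) \<in> ?I m"
      using pv.subspace_0[OF I_sub] by simp
    then show ?thesis unfolding W_def by (intro CollectI exI)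
  next
    case False
    then have "k = m - 1" by (auto simp: k_def min_def split: if_splits)
    have prod: "(\<Prod>v\<in>A. g v ^ Poly_Mapping.lookup u v) \<in> ?I (\<Sum>v\<in>A. Poly_Mapping.lookup u v)"
      if "v0 \<notin> A" for A
      using that
    proof (induction A rule: infinite_finite_induct)
      case (insert x A)
      then show ?case
        using lP[of x] by (auto simp: g_def intro!: ideal_power_power_mult form_in_point_ideal[OF linear_form_in_forms])
    qed simp_all
    have "(\<Sum>v\<in>UNIV - {v0}. Poly_Mapping.lookup u v) + Poly_Mapping.lookup u v0 = b"
      using u by (simp add: exponents_def exponent_degree_def sum.remove[of UNIV v0])
    then have "m \<le> (\<Sum>v\<in>UNIV - {v0}. Poly_Mapping.lookup u v)"
      using False \<open>k = m - 1\<close> m by linarith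
    then have "(\<Prod>v\<in>UNIV - {v0}. g v ^ Poly_Mapping.lookup u v) \<in> ?I m"
      using prod[of "UNIV - {v0}"] ideal_power_antimono by blast
    then have "g v0 ^ Poly_Mapping.lookup u v0 * (\<Prod>v\<in>UNIV - {v0}. g v ^ Poly_Mapping.lookup u v) \<in> ?I m"
      by (rule ideal_power_absorb)
    then have "monomial_value g u \<in> ?I m"
      by (simp add: monomial_value_def prod.remove[of UNIV v0])
    then show ?thesis unfolding W_def by (intro CollectI exI[of _ "\<lambda>_. 0"]) simp
  qed
  then have "pv.span (monomial_value g ` exponents b) \<subseteq> W"
    by (intro pv.span_minimal W_sub) blast
  then have spans: "\<forall>f\<in>forms b. \<exists>c. f - (\<Sum>t\<in>exponents k. poly_const (c t) * \<beta> t) \<in> ?I m"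
    using spanning unfolding W_def by blast

  \<comment> \<open>Taylor expansion at \<open>P\<close> in the affine chart \<open>q = 1\<close>, with the remaining variables as
      local coordinates\<close>
  define \<tau> where "\<tau> v = poly_const (P $ v) + (if v = v0 then 0 else variable v)" for v
  define \<theta> where "\<theta> = substitute poly_const \<tau>"
  have \<theta>_linear: "\<theta> (linear_form k) = poly_const (pairing k P) +
      (\<Sum>v\<in>UNIV. poly_const (k $ v) * (if v = v0 then 0 else variable v))" for k
  proof -
    have "poly_const (pairing k P) = (\<Sum>v\<in>UNIV. poly_const (k $ v) * poly_const (P $ v) :: ('v, 'a) polynomial)"
    proof -
      have "(poly_const (sum g A) :: ('v, 'a) polynomial) = (\<Sum>x\<in>A. poly_const (g x))" for g :: "'v \<Rightarrow> 'a" and A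
        by (induction A rule: infinite_finite_induct) (simp_all add: single_add)
      then show ?thesis by (simp add: pairing_def mult_single)
    qed
    then show ?thesis
      unfolding \<theta>_def linear_form_def const_hom.substitute_sum const_hom.substitute_mult
        const_hom.substitute_const const_hom.substitute_variable \<tau>_def
      by (simp only: distrib_left sum.distrib)
  qed
  have \<theta>_order: "\<theta> f \<in> order_at_least j" if "f \<in> ?I j" for f j
    using that
  proof (induction j arbitrary: f)
    case 0
    then show ?case by (simp add: order_at_least_def)
  next
    case (Suc j)
    from ideal_power_point_Suc[OF P Suc.prems] show ?case
    proof (induction rule: ideal.span_induct_alt)
      case base
      then show ?case using order_at_least_zero by (simp add: \<theta>_def)
    next
      case (step c x y)
      then obtain h f where x: "x = linear_form h * f" "pairing h P = 0" "f \<in> ?I j" by blast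
      have "\<theta> (linear_form h) \<in> order_at_least 1"
        unfolding \<theta>_linear x(2)
        by (auto intro!: order_at_least_add order_at_least_sum order_at_least_absorb order_at_least_zero order_at_least_variable[unfolded One_nat_def] simp: single_zero)
      from order_at_least_mult[OF this Suc.IH[OF x(3)]]
      have "\<theta> (linear_form h) * \<theta> f \<in> order_at_least (Suc j)" by simp
      then have "\<theta> c * (\<theta> (linear_form h) * \<theta> f) \<in> order_at_least (Suc j)"
        by (rule order_at_least_absorb)
      then show ?case
        using step.IH unfolding x(1) \<theta>_def const_hom.substitute_add const_hom.substitute_mult
        by (intro order_at_least_add)
    qed
  qed
  have \<theta>_g: "\<theta> (g v) = (if v = v0 then 1 else variable v)" for v
  proof -
    have \<theta>q: "\<theta> (linear_form q) = 1"
    proof -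
      have "(\<Sum>v\<in>UNIV. poly_const (q $ v) * (if v = v0 then 0 else variable v)) = 0"
        by (intro sum.neutral) (auto simp: q_def axis_def)
      then show ?thesis by (simp add: \<theta>_linear qP)
    qed
    have "\<theta> (linear_form (axis v 1 - P $ v *s q)) = \<tau> v - poly_const (P $ v)"
      unfolding linear_form_diff linear_form_scale linear_form_axis \<theta>_def
        const_hom.substitute_diff const_hom.substitute_mult const_hom.substitute_const const_hom.substitute_variable
      using \<theta>q by (simp add: \<theta>_def)
    then show ?thesis using \<theta>q by (simp add: g_def l_def \<tau>_def)
  qed
  define erase where "erase t = t - Poly_Mapping.single v0 (Poly_Mapping.lookup t v0)" for t :: "'v \<Rightarrow>\<^sub>0 nat"
  have lookup_erase: "Poly_Mapping.lookup (erase t) v = (if v = v0 then 0 else Poly_Mapping.lookup t v)" for t v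
    by (simp add: erase_def lookup_minus lookup_single when_def)
  have \<theta>_\<beta>: "\<theta> (\<beta> t) = Poly_Mapping.single (erase t) 1" for t
  proof -
    have "\<theta> (\<beta> t) = monomial_value (\<lambda>v. if v = v0 then 1 else variable v) t"
      using \<theta>_g unfolding \<beta>_def \<theta>_def const_hom.substitute_mult const_hom.substitute_power
        const_hom.substitute_monomial_value by simp
    also have "\<dots> = monomial_value variable (erase t)"
      unfolding monomial_value_def by (intro prod.cong) (auto simp: lookup_erase)
    finally show ?thesis by (simp add: monomial_value_variable)
  qed
  have "\<forall>t\<in>exponents k. c t = 0"
    if mb: "m - 1 \<le> b" and c: "(\<Sum>t\<in>exponents k. poly_const (c t) * \<beta> t) \<in> ?I m" for c
  proof
    fix t :: "'v \<Rightarrow>\<^sub>0 nat" assume t: "t \<in> exponents k"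
    have km: "k = m - 1" using mb by (simp add: k_def)
    have split: "exponent_degree u = Poly_Mapping.lookup u v0 + exponent_degree (erase u)" for u
    proof -
      have "exponent_degree (erase u) = (\<Sum>v\<in>UNIV - {v0}. Poly_Mapping.lookup u v)"
        unfolding exponent_degree_def sum.remove[of UNIV v0 "Poly_Mapping.lookup (erase u)", simplified]
        by (simp add: lookup_erase)
      then show ?thesis by (simp add: exponent_degree_def sum.remove[of UNIV v0])
    qed
    have inj: "erase u = erase t \<longleftrightarrow> u = t" if u: "u \<in> exponents k" for u
    proof
      assume eq: "erase u = erase t"
      have "Poly_Mapping.lookup u v0 = Poly_Mapping.lookup t v0"
        using u t eq split[of u] split[of t] by (simp add: exponents_def)
      then show "u = t"
        using arg_cong[OF eq, of Poly_Mapping.lookup] lookup_erase by (intro poly_mapping_eqI) metis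
    qed simp
    have "\<theta> (\<Sum>t\<in>exponents k. poly_const (c t) * \<beta> t) = (\<Sum>t\<in>exponents k. Poly_Mapping.single (erase t) (c t))"
      using \<theta>_\<beta> unfolding \<theta>_def const_hom.substitute_sum const_hom.substitute_mult const_hom.substitute_const
      by (simp add: mult_single)
    then have "(\<Sum>t\<in>exponents k. Poly_Mapping.single (erase t) (c t)) \<in> order_at_least m"
      using \<theta>_order[OF c] by simp
    moreover have "exponent_degree (erase t) < m" using split[of t] t km m by (simp add: exponents_def)
    ultimately have "Poly_Mapping.lookup (\<Sum>t\<in>exponents k. Poly_Mapping.single (erase t) (c t)) (erase t) = 0"
      by (metis (mono_tags, lifting) order_at_least_def in_keys_iff mem_Collect_eq not_le)
    moreover have "Poly_Mapping.lookup (\<Sum>t\<in>exponents k. Poly_Mapping.single (erase t) (c t)) (erase t)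
      = (\<Sum>u\<in>exponents k. if u = t then c u else 0)"
      unfolding lookup_sum by (intro sum.cong) (auto simp: lookup_single when_def inj)
    ultimately show "c t = 0" using t by (simp add: finite_exponents)
  qed
  then show ?thesis using \<beta>_forms spans by (intro exI[of _ \<beta>] conjI ballI allI impI) simp_all
qed


section \<open>Bases of graded components\<close>

lemma basis_of_component_indexed:
  assumes I: "pv.subspace I" and J: "finite J" and F: "\<And>j. j \<in> J \<Longrightarrow> F j \<in> forms b"
    and indep: "\<And>c. (\<Sum>j\<in>J. poly_const (c j) * F j) \<in> I \<Longrightarrow> \<forall>j\<in>J. c j = 0"
    and span: "\<And>f. f \<in> forms b \<Longrightarrow> \<exists>c. f - (\<Sum>j\<in>J. poly_const (c j) * F j) \<in> I"
  shows "basis_of_component I b (F ` J)" and "card (F ` J) = card J"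
proof -
  have inj: "inj_on F J"
  proof (rule inj_onI, rule ccontr)
    fix x y assume xy: "x \<in> J" "y \<in> J" "F x = F y" "x \<noteq> y"
    define c where "c j = (if j = x then 1 else 0) - (if j = y then 1 else (0::'a))" for j
    have "(\<Sum>j\<in>J. poly_const (c j) * F j) = (\<Sum>j\<in>J. if j = x then F j else 0) - (\<Sum>j\<in>J. if j = y then F j else 0)"
      unfolding sum_subtractf[symmetric]
      by (intro sum.cong) (auto simp: c_def single_diff left_diff_distrib single_uminus)
    also have "\<dots> = 0" using xy J by simp
    finally have "\<forall>j\<in>J. c j = 0" using indep[of c] pv.subspace_0[OF I] by simp
    then show False using xy by (auto simp: c_def)
  qed
  then show "card (F ` J) = card J" by (rule card_image)
  have "\<forall>x\<in>F ` J. c x = 0" if "(\<Sum>x\<in>F ` J. poly_const (c x) * x) \<in> I" for c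
    using indep[of "\<lambda>j. c (F j)"] that by (simp add: sum.reindex[OF inj])
  moreover have "\<exists>c. f - (\<Sum>x\<in>F ` J. poly_const (c x) * x) \<in> I" if f: "f \<in> forms b" for f
  proof -
    obtain c where c: "f - (\<Sum>j\<in>J. poly_const (c j) * F j) \<in> I" using span[OF f] by blast
    have "(\<Sum>x\<in>F ` J. poly_const (c (inv_into J F x)) * x) = (\<Sum>j\<in>J. poly_const (c j) * F j)"
      by (simp add: sum.reindex[OF inj] inv_into_f_f[OF inj])
    then show ?thesis using c by (intro exI[of _ "\<lambda>x. c (inv_into J F x)"]) simp
  qed
  ultimately show "basis_of_component I b (F ` J)"
    unfolding basis_of_component_def using J F by auto
qed

lemma card_basis_of_component_le:
  assumes I: "pv.subspace I" and B: "basis_of_component I b B" and C: "basis_of_component I b C"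
  shows "card B \<le> card C"
proof (rule pv.card_independent_modulo_le[OF I])
  show "finite B" "finite C" using B C by (auto simp: basis_of_component_def)
  show "\<forall>x\<in>B. c x = 0" if "(\<Sum>x\<in>B. poly_const (c x) * x) \<in> I" for c
    using B that by (auto simp: basis_of_component_def)
  show "B \<subseteq> pv.span (C \<union> I)"
  proof
    fix x assume "x \<in> B"
    then have "x \<in> forms b" using B by (auto simp: basis_of_component_def)
    then obtain c where c: "x - (\<Sum>y\<in>C. poly_const (c y) * y) \<in> I"
      using C unfolding basis_of_component_def by blast
    have "(x - (\<Sum>y\<in>C. poly_const (c y) * y)) + (\<Sum>y\<in>C. poly_const (c y) * y) \<in> pv.span (C \<union> I)"
      using c by (intro pv.span_add[OF pv.span_base pv.span_sum[OF pv.span_scale[OF pv.span_base]]]) auto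
    then show "x \<in> pv.span (C \<union> I)" by simp
  qed
qed

lemma hilbert_function_eq_card:
  assumes "pv.subspace I" "basis_of_component I b B"
  shows "hilbert_function I b = card B"
  unfolding hilbert_function_def
  using someI[of "basis_of_component I b" B] assms card_basis_of_component_le by (metis order_antisym)

lemma fat_ideal_iff: "f \<in> fat_ideal s P m \<longleftrightarrow> (\<forall>i\<in>{1..s}. f \<in> ideal_power (point_ideal (P i)) (m i))"
  by (simp add: fat_ideal_def)

lemma ideal_power_pv_subspace: "pv.subspace (ideal_power I k)"
  by (intro ideal_subspace_imp_pv ideal_power_subspace)

lemma fat_ideal_pv_subspace: "pv.subspace (fat_ideal s P m)"
  unfolding fat_ideal_def by (intro pv.subspace_Inter) (auto simp: ideal_power_pv_subspace)

text \<open>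
  The solutions of the congruences that are a local basis element at one point and zero at the
  others form a basis of the graded component.
\<close>

lemma hilbert_function_if_congruences:
  fixes P :: "nat \<Rightarrow> 'a::field ^ 'v::finite"
  assumes P: "\<And>i. i \<in> {1..s} \<Longrightarrow> P i \<noteq> 0 \<and> 1 \<le> m i \<and> m i - 1 \<le> b"
    and crt: "\<And>g. (\<And>i. i \<in> {1..s} \<Longrightarrow> g i \<in> forms b) \<Longrightarrow>
      \<exists>f\<in>forms b. \<forall>i\<in>{1..s}. f - g i \<in> ideal_power (point_ideal (P i)) (m i)"
  shows "hilbert_function (fat_ideal s P m) b = (\<Sum>i=1..s. card (exponents (m i - 1) :: ('v \<Rightarrow>\<^sub>0 nat) set))"
proof -
  let ?T = "\<lambda>i. exponents (m i - 1) :: ('v \<Rightarrow>\<^sub>0 nat) set"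
  let ?I = "\<lambda>i. ideal_power (point_ideal (P i)) (m i)"
  define local_basis_at where "local_basis_at i \<beta> \<longleftrightarrow> (\<forall>t\<in>?T i. \<beta> t \<in> forms b) \<and>
    (\<forall>f\<in>forms b. \<exists>c. f - (\<Sum>t\<in>?T i. poly_const (c t) * \<beta> t) \<in> ?I i) \<and>
    (\<forall>c. (\<Sum>t\<in>?T i. poly_const (c t) * \<beta> t) \<in> ?I i \<longrightarrow> (\<forall>t\<in>?T i. c t = 0))" for i \<beta>
  have "\<forall>i\<in>{1..s}. \<exists>\<beta>. local_basis_at i \<beta>"
  proof
    fix i assume i: "i \<in> {1..s}"
    then have "min b (m i - 1) = m i - 1" using P by (simp add: min_absorb2)
    then show "\<exists>\<beta>. local_basis_at i \<beta>"
      using local_basis[of "P i" "m i" b] P[OF i] unfolding local_basis_at_def by simp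
  qed
  from bchoice[OF this] obtain \<beta> where "\<forall>i\<in>{1..s}. local_basis_at i (\<beta> i)" by blast
  then have \<beta>: "\<And>i t. i \<in> {1..s} \<Longrightarrow> t \<in> ?T i \<Longrightarrow> \<beta> i t \<in> forms b"
    "\<And>i f. i \<in> {1..s} \<Longrightarrow> f \<in> forms b \<Longrightarrow> \<exists>c. f - (\<Sum>t\<in>?T i. poly_const (c t) * \<beta> i t) \<in> ?I i"
    "\<And>i c. i \<in> {1..s} \<Longrightarrow> (\<Sum>t\<in>?T i. poly_const (c t) * \<beta> i t) \<in> ?I i \<Longrightarrow> \<forall>t\<in>?T i. c t = 0"
    unfolding local_basis_at_def by simp_all
  define J where "J = Sigma {1..s} ?T"
  have finJ: "finite J" by (simp add: J_def finite_exponents)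
  have "\<exists>f\<in>forms b. \<forall>k\<in>{1..s}. f - (if k = fst j then \<beta> (fst j) (snd j) else 0) \<in> ?I k"
    if "j \<in> J" for j
    using that \<beta>(1) by (intro crt) (auto simp: J_def)
  then obtain F where F: "\<And>j. j \<in> J \<Longrightarrow> F j \<in> forms b"
    "\<And>j k. j \<in> J \<Longrightarrow> k \<in> {1..s} \<Longrightarrow> F j - (if k = fst j then \<beta> (fst j) (snd j) else 0) \<in> ?I k"
    by metis
  have local: "(\<Sum>j\<in>J. poly_const (c j) * F j) - (\<Sum>t\<in>?T k. poly_const (c (k, t)) * \<beta> k t) \<in> ?I k"
    if k: "k \<in> {1..s}" for c k
  proof -
    have "(\<Sum>j\<in>J. poly_const (c j) * (if k = fst j then \<beta> (fst j) (snd j) else 0))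
      = (\<Sum>i\<in>{1..s}. \<Sum>t\<in>?T i. poly_const (c (i, t)) * (if k = i then \<beta> i t else 0))"
      unfolding J_def by (subst sum.Sigma) (auto simp: finite_exponents intro!: sum.cong)
    also have "\<dots> = (\<Sum>i\<in>{1..s}. if i = k then \<Sum>t\<in>?T i. poly_const (c (i, t)) * \<beta> i t else 0)"
      by (intro sum.cong) auto
    also have "\<dots> = (\<Sum>t\<in>?T k. poly_const (c (k, t)) * \<beta> k t)" using k by simp
    finally have "(\<Sum>j\<in>J. poly_const (c j) * F j) - (\<Sum>t\<in>?T k. poly_const (c (k, t)) * \<beta> k t)
      = (\<Sum>j\<in>J. poly_const (c j) * (F j - (if k = fst j then \<beta> (fst j) (snd j) else 0)))"
      by (simp add: right_diff_distrib sum_subtractf)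
    also have "\<dots> \<in> ?I k"
      using F(2) k by (intro pv.subspace_sum pv.subspace_scale ideal_power_pv_subspace) auto
    finally show ?thesis .
  qed
  have indep: "\<forall>j\<in>J. c j = 0" if c: "(\<Sum>j\<in>J. poly_const (c j) * F j) \<in> fat_ideal s P m" for c
  proof
    fix j assume j: "j \<in> J"
    obtain k t where kt: "j = (k, t)" "k \<in> {1..s}" "t \<in> ?T k" using j by (auto simp: J_def)
    have "(\<Sum>j\<in>J. poly_const (c j) * F j) \<in> ?I k" using c kt(2) unfolding fat_ideal_iff by blast
    from pv.subspace_diff[OF ideal_power_pv_subspace this local[OF kt(2), of c]]
    have "(\<Sum>t\<in>?T k. poly_const (c (k, t)) * \<beta> k t) \<in> ?I k" by simp
    then show "c j = 0" using \<beta>(3)[OF kt(2), of "\<lambda>t. c (k, t)"] kt by blast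
  qed
  have spans: "\<exists>c. f - (\<Sum>j\<in>J. poly_const (c j) * F j) \<in> fat_ideal s P m" if f: "f \<in> forms b" for f
  proof -
    have "\<forall>i\<in>{1..s}. \<exists>c. f - (\<Sum>t\<in>?T i. poly_const (c t) * \<beta> i t) \<in> ?I i"
      using \<beta>(2) f by simp
    from bchoice[OF this] obtain c where
      "\<forall>i\<in>{1..s}. f - (\<Sum>t\<in>?T i. poly_const (c i t) * \<beta> i t) \<in> ?I i"
      by (elim exE) (rule that)
    then have c: "\<And>i. i \<in> {1..s} \<Longrightarrow> f - (\<Sum>t\<in>?T i. poly_const (c i t) * \<beta> i t) \<in> ?I i"
      by simp
    define d where "d j = c (fst j) (snd j)" for j
    have "f - (\<Sum>j\<in>J. poly_const (d j) * F j) \<in> ?I k" if k: "k \<in> {1..s}" for k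
    proof -
      have "(f - (\<Sum>t\<in>?T k. poly_const (c k t) * \<beta> k t)) -
        ((\<Sum>j\<in>J. poly_const (d j) * F j) - (\<Sum>t\<in>?T k. poly_const (d (k, t)) * \<beta> k t)) \<in> ?I k"
        by (intro pv.subspace_diff[OF ideal_power_pv_subspace] c local k)
      then show ?thesis by (simp add: d_def)
    qed
    then show ?thesis unfolding fat_ideal_iff by blast
  qed
  note basis = basis_of_component_indexed[of "fat_ideal s P m", OF fat_ideal_pv_subspace finJ F(1) indep spans]
  then have "hilbert_function (fat_ideal s P m) b = card J"
    using hilbert_function_eq_card[OF fat_ideal_pv_subspace basis(1)] by simp
  then show ?thesis by (simp add: J_def finite_exponents)
qed

section \<open>Products of graded components\<close>

interpretation families: vector_space
  "\<lambda>(c::'a::field) (h :: nat \<Rightarrow> ('v::finite, 'a) polynomial) i. poly_const c * h i"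
  by unfold_locales
    (rule ext, simp add: distrib_left distrib_right single_add mult_single flip: mult.assoc)+

lemma sum_families_apply: "(\<Sum>x\<in>A. (H x :: nat \<Rightarrow> ('v::finite, 'a::field) polynomial)) i = (\<Sum>x\<in>A. H x i)"
  by (induction A rule: infinite_finite_induct) auto

text \<open>
  The space of families of forms of degree \<open>b\<close>, one for each point, has dimension at most the sum
  of the local contributions modulo the families that vanish to the prescribed orders.
\<close>

lemma card_independent_families_le:
  fixes P :: "nat \<Rightarrow> 'a::field ^ 'v::finite"
  assumes P: "\<And>i. i \<in> {1..s} \<Longrightarrow> P i \<noteq> 0 \<and> 1 \<le> m i"
    and B: "finite B" "\<And>h i. h \<in> B \<Longrightarrow> i \<in> {1..s} \<Longrightarrow> h i \<in> forms b"
    and indep: "\<And>c. (\<And>i. i \<in> {1..s} \<Longrightarrow> (\<Sum>h\<in>B. poly_const (c h) * h i) \<in> ideal_power (point_ideal (P i)) (m i))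
      \<Longrightarrow> \<forall>h\<in>B. c h = 0"
  shows "card B \<le> (\<Sum>i=1..s. card (exponents (min b (m i - 1)) :: ('v \<Rightarrow>\<^sub>0 nat) set))"
proof -
  let ?T = "\<lambda>i. exponents (min b (m i - 1)) :: ('v \<Rightarrow>\<^sub>0 nat) set"
  let ?I = "\<lambda>i. ideal_power (point_ideal (P i)) (m i)"
  define N where "N = {h :: nat \<Rightarrow> ('v, 'a) polynomial. \<forall>i\<in>{1..s}. h i \<in> ?I i}"
  have N: "families.subspace N"
    by (rule families.subspaceI)
      (auto simp: N_def pv.subspace_0[OF ideal_power_pv_subspace] pv.subspace_add[OF ideal_power_pv_subspace]
        pv.subspace_scale[OF ideal_power_pv_subspace])
  define spans_at where "spans_at i \<beta> \<longleftrightarrow>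
    (\<forall>f\<in>forms b. \<exists>c. f - (\<Sum>t\<in>?T i. poly_const (c t) * \<beta> t) \<in> ?I i)" for i \<beta>
  have "\<forall>i\<in>{1..s}. \<exists>\<beta>. spans_at i \<beta>"
    using local_basis[of "P i" "m i" b for i] P unfolding spans_at_def by blast
  from bchoice[OF this] obtain \<beta> where "\<forall>i\<in>{1..s}. spans_at i (\<beta> i)" by blast
  then have
    \<beta>: "\<And>i f. i \<in> {1..s} \<Longrightarrow> f \<in> forms b \<Longrightarrow> \<exists>c. f - (\<Sum>t\<in>?T i. poly_const (c t) * \<beta> i t) \<in> ?I i"
    unfolding spans_at_def by blast
  define J where "J = Sigma {1..s} ?T"
  define \<delta> where "\<delta> j = (\<lambda>k. if k = fst j then \<beta> (fst j) (snd j) else 0)" for j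
  have finJ: "finite J" by (simp add: J_def finite_exponents)
  have "card B \<le> card (\<delta> ` J)"
  proof (rule families.card_independent_modulo_le[OF N B(1)])
    show "finite (\<delta> ` J)" using finJ by simp
    show "\<forall>h\<in>B. c h = 0" if "(\<Sum>h\<in>B. (\<lambda>i. poly_const (c h) * h i)) \<in> N" for c
      using that by (intro indep) (simp add: N_def sum_families_apply)
    show "B \<subseteq> families.span (\<delta> ` J \<union> N)"
    proof
      fix h assume h: "h \<in> B"
      have "\<forall>i\<in>{1..s}. \<exists>c. h i - (\<Sum>t\<in>?T i. poly_const (c t) * \<beta> i t) \<in> ?I i"
        using \<beta> B(2)[OF h] by simp
      from bchoice[OF this] obtain c where
        "\<forall>i\<in>{1..s}. h i - (\<Sum>t\<in>?T i. poly_const (c i t) * \<beta> i t) \<in> ?I i"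
        by (elim exE) (rule that)
      then have c: "\<And>i. i \<in> {1..s} \<Longrightarrow> h i - (\<Sum>t\<in>?T i. poly_const (c i t) * \<beta> i t) \<in> ?I i"
        by simp
      define g where "g = (\<Sum>j\<in>J. (\<lambda>k. poly_const (c (fst j) (snd j)) * \<delta> j k))"
      have g_apply: "g k = (\<Sum>t\<in>?T k. poly_const (c k t) * \<beta> k t)" if k: "k \<in> {1..s}" for k
      proof -
        have "g k = (\<Sum>i\<in>{1..s}. \<Sum>t\<in>?T i. poly_const (c i t) * (if k = i then \<beta> i t else 0))"
          unfolding g_def sum_families_apply J_def \<delta>_def
          by (subst sum.Sigma) (auto simp: finite_exponents intro!: sum.cong)
        also have "\<dots> = (\<Sum>i\<in>{1..s}. if i = k then \<Sum>t\<in>?T i. poly_const (c i t) * \<beta> i t else 0)"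
          by (intro sum.cong) auto
        also have "\<dots> = (\<Sum>t\<in>?T k. poly_const (c k t) * \<beta> k t)" using k by simp
        finally show ?thesis .
      qed
      have "g \<in> families.span (\<delta> ` J \<union> N)"
        unfolding g_def by (intro families.span_sum families.span_scale families.span_base) auto
      moreover have "h - g \<in> N"
        using c by (simp add: N_def g_apply)
      then have "h - g \<in> families.span (\<delta> ` J \<union> N)" by (intro families.span_base) auto
      ultimately have "g + (h - g) \<in> families.span (\<delta> ` J \<union> N)" by (rule families.span_add)
      then show "h \<in> families.span (\<delta> ` J \<union> N)" by simp
    qed
  qed
  also have "\<dots> \<le> card J" using finJ by (rule card_image_le)
  also have "\<dots> = (\<Sum>i=1..s. card (?T i))" by (simp add: J_def finite_exponents)
  finally show ?thesis .
qed

lemma card_independent_forms_le: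
  fixes P :: "nat \<Rightarrow> 'a::field ^ 'v::finite"
  assumes P: "\<And>i. i \<in> {1..s} \<Longrightarrow> P i \<noteq> 0 \<and> 1 \<le> m i"
    and B: "finite B" "B \<subseteq> forms b"
    and indep: "\<And>c. (\<Sum>f\<in>B. poly_const (c f) * f) \<in> fat_ideal s P m \<Longrightarrow> \<forall>f\<in>B. c f = 0"
  shows "card B \<le> (\<Sum>i=1..s. card (exponents (min b (m i - 1)) :: ('v \<Rightarrow>\<^sub>0 nat) set))"
proof -
  define diag where "diag f = (\<lambda>i :: nat. f)" for f :: "('v, 'a) polynomial"
  have diag_apply: "diag f i = f" for f i by (simp add: diag_def)
  have inj: "inj_on diag A" for A by (auto simp: inj_on_def diag_def fun_eq_iff)
  have "card (diag ` B) \<le> (\<Sum>i=1..s. card (exponents (min b (m i - 1)) :: ('v \<Rightarrow>\<^sub>0 nat) set))"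
  proof (rule card_independent_families_le[of s P m, OF P])
    show "finite (diag ` B)" using B(1) by simp
    show "h i \<in> forms b" if "h \<in> diag ` B" for h i using that B(2) by (auto simp: diag_def)
    show "\<forall>h\<in>diag ` B. c h = 0"
      if "\<And>i. i \<in> {1..s} \<Longrightarrow> (\<Sum>h\<in>diag ` B. poly_const (c h) * h i) \<in> ideal_power (point_ideal (P i)) (m i)" for c
    proof -
      have "(\<Sum>f\<in>B. poly_const (c (diag f)) * f) \<in> fat_ideal s P m"
        using that unfolding fat_ideal_iff by (simp add: sum.reindex[OF inj] diag_apply)
      from indep[OF this] show ?thesis by blast
    qed
  qed
  then show ?thesis by (simp add: card_image[OF inj])
qed

text \<open>
  An independent set of maximal cardinality spans. This justifies the choice operator in the
  definition of the Hilbert function.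
\<close>

lemma exists_basis_of_component:
  fixes P :: "nat \<Rightarrow> 'a::field ^ 'v::finite"
  assumes P: "\<And>i. i \<in> {1..s} \<Longrightarrow> P i \<noteq> 0 \<and> 1 \<le> m i"
  shows "\<exists>B. basis_of_component (fat_ideal s P m) b B"
proof -
  let ?I = "fat_ideal s P m"
  define Q where "Q B \<longleftrightarrow> finite B \<and> B \<subseteq> forms b \<and>
    (\<forall>c. (\<Sum>f\<in>B. poly_const (c f) * f) \<in> ?I \<longrightarrow> (\<forall>f\<in>B. c f = 0))" for B
  have "Q {}" by (simp add: Q_def)
  moreover have "\<forall>B. Q B \<longrightarrow> card B < Suc (\<Sum>i=1..s. card (exponents (min b (m i - 1)) :: ('v \<Rightarrow>\<^sub>0 nat) set))"
  proof (intro allI impI)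
    fix B assume "Q B"
    then show "card B < Suc (\<Sum>i=1..s. card (exponents (min b (m i - 1)) :: ('v \<Rightarrow>\<^sub>0 nat) set))"
      unfolding less_Suc_eq_le by (intro card_independent_forms_le[of s P m, OF P]) (simp_all add: Q_def)
  qed
  ultimately obtain B where B: "Q B" "\<And>C. Q C \<Longrightarrow> card C \<le> card B"
    using ex_has_greatest_nat[of Q "{}" card] by blast
  have "\<exists>c. f - (\<Sum>x\<in>B. poly_const (c x) * x) \<in> ?I" if f: "f \<in> forms b" for f
  proof (rule ccontr)
    assume "\<not> ?thesis"
    then have neg: "f - (\<Sum>x\<in>B. poly_const (c x) * x) \<notin> ?I" for c by blast
    have fB: "f \<notin> B"
    proof
      assume "f \<in> B"
      have "(\<Sum>x\<in>B. poly_const (if x = f then 1 else 0) * x) = (\<Sum>x\<in>B. if x = f then x else 0)"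
        by (intro sum.cong) auto
      then have "f - (\<Sum>x\<in>B. poly_const (if x = f then 1 else 0) * x) = 0"
        using B(1) \<open>f \<in> B\<close> by (simp add: Q_def)
      then show False
        using neg[of "\<lambda>x. if x = f then 1 else 0"] pv.subspace_0[OF fat_ideal_pv_subspace, of s P m] by simp
    qed
    have "\<forall>x\<in>insert f B. c x = 0" if c: "(\<Sum>x\<in>insert f B. poly_const (c x) * x) \<in> ?I" for c
    proof -
      have c': "poly_const (c f) * f + (\<Sum>x\<in>B. poly_const (c x) * x) \<in> ?I"
        using c fB B(1) by (simp add: Q_def)
      have "c f = 0"
      proof (rule ccontr)
        assume "c f \<noteq> 0"
        have "poly_const (1 / c f) * (poly_const (c f) * f + (\<Sum>x\<in>B. poly_const (c x) * x))
          = f - (\<Sum>x\<in>B. poly_const (- c x / c f) * x)"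
          using \<open>c f \<noteq> 0\<close> by (simp add: distrib_left sum_distrib_left mult_single single_uminus sum_negf flip: mult.assoc)
        then have "f - (\<Sum>x\<in>B. poly_const (- c x / c f) * x) \<in> ?I"
          using pv.subspace_scale[OF fat_ideal_pv_subspace c', of "1 / c f"] by (simp only:)
        then show False using neg[of "\<lambda>x. - c x / c f"] by (simp only:)
      qed
      then show ?thesis using c' B(1) by (simp add: Q_def)
    qed
    then have "Q (insert f B)" using B(1) f by (simp add: Q_def)
    from B(2)[OF this] show False using fB B(1) by (simp add: Q_def)
  qed
  then have "basis_of_component ?I b B" using B(1) unfolding Q_def basis_of_component_def by simp
  then show ?thesis by blast
qed

text \<open>
  If the Hilbert function reaches the degree, the diagonal images of a basis fill the product of
  the local quotients. So no local contribution is smaller than in high degree, which means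
  \<open>m i - 1 \<le> b\<close>, and the family that is \<open>G\<close> at \<open>P i\<close> and zero elsewhere is not independent of the
  diagonal.
\<close>

lemma congruences_if_hilbert_function:
  fixes P :: "nat \<Rightarrow> 'a::field ^ 'v::finite"
  assumes card: "2 \<le> CARD('v)"
    and P: "\<And>i. i \<in> {1..s} \<Longrightarrow> P i \<noteq> 0 \<and> 1 \<le> m i"
    and H: "hilbert_function (fat_ideal s P m) b = (\<Sum>i=1..s. card (exponents (m i - 1) :: ('v \<Rightarrow>\<^sub>0 nat) set))"
    and i: "i \<in> {1..s}"
  shows "m i - 1 \<le> b" and "G \<in> forms b \<Longrightarrow>
    \<exists>F\<in>forms b. \<forall>k\<in>{1..s}. F - (if k = i then G else 0) \<in> ideal_power (point_ideal (P k)) (m k)"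
proof -
  let ?T = "\<lambda>k. exponents k :: ('v \<Rightarrow>\<^sub>0 nat) set"
  let ?I = "\<lambda>i. ideal_power (point_ideal (P i)) (m i)"
  obtain B where B: "basis_of_component (fat_ideal s P m) b B" using exists_basis_of_component[of s P m, OF P] by blast
  then have cardB: "card B = (\<Sum>i=1..s. card (?T (m i - 1)))"
    using hilbert_function_eq_card[OF fat_ideal_pv_subspace B] H by simp
  have B': "finite B" "B \<subseteq> forms b"
    "\<And>c. (\<Sum>f\<in>B. poly_const (c f) * f) \<in> fat_ideal s P m \<Longrightarrow> \<forall>f\<in>B. c f = 0"
    using B by (auto simp: basis_of_component_def)
  have mono: "card (?T (min b k)) \<le> card (?T k)" for k
    using card_exponents_strict_mono[OF card, of "min b k" k] by (cases "b < k") auto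
  show "m i - 1 \<le> b"
  proof (rule ccontr)
    assume "\<not> m i - 1 \<le> b"
    then have "card (?T (min b (m i - 1))) < card (?T (m i - 1))"
      by (intro card_exponents_strict_mono card) auto
    then have "(\<Sum>i=1..s. card (?T (min b (m i - 1)))) < (\<Sum>i=1..s. card (?T (m i - 1)))"
      using mono i by (intro sum_strict_mono_ex1) auto
    then show False using card_independent_forms_le[of s P m, OF P B'] cardB by simp
  qed
  show "\<exists>F\<in>forms b. \<forall>k\<in>{1..s}. F - (if k = i then G else 0) \<in> ?I k" if G: "G \<in> forms b"
  proof (rule ccontr)
    assume neg: "\<not> ?thesis"
    define diag where "diag f = (\<lambda>i :: nat. f)" for f :: "('v, 'a) polynomial"
    have diag_apply: "diag f i = f" for f i by (simp add: diag_def)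
    have inj: "inj_on diag A" for A by (auto simp: inj_on_def diag_def fun_eq_iff)
    define \<delta> where "\<delta> = (\<lambda>k. if k = i then G else 0)"
    have \<delta>_apply: "\<delta> k = (if k = i then G else 0)" for k by (simp add: \<delta>_def)
    have new: "\<delta> \<notin> diag ` B"
    proof
      assume "\<delta> \<in> diag ` B"
      then obtain f where f: "f \<in> B" "\<delta> = diag f" by blast
      then have "f - (if k = i then G else 0) = 0" for k by (auto simp: \<delta>_def diag_def fun_eq_iff)
      then show False
        using neg f B'(2) pv.subspace_0[OF ideal_power_pv_subspace] by (metis subsetD)
    qed
    have "card (insert \<delta> (diag ` B)) \<le> (\<Sum>i=1..s. card (?T (min b (m i - 1))))"
    proof (rule card_independent_families_le[of s P m, OF P])
      show "finite (insert \<delta> (diag ` B))" using B'(1) by simp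
      show "h i \<in> forms b" if "h \<in> insert \<delta> (diag ` B)" for h i
        using that B'(2) G by (auto simp: diag_def \<delta>_def)
      show "\<forall>h\<in>insert \<delta> (diag ` B). c h = 0"
        if c: "\<And>i. i \<in> {1..s} \<Longrightarrow> (\<Sum>h\<in>insert \<delta> (diag ` B). poly_const (c h) * h i) \<in> ?I i" for c
      proof -
        let ?f = "\<Sum>f\<in>B. poly_const (c (diag f)) * f"
        have c': "poly_const (c \<delta>) * (if k = i then G else 0) + ?f \<in> ?I k" if "k \<in> {1..s}" for k
          using c[OF that] new B'(1) by (simp add: sum.reindex[OF inj] diag_apply \<delta>_apply)
        have "c \<delta> = 0"
        proof (rule ccontr)
          assume nz: "c \<delta> \<noteq> 0"
          define F where "F = poly_const (- 1 / c \<delta>) * ?f"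
          have "F - (if k = i then G else 0) \<in> ?I k" if k: "k \<in> {1..s}" for k
          proof -
            have "poly_const (- 1 / c \<delta>) * (poly_const (c \<delta>) * (if k = i then G else 0) + ?f) \<in> ?I k"
              by (rule pv.subspace_scale[OF ideal_power_pv_subspace c'[OF k]])
            moreover have "poly_const (- 1 / c \<delta>) * (poly_const (c \<delta>) * x) = - x" for x :: "('v, 'a) polynomial"
              using nz by (simp add: mult_single single_uminus flip: mult.assoc)
            ultimately show ?thesis by (simp only: F_def distrib_left add.commute[of "- _"] diff_conv_add_uminus)
          qed
          moreover have "F \<in> forms b"
            unfolding F_def using B'(2) by (intro forms_scale forms_sum) auto
          ultimately show False using neg by blast
        qed
        then have "?f \<in> fat_ideal s P m" using c' unfolding fat_ideal_iff by simp
        from B'(3)[OF this] \<open>c \<delta> = 0\<close> show ?thesis by auto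
      qed
    qed
    also have "\<dots> \<le> (\<Sum>i=1..s. card (?T (m i - 1)))" by (intro sum_mono mono)
    finally show False using new B'(1) cardB by (simp add: card_image[OF inj])
  qed
qed

lemma fat_degree_eq:
  fixes P :: "nat \<Rightarrow> 'a::field ^ 'v::finite"
  assumes "\<And>i. i \<in> {1..s} \<Longrightarrow> 1 \<le> m i"
  shows "fat_degree s P m = (\<Sum>i=1..s. card (exponents (m i - 1) :: ('v \<Rightarrow>\<^sub>0 nat) set))"
  unfolding fat_degree_def Let_def using assms by (intro sum.cong refl card_exponents_pred[symmetric]) auto


section \<open>Restriction to a rational normal curve\<close>

interpretation curve_hom: coefficient_hom "\<lambda>c::'a::field. [:c:]"
  by unfold_locales (simp_all add: one_pCons)

definition curve_coordinate :: "(nat \<Rightarrow> 'a::field ^ 'v::finite) \<Rightarrow> nat \<Rightarrow> 'v \<Rightarrow> 'a poly" where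
  "curve_coordinate e d v = (\<Sum>i\<le>d. monom (e i $ v) i)"

text \<open>
  Restriction to the affine chart \<open>t \<mapsto> \<Sum>i\<le>d. t\<^sup>i e i\<close> of the curve. The point at infinity is \<open>e d\<close>;
  its chart is the same construction for the reversed basis \<open>\<lambda>i. e (d - i)\<close> at \<open>t = 0\<close>. Over a
  finite field all rational points of the curve may occur, so infinity cannot be moved away.
\<close>

definition restrict_to_curve ::
  "(nat \<Rightarrow> 'a::field ^ 'v::finite) \<Rightarrow> nat \<Rightarrow> ('v, 'a) polynomial \<Rightarrow> 'a poly" where
  "restrict_to_curve e d = substitute (\<lambda>c. [:c:]) (curve_coordinate e d)"

definition curve_point :: "(nat \<Rightarrow> 'a::field ^ 'v::finite) \<Rightarrow> nat \<Rightarrow> 'a \<Rightarrow> 'a ^ 'v" where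
  "curve_point e d t = (\<Sum>i\<le>d. t ^ i *s e i)"

lemmas restrict_simps =
  curve_hom.substitute_add[of "curve_coordinate e d" for e d, folded restrict_to_curve_def]
  curve_hom.substitute_diff[of "curve_coordinate e d" for e d, folded restrict_to_curve_def]
  curve_hom.substitute_mult[of "curve_coordinate e d" for e d, folded restrict_to_curve_def]
  curve_hom.substitute_power[of "curve_coordinate e d" for e d, folded restrict_to_curve_def]
  curve_hom.substitute_zero[of "curve_coordinate e d" for e d, folded restrict_to_curve_def]

lemma pairing_sum_right: "pairing l (\<Sum>i\<in>A. x i) = (\<Sum>i\<in>A. pairing l (x i))"
proof (induction A rule: infinite_finite_induct)
  case (insert i A)
  then show ?case using pairing_add[of "x i" "\<Sum>i\<in>A. x i" l] by (simp add: pairing_commute)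
qed (simp_all add: pairing_def)

lemma pairing_scale_right: "pairing l (c *s x) = c * pairing l x"
  using pairing_scale[of c x l] by (simp add: pairing_commute)

lemma restrict_linear_form:
  fixes e :: "nat \<Rightarrow> 'a::field ^ 'v::finite"
  shows "restrict_to_curve e d (linear_form l) = (\<Sum>i\<le>d. monom (pairing l (e i)) i)"
proof -
  have "restrict_to_curve e d (linear_form l) = (\<Sum>v\<in>UNIV. \<Sum>i\<le>d. [:l $ v:] * monom (e i $ v) i)"
    unfolding restrict_to_curve_def linear_form_def curve_hom.substitute_sum curve_hom.substitute_mult
      curve_hom.substitute_const curve_hom.substitute_variable curve_coordinate_def sum_distrib_left ..
  also have "\<dots> = (\<Sum>i\<le>d. \<Sum>v\<in>UNIV. monom (l $ v * e i $ v) i)"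
    by (subst sum.swap) (simp add: smult_monom)
  also have "\<dots> = (\<Sum>i\<le>d. monom (pairing l (e i)) i)"
  proof -
    have "(\<Sum>v\<in>A. monom (f v) i) = monom (\<Sum>v\<in>A. f v) i" for A :: "'v set" and f :: "'v \<Rightarrow> 'a" and i
      by (induction A rule: infinite_finite_induct) (simp_all add: add_monom)
    then show ?thesis by (simp only: pairing_def)
  qed
  finally show ?thesis .
qed

lemma poly_restrict_linear_form:
  "poly (restrict_to_curve e d (linear_form l)) t = pairing l (curve_point e d t)"
  by (simp add: restrict_linear_form poly_sum poly_monom curve_point_def pairing_sum_right
      pairing_scale_right mult.commute)

lemma restrict_vanishing_order:
  assumes Q: "Q = c *s curve_point e d t" "Q \<noteq> 0" and f: "f \<in> ideal_power (point_ideal Q) k"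
  shows "[:- t, 1:] ^ k dvd restrict_to_curve e d f"
  using f
proof (induction k arbitrary: f)
  case (Suc k)
  from ideal_power_point_Suc[OF Q(2) Suc.prems] show ?case
  proof (induction rule: ideal.span_induct_alt)
    case base
    then show ?case by (simp add: restrict_simps)
  next
    case (step a x y)
    then obtain l g where x: "x = linear_form l * g" "pairing l Q = 0" "g \<in> ideal_power (point_ideal Q) k"
      by blast
    have "c \<noteq> 0" using Q by auto
    then have "poly (restrict_to_curve e d (linear_form l)) t = 0"
      using x(2) unfolding Q(1) pairing_scale_right by (simp add: poly_restrict_linear_form)
    then have "[:- t, 1:] dvd restrict_to_curve e d (linear_form l)" by (simp add: poly_eq_0_iff_dvd)
    from mult_dvd_mono[OF this Suc.IH[OF x(3)]]
    have "[:- t, 1:] ^ Suc k dvd restrict_to_curve e d a * (restrict_to_curve e d (linear_form l) * restrict_to_curve e d g)"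
      by (simp add: dvd_mult)
    then show ?case using step.IH unfolding x(1) restrict_simps by (rule dvd_add)
  qed
qed simp

section \<open>The chart at infinity\<close>

text \<open>
  This is \<open>T\<^sup>N p(1/T)\<close>, the change of chart for binary forms of degree \<open>N\<close>.
\<close>

definition reverse_poly :: "nat \<Rightarrow> 'a::field poly \<Rightarrow> 'a poly" where
  "reverse_poly N p = monom 1 (N - degree p) * reflect_poly p"

lemma coeff_reverse_poly:
  assumes "degree p \<le> N"
  shows "coeff (reverse_poly N p) i = (if i \<le> N then coeff p (N - i) else 0)"
  unfolding reverse_poly_def coeff_monom_mult coeff_reflect_poly
  using assms by (auto intro: coeff_eq_0)

lemma reverse_poly_add:
  "degree p \<le> N \<Longrightarrow> degree q \<le> N \<Longrightarrow> reverse_poly N (p + q) = reverse_poly N p + reverse_poly N q"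
  by (rule poly_eqI) (simp add: coeff_reverse_poly degree_add_le)

lemma reverse_poly_mult:
  assumes "degree p \<le> N" "degree q \<le> M"
  shows "reverse_poly (N + M) (p * q) = reverse_poly N p * reverse_poly M q"
proof (cases "p = 0 \<or> q = 0")
  case False
  then have "N + M - degree (p * q) = (N - degree p) + (M - degree q)"
    using assms by (simp add: degree_mult_eq)
  then have "monom (1::'a) (N + M - degree (p * q)) = monom 1 (N - degree p) * monom 1 (M - degree q)"
    by (simp add: mult_monom)
  then show ?thesis unfolding reverse_poly_def reflect_poly_mult by (simp add: ac_simps)
qed (auto simp: reverse_poly_def)

lemma reverse_poly_zero [simp]: "reverse_poly N 0 = 0"
  by (simp add: reverse_poly_def)

lemma restrict_reversed_curve:
  fixes e :: "nat \<Rightarrow> 'a::field ^ 'v::finite"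
  assumes "f \<in> forms j"
  shows "degree (restrict_to_curve e d f) \<le> j * d"
    and "restrict_to_curve (\<lambda>i. e (d - i)) d f = reverse_poly (j * d) (restrict_to_curve e d f)"
proof -
  define reversed where "reversed N p p' \<longleftrightarrow> degree p \<le> N \<and> p' = reverse_poly N p" for N and p p' :: "'a poly"
  have mult: "reversed (N + M) (p * q) (p' * q')" if "reversed N p p'" "reversed M q q'" for N M p q p' q'
    using that reverse_poly_mult[of p N q M] degree_mult_le[of p q] by (auto simp: reversed_def)
  have const: "reversed 0 [:c:] [:c:]" for c
    by (auto intro!: poly_eqI simp: reversed_def coeff_reverse_poly coeff_pCons split: nat.split)
  have one: "reversed 0 1 1" using const[of 1] by (simp add: one_pCons)
  have coordinate: "reversed d (curve_coordinate e d v) (curve_coordinate (\<lambda>i. e (d - i)) d v)" for v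
  proof -
    have coeff: "coeff (curve_coordinate e d v) i = (if i \<le> d then e i $ v else 0)" for e :: "nat \<Rightarrow> 'a ^ 'v" and i
      by (simp add: curve_coordinate_def coeff_sum)
    have "degree (curve_coordinate e d v) \<le> d" by (intro degree_le) (simp add: coeff)
    then show ?thesis
      unfolding reversed_def by (auto intro!: poly_eqI simp: coeff_reverse_poly coeff)
  qed
  have power: "reversed (d * k) (curve_coordinate e d v ^ k) (curve_coordinate (\<lambda>i. e (d - i)) d v ^ k)" for v k
    using mult[OF coordinate[of v]] by (induction k) (simp_all add: one)
  have "reversed (d * (\<Sum>v\<in>A. Poly_Mapping.lookup t v))
    (\<Prod>v\<in>A. curve_coordinate e d v ^ Poly_Mapping.lookup t v)
    (\<Prod>v\<in>A. curve_coordinate (\<lambda>i. e (d - i)) d v ^ Poly_Mapping.lookup t v)" for A t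
    using mult[OF power]
    by (induction A rule: infinite_finite_induct) (simp_all add: one distrib_left)
  then have mono: "reversed (d * exponent_degree t) (monomial_value (curve_coordinate e d) t)
    (monomial_value (curve_coordinate (\<lambda>i. e (d - i)) d) t)" for t
    by (simp add: exponent_degree_def monomial_value_def)
  have sum: "reversed N (\<Sum>x\<in>A. p x) (\<Sum>x\<in>A. p' x)"
    if "\<And>x. x \<in> A \<Longrightarrow> reversed N (p x) (p' x)" for N and A :: "('v \<Rightarrow>\<^sub>0 nat) set" and p p'
    using that
    by (induction A rule: infinite_finite_induct) (auto simp: reversed_def reverse_poly_add degree_add_le)
  have "reversed (j * d) (restrict_to_curve e d f) (restrict_to_curve (\<lambda>i. e (d - i)) d f)"
    unfolding restrict_to_curve_def substitute_def
  proof (rule sum)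
    fix t assume "t \<in> Poly_Mapping.keys f"
    then have "exponent_degree t = j" using assms by (simp add: forms_iff)
    then show "reversed (j * d) ([:Poly_Mapping.lookup f t:] * monomial_value (curve_coordinate e d) t)
      ([:Poly_Mapping.lookup f t:] * monomial_value (curve_coordinate (\<lambda>i. e (d - i)) d) t)"
      using mult[OF const[of "Poly_Mapping.lookup f t"] mono[of t]] by (simp only: add_0 mult.commute)
  qed
  then show "degree (restrict_to_curve e d f) \<le> j * d"
    "restrict_to_curve (\<lambda>i. e (d - i)) d f = reverse_poly (j * d) (restrict_to_curve e d f)"
    by (simp_all add: reversed_def)
qed

lemma degree_of_vanishing_at_infinity:
  assumes f: "f \<in> forms j" and "restrict_to_curve e d f \<noteq> 0"
    and "[:0, 1:] ^ k dvd restrict_to_curve (\<lambda>i. e (d - i)) d f"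
  shows "degree (restrict_to_curve e d f) + k \<le> j * d"
proof (rule ccontr)
  let ?p = "restrict_to_curve e d f"
  assume neg: "\<not> ?thesis"
  have deg: "degree ?p \<le> j * d" by (rule restrict_reversed_curve(1)[OF f])
  have "monom 1 k dvd reverse_poly (j * d) ?p"
    using assms(3) unfolding restrict_reversed_curve(2)[OF f] by (simp add: monom_altdef)
  then have "coeff (reverse_poly (j * d) ?p) (j * d - degree ?p) = 0"
    unfolding monom_1_dvd_iff' using neg deg by auto
  then have "coeff ?p (degree ?p) = 0" using deg by (simp add: coeff_reverse_poly)
  then show False using assms(2) by simp
qed

section \<open>Forms with prescribed order on the curve\<close>

lemma exists_dual_forms:
  fixes e :: "nat \<Rightarrow> 'a::field ^ 'v::finite"
  assumes "vec.independent (e ` {..d})" "inj_on e {..d}" "k \<le> d"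
  shows "\<exists>l. \<forall>i\<le>d. pairing l (e i) = (if i = k then 1 else 0)"
proof -
  have "e k \<notin> vec.span (e ` {..d} - {e k})"
    using assms(1,3) by (auto simp: vec.dependent_def)
  moreover have "e ` ({..d} - {k}) \<subseteq> e ` {..d} - {e k}"
    using assms(2,3) by (auto dest: inj_onD)
  ultimately have "e k \<notin> vec.span (e ` ({..d} - {k}))" using vec.span_mono by blast
  from exists_separating_form[OF this] show ?thesis by force
qed

text \<open>
  The witness is \<open>l0\<^sup>j\<^sup>-\<^sup>m\<^sup>+\<^sup>1 h\<^sup>m\<^sup>-\<^sup>1\<close>, where \<open>l0\<close> restricts to \<open>1\<close> and \<open>h\<close> to the local parameter \<open>T - t\<close>.
\<close>

lemma exists_form_of_exact_order:
  fixes e :: "nat \<Rightarrow> 'a::field ^ 'v::finite"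
  assumes e: "vec.independent (e ` {..d})" "inj_on e {..d}" "1 \<le> d"
    and Q: "Q = c *s curve_point e d t" "Q \<noteq> 0" and m: "1 \<le> m" "m - 1 \<le> j"
  shows "\<exists>G\<in>forms j. G \<in> ideal_power (point_ideal Q) (m - 1) \<and>
    (\<forall>F. F - G \<in> ideal_power (point_ideal Q) m \<longrightarrow> restrict_to_curve e d F \<noteq> 0)"
proof -
  obtain l0 l1 where l0: "\<And>i. i \<le> d \<Longrightarrow> pairing l0 (e i) = (if i = 0 then 1 else 0)"
    and l1: "\<And>i. i \<le> d \<Longrightarrow> pairing l1 (e i) = (if i = 1 then 1 else 0)"
    using exists_dual_forms[OF e(1,2), of 0] exists_dual_forms[OF e(1,2), of 1] e(3) by blast
  have r0: "restrict_to_curve e d (linear_form l0) = 1"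
  proof -
    have "(\<Sum>i\<le>d. monom (pairing l0 (e i)) i) = (\<Sum>i\<le>d. if i = 0 then 1 else 0)"
      by (intro sum.cong) (auto simp: l0)
    then show ?thesis by (simp add: restrict_linear_form)
  qed
  have r1: "restrict_to_curve e d (linear_form l1) = [:0, 1:]"
  proof -
    have "(\<Sum>i\<le>d. monom (pairing l1 (e i)) i) = (\<Sum>i\<le>d. if i = 1 then [:0, 1:] else 0)"
      by (intro sum.cong) (auto simp: l1 monom_altdef)
    then show ?thesis using e(3) by (simp add: restrict_linear_form)
  qed
  define h where "h = linear_form (l1 - t *s l0)"
  have h: "restrict_to_curve e d h = [:- t, 1:]"
  proof -
    have "restrict_to_curve e d (poly_const t * linear_form l0) = [:t:] * 1"
      using r0 by (simp add: restrict_to_curve_def curve_hom.substitute_mult curve_hom.substitute_const)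
    then show ?thesis unfolding h_def linear_form_diff linear_form_scale restrict_simps(2) by (simp add: r1)
  qed
  have hQ: "h \<in> point_ideal Q"
    unfolding h_def
  proof (rule form_in_point_ideal[OF linear_form_in_forms])
    have "pairing (l1 - t *s l0) (curve_point e d t) = 0"
      using h poly_restrict_linear_form[of e d "l1 - t *s l0" t] by (simp add: h_def)
    then show "poly_eval (linear_form (l1 - t *s l0)) Q = 0" by (simp add: Q pairing_scale_right)
  qed
  define G where "G = linear_form l0 ^ (j - (m - 1)) * h ^ (m - 1)"
  have "G \<in> forms (1 * (j - (m - 1)) + 1 * (m - 1))"
    unfolding G_def h_def by (intro forms_mult forms_power linear_form_in_forms)
  then have "G \<in> forms j" using m(2) by simp
  moreover have "G \<in> ideal_power (point_ideal Q) (m - 1)"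
    unfolding G_def by (intro ideal_power_absorb ideal_power_power hQ)
  moreover have "restrict_to_curve e d F \<noteq> 0" if F: "F - G \<in> ideal_power (point_ideal Q) m" for F
  proof
    assume zero: "restrict_to_curve e d F = 0"
    have rG: "restrict_to_curve e d G = [:- t, 1:] ^ (m - 1)"
      by (simp add: G_def restrict_simps r0 h)
    have "[:- t, 1:] ^ m dvd restrict_to_curve e d (F - G)"
      by (rule restrict_vanishing_order[OF Q F])
    then have "[:- t, 1:] ^ m dvd [:- t, 1:] ^ (m - 1)"
      unfolding restrict_simps(2) rG zero by simp
    from dvd_imp_degree_le[OF this] have "m \<le> m - 1" by (simp add: degree_linear_power)
    then show False using m(1) by simp
  qed
  ultimately show ?thesis by blast
qed

text \<open>
  Bezout for the curve of degree \<open>d\<close> and a hypersurface of degree \<open>j\<close>: the restriction is a nonzero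
  polynomial, its roots account for the points of the affine chart, and the drop of its degree
  below \<open>j d\<close> for the point at infinity.
\<close>

lemma sum_multiplicities_le:
  fixes e :: "nat \<Rightarrow> 'a::field ^ 'v::finite" and P :: "'i \<Rightarrow> 'a ^ 'v"
  assumes fin: "finite S" and f: "f \<in> forms j" "restrict_to_curve e d f \<noteq> 0"
    and P: "\<And>i. i \<in> S \<Longrightarrow> P i \<noteq> 0" "\<And>i. i \<in> S \<Longrightarrow> f \<in> ideal_power (point_ideal (P i)) (m i)"
    and distinct: "\<And>i k. i \<in> S \<Longrightarrow> k \<in> S \<Longrightarrow> i \<noteq> k \<Longrightarrow> P i \<notin> vec.span {P k}"
    and curve: "\<And>i. i \<in> S \<Longrightarrow> (\<exists>c t. P i = c *s curve_point e d t) \<or> (\<exists>c. P i = c *s e d)"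
  shows "(\<Sum>i\<in>S. m i) \<le> j * d"
proof -
  let ?p = "restrict_to_curve e d f"
  define A where "A = {i \<in> S. \<exists>c t. P i = c *s curve_point e d t}"
  have "\<forall>i\<in>A. \<exists>t. \<exists>c. P i = c *s curve_point e d t" by (auto simp: A_def)
  then obtain t where t: "\<And>i. i \<in> A \<Longrightarrow> \<exists>c. P i = c *s curve_point e d (t i)" by metis
  have multiple: "P i \<in> vec.span {P k}" if "P i = a *s x" "P k = b *s x" "P k \<noteq> 0" for i k a b x
  proof -
    have "b \<noteq> 0" using that by auto
    then have "P i = (a / b) *s P k" using that by simp
    then show ?thesis by (auto simp: vec.span_singleton)
  qed
  have inj: "inj_on t A"
  proof (rule inj_onI, rule ccontr)
    fix i k assume ik: "i \<in> A" "k \<in> A" "t i = t k" "i \<noteq> k"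
    obtain a b where "P i = a *s curve_point e d (t i)" "P k = b *s curve_point e d (t i)"
      using t[OF ik(1)] t[OF ik(2)] ik(3) by metis
    then show False using multiple distinct[of i k] P(1)[of k] ik by (auto simp: A_def)
  qed
  have "(\<Sum>i\<in>A. m i) \<le> (\<Sum>i\<in>A. order (t i) ?p)"
  proof (rule sum_mono)
    fix i assume i: "i \<in> A"
    then obtain c where "P i = c *s curve_point e d (t i)" using t by blast
    then have "[:- t i, 1:] ^ m i dvd ?p"
      using i by (intro restrict_vanishing_order[OF _ P(1) P(2)]) (auto simp: A_def)
    then show "m i \<le> order (t i) ?p" using f(2) by (simp add: order_divides)
  qed
  also have "\<dots> = (\<Sum>x\<in>t ` A. order x ?p)" by (simp add: sum.reindex[OF inj])
  also have "\<dots> \<le> (\<Sum>x\<in>t ` A \<union> {x. poly ?p x = 0}. order x ?p)"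
    using fin f(2) poly_roots_finite[of ?p] by (intro sum_mono2) (auto simp: A_def)
  also have "\<dots> = (\<Sum>x | poly ?p x = 0. order x ?p)"
    using fin f(2) poly_roots_finite[of ?p] by (intro sum.mono_neutral_right) (auto simp: A_def order_root)
  also have "\<dots> \<le> degree ?p" using f(2) by (rule sum_order_le_degree)
  finally have finite_part: "(\<Sum>i\<in>A. m i) \<le> degree ?p" .
  have infinite_part: "degree ?p + (\<Sum>i\<in>S - A. m i) \<le> j * d"
  proof (cases "S - A = {}")
    case True
    show ?thesis unfolding True using restrict_reversed_curve(1)[OF f(1), of e d] by simp
  next
    case False
    then obtain i where i: "i \<in> S" "i \<notin> A" by blast
    then obtain c where c: "P i = c *s e d" using curve[OF i(1)] by (auto simp: A_def)
    have "S - A = {i}"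
    proof (rule ccontr)
      assume "S - A \<noteq> {i}"
      then obtain k where k: "k \<in> S" "k \<notin> A" "k \<noteq> i" using i by blast
      then obtain b where "P k = b *s e d" using curve[OF k(1)] by (auto simp: A_def)
      then show False using multiple[OF c] distinct[OF i(1) k(1)] k P(1)[OF k(1)] by auto
    qed
    have "curve_point (\<lambda>i. e (d - i)) d 0 = e d"
    proof -
      have "curve_point (\<lambda>i. e (d - i)) d 0 = (\<Sum>i\<le>d. if i = 0 then e d else 0)"
        unfolding curve_point_def by (intro sum.cong) (auto simp: power_0_left)
      then show ?thesis by simp
    qed
    then have "[:- 0, 1:] ^ m i dvd restrict_to_curve (\<lambda>i. e (d - i)) d f"
      using c i(1) by (intro restrict_vanishing_order[OF _ P(1) P(2)]) auto
    then have "degree ?p + m i \<le> j * d"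
      using degree_of_vanishing_at_infinity[OF f, of "m i"] by simp
    then show ?thesis by (simp add: \<open>S - A = {i}\<close>)
  qed
  have "(\<Sum>i\<in>S. m i) = (\<Sum>i\<in>A. m i) + (\<Sum>i\<in>S - A. m i)"
    using fin by (subst sum.subset_diff[of A S]) (auto simp: A_def)
  then show ?thesis using finite_part infinite_part by linarith
qed


section \<open>The Segre bound\<close>

lemma segre_quotient_le_segre_bound:
  fixes P :: "nat \<Rightarrow> 'a::field ^ 'v::finite"
  assumes "vec.subspace U" "1 \<le> proj_dim U"
  shows "segre_quotient s P m U \<le> segre_bound s P m"
proof -
  define q where "q = (\<lambda>(w, n). \<lceil>(real w - 1) / real_of_int (int n - 1)\<rceil>)"
  let ?Q = "{segre_quotient s P m L |L. vec.subspace L \<and> proj_dim L \<ge> 1}"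
  have "?Q \<subseteq> q ` ({..\<Sum>i=1..s. m i} \<times> {..CARD('v)})"
  proof
    fix x assume "x \<in> ?Q"
    then obtain L where "x = segre_quotient s P m L" by blast
    then have "x = q (weight s P m L, vec.dim L)"
      by (simp add: q_def segre_quotient_def proj_dim_def)
    moreover have "weight s P m L \<le> (\<Sum>i=1..s. m i)"
      unfolding weight_def by (intro sum_mono2) auto
    moreover have "vec.dim L \<le> CARD('v)" by (rule dim_subset_UNIV_cart_gen)
    ultimately show "x \<in> q ` ({..\<Sum>i=1..s. m i} \<times> {..CARD('v)})" by blast
  qed
  then have "finite ?Q" by (rule finite_subset) simp
  then show ?thesis unfolding segre_bound_def using assms by (intro Max_ge) blast+
qed

lemma weight_le_segre_bound:
  fixes P :: "nat \<Rightarrow> 'a::field ^ 'v::finite"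
  assumes U: "vec.subspace U" "2 \<le> vec.dim U" and b: "segre_bound s P m \<le> int b"
  shows "weight s P m U \<le> b * (vec.dim U - 1) + 1"
proof -
  have "1 \<le> proj_dim U" using U(2) by (simp add: proj_dim_def)
  then have "segre_quotient s P m U \<le> int b"
    using segre_quotient_le_segre_bound[OF U(1), of s P m] b by simp
  then have "(real (weight s P m U) - 1) / real_of_int (proj_dim U) \<le> real b"
    unfolding segre_quotient_def by (simp add: ceiling_le_iff)
  moreover have "real_of_int (proj_dim U) = real (vec.dim U - 1)"
    using U(2) by (simp add: proj_dim_def of_nat_diff)
  ultimately have "real (weight s P m U) - 1 \<le> real b * real (vec.dim U - 1)"
    using U(2) by (simp add: divide_le_eq)
  then have "real (weight s P m U) \<le> real (b * (vec.dim U - 1) + 1)" by simp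
  then show ?thesis by (simp only: of_nat_le_iff)
qed

text \<open>
  Any line through \<open>P i\<close> has weight at least \<open>m i\<close>, and the Segre quotient of a line is its weight
  minus one.
\<close>

lemma multiplicity_le_segre_bound:
  fixes P :: "nat \<Rightarrow> 'a::field ^ 'v::finite"
  assumes card: "2 \<le> CARD('v)" and i: "i \<in> {1..s}" "P i \<noteq> 0"
  shows "int (m i) - 1 \<le> segre_bound s P m"
proof -
  have "vec.dim {P i} = 1" using i(2) by (simp add: vec.dim_insert vec.span_empty)
  have "vec.span {P i} \<noteq> UNIV"
  proof
    assume "vec.span {P i} = UNIV"
    then have "vec.dim (UNIV :: ('a ^ 'v) set) = 1"
      using \<open>vec.dim {P i} = 1\<close> by (metis vec.dim_span)
    then have "CARD('v) = 1" by (simp only: vec_dim_card)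
    then show False using card by simp
  qed
  then obtain x where x: "x \<notin> vec.span {P i}" by blast
  define U where "U = vec.span {x, P i}"
  have U: "vec.subspace U" "proj_dim U = 1"
    using x \<open>vec.dim {P i} = 1\<close> by (auto simp: U_def proj_dim_def vec.dim_insert)
  have "m i \<le> weight s P m U"
    unfolding weight_def using i(1) by (intro member_le_sum) (auto simp: U_def intro: vec.span_base)
  moreover have "segre_quotient s P m U = int (weight s P m U) - 1"
    unfolding segre_quotient_def U(2) by (simp add: ceiling_diff_one)
  ultimately show ?thesis using segre_quotient_le_segre_bound[of U s P m] U by simp
qed

lemma hilbert_function_at_segre_bound:
  fixes P :: "nat \<Rightarrow> 'a::field ^ 'v::finite"
  assumes card: "2 \<le> CARD('v)" and X: "fat_point_scheme s P m" and b: "segre_bound s P m = int b"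
  shows "hilbert_function (fat_ideal s P m) b = fat_degree s P m"
proof -
  have P: "P i \<noteq> 0" "1 \<le> m i" if "i \<in> {1..s}" for i
    using X that by (auto simp: fat_point_scheme_def)
  have distinct: "P i \<notin> vec.span {P k}" if "i \<in> {1..s}" "k \<in> {1..s}" "i \<noteq> k" for i k
    using X that by (auto simp: fat_point_scheme_def vec.span_singleton)
  have "hilbert_function (fat_ideal s P m) b = (\<Sum>i=1..s. card (exponents (m i - 1) :: ('v \<Rightarrow>\<^sub>0 nat) set))"
  proof (rule hilbert_function_if_congruences)
    show "P i \<noteq> 0 \<and> 1 \<le> m i \<and> m i - 1 \<le> b" if "i \<in> {1..s}" for i
      using P[OF that] multiplicity_le_segre_bound[OF card that, of P m] b by simp
    show "\<exists>f\<in>forms b. \<forall>i\<in>{1..s}. f - g i \<in> ideal_power (point_ideal (P i)) (m i)"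
      if "\<And>i. i \<in> {1..s} \<Longrightarrow> g i \<in> forms b" for g
    proof (rule simultaneous_congruences[OF _ P(1) distinct _ that])
      show "(\<Sum>i | i \<in> {1..s} \<and> P i \<in> U. m i) \<le> b * (vec.dim U - 1) + 1"
        if "vec.subspace U" "2 \<le> vec.dim U" for U
        using weight_le_segre_bound[OF that, of s P m b] b unfolding weight_def by simp
    qed auto
  qed
  then show ?thesis using fat_degree_eq[of s m P] P(2) by simp
qed

text \<open>
  Otherwise some form \<open>F\<close> of degree \<open>j\<close> would have order at least \<open>m k\<close> at each point except one
  point \<open>P i\<close> on the curve, where its restriction has order exactly \<open>m i - 1\<close> and hence is nonzero. This
  forces \<open>w\<^sub>L(X) - 1 \<le> j d\<close>, while \<open>j\<close> below the quotient of \<open>L\<close> means \<open>j d < w\<^sub>L(X) - 1\<close>.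
\<close>

lemma hilbert_function_below_curve_bound:
  fixes P :: "nat \<Rightarrow> 'a::field ^ 'v::finite"
  assumes card: "2 \<le> CARD('v)" and X: "fat_point_scheme s P m"
    and C: "rational_normal_curve L C" and on_curve: "\<forall>i\<in>{1..s}. P i \<in> L \<longrightarrow> P i \<in> C"
    and j: "int j < segre_quotient s P m L"
  shows "hilbert_function (fat_ideal s P m) j \<noteq> fat_degree s P m"
proof
  assume H: "hilbert_function (fat_ideal s P m) j = fat_degree s P m"
  have P: "P i \<noteq> 0" "1 \<le> m i" if "i \<in> {1..s}" for i
    using X that by (auto simp: fat_point_scheme_def)
  have distinct: "P i \<notin> vec.span {P k}" if "i \<in> {1..s}" "k \<in> {1..s}" "i \<noteq> k" for i k
    using X that by (auto simp: fat_point_scheme_def vec.span_singleton)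
  obtain d e where d: "1 \<le> d" "proj_dim L = int d"
    and e: "inj_on e {..d}" "vec.independent (e ` {..d})"
    and C_eq: "C = {k *s (\<Sum>i\<le>d. (a ^ (d - i) * b ^ i) *s e i) |k a b. k \<noteq> 0 \<and> (a, b) \<noteq> (0, 0)}"
    using C unfolding rational_normal_curve_def by blast
  define S where "S = {i \<in> {1..s}. P i \<in> L}"
  have finS: "finite S" by (simp add: S_def)
  have w: "weight s P m L = (\<Sum>i\<in>S. m i)" by (simp add: weight_def S_def)
  have jd: "j * d + 1 < (\<Sum>i\<in>S. m i)"
  proof -
    have "real j < (real (weight s P m L) - 1) / real d"
      using j d(2) unfolding segre_quotient_def by (simp add: less_ceiling_iff)
    then have "real j * real d < real (weight s P m L) - 1"
      using d(1) by (simp add: less_divide_eq)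
    then have "real (j * d + 1) < real (weight s P m L)" by simp
    then show ?thesis unfolding w by (simp only: of_nat_less_iff)
  qed
  have curve: "(\<exists>c t. P i = c *s curve_point e d t) \<or> (\<exists>c. P i = c *s e d)" if i: "i \<in> S" for i
  proof -
    obtain k a b where kab: "P i = k *s (\<Sum>i\<le>d. (a ^ (d - i) * b ^ i) *s e i)"
      using on_curve i unfolding S_def C_eq by blast
    show ?thesis
    proof (cases "a = 0")
      case True
      have "(\<Sum>i\<le>d. (a ^ (d - i) * b ^ i) *s e i) = (\<Sum>i\<le>d. if i = d then b ^ d *s e d else 0)"
        by (intro sum.cong) (auto simp: True power_0_left)
      then have "P i = (k * b ^ d) *s e d" by (simp add: kab)
      then show ?thesis by blast
    next
      case False
      have "(\<Sum>i\<le>d. (a ^ (d - i) * b ^ i) *s e i) = a ^ d *s curve_point e d (b / a)"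
        unfolding curve_point_def vec.scale_sum_right
        using False by (intro sum.cong) (auto simp: power_divide power_diff)
      then have "P i = (k * a ^ d) *s curve_point e d (b / a)" by (simp add: kab)
      then show ?thesis by blast
    qed
  qed
  have "S \<noteq> {}" using jd by auto
  then obtain i where i: "i \<in> S" by blast
  then have i_range: "i \<in> {1..s}" by (simp add: S_def)
  have "fat_degree s P m = (\<Sum>i=1..s. card (exponents (m i - 1) :: ('v \<Rightarrow>\<^sub>0 nat) set))"
    using fat_degree_eq P(2) by blast
  with H have H': "hilbert_function (fat_ideal s P m) j = (\<Sum>i=1..s. card (exponents (m i - 1) :: ('v \<Rightarrow>\<^sub>0 nat) set))"
    by simp
  have P': "P i \<noteq> 0 \<and> 1 \<le> m i" if "i \<in> {1..s}" for i using P[OF that] by blast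
  have mj: "m i - 1 \<le> j"
    by (rule congruences_if_hilbert_function(1)[of s P m, OF card P' H' i_range])
  have "\<exists>G\<in>forms j. G \<in> ideal_power (point_ideal (P i)) (m i - 1) \<and>
    (\<forall>F\<in>forms j. F - G \<in> ideal_power (point_ideal (P i)) (m i) \<longrightarrow> restrict_to_curve e d F \<noteq> 0)"
    using curve[OF i]
  proof
    assume "\<exists>c t. P i = c *s curve_point e d t"
    then show ?thesis
      using exists_form_of_exact_order[OF e(2,1) d(1) _ P(1)[OF i_range] P(2)[OF i_range] mj] by blast
  next
    assume "\<exists>c. P i = c *s e d"
    then obtain c where c: "P i = c *s e d" by blast
    let ?e = "\<lambda>i. e (d - i)"
    have "curve_point ?e d 0 = e d"
    proof -
      have "curve_point ?e d 0 = (\<Sum>i\<le>d. if i = 0 then e d else 0)"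
        unfolding curve_point_def by (intro sum.cong) (auto simp: power_0_left)
      then show ?thesis by simp
    qed
    then have c': "P i = c *s curve_point ?e d 0" using c by simp
    have "?e ` {..d} = e ` {..d}"
    proof -
      have "(\<lambda>i. d - i) ` {..d} = {..d}"
      proof
        show "{..d} \<subseteq> (\<lambda>i. d - i) ` {..d}"
        proof
          fix x assume "x \<in> {..d}"
          then have "x = d - (d - x)" "d - x \<in> {..d}" by auto
          then show "x \<in> (\<lambda>i. d - i) ` {..d}" by blast
        qed
      qed auto
      then show ?thesis by (metis image_image)
    qed
    then have ind: "vec.independent (?e ` {..d})" using e(2) by simp
    have inj: "inj_on ?e {..d}"
    proof (rule inj_onI)
      fix x y assume xy: "x \<in> {..d}" "y \<in> {..d}" "e (d - x) = e (d - y)"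
      then have "d - x = d - y" using e(1) by (auto dest: inj_onD)
      then show "x = y" using xy by auto
    qed
    obtain G where G: "G \<in> forms j" "G \<in> ideal_power (point_ideal (P i)) (m i - 1)"
      "\<And>F. F - G \<in> ideal_power (point_ideal (P i)) (m i) \<Longrightarrow> restrict_to_curve ?e d F \<noteq> 0"
      using exists_form_of_exact_order[OF ind inj d(1) c' P(1)[OF i_range] P(2)[OF i_range] mj] by blast
    have "restrict_to_curve e d F \<noteq> 0"
      if "F \<in> forms j" "F - G \<in> ideal_power (point_ideal (P i)) (m i)" for F
      using G(3)[OF that(2)] restrict_reversed_curve(2)[OF that(1), of e d] by auto
    then show ?thesis using G by blast
  qed
  then obtain G where G: "G \<in> forms j" "G \<in> ideal_power (point_ideal (P i)) (m i - 1)"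
    "\<And>F. F \<in> forms j \<Longrightarrow> F - G \<in> ideal_power (point_ideal (P i)) (m i) \<Longrightarrow> restrict_to_curve e d F \<noteq> 0"
    by blast
  obtain F where F: "F \<in> forms j"
    "\<And>k. k \<in> {1..s} \<Longrightarrow> F - (if k = i then G else 0) \<in> ideal_power (point_ideal (P k)) (m k)"
    using congruences_if_hilbert_function(2)[of s P m, OF card P' H' i_range G(1)] by blast
  define m' where "m' = m(i := m i - 1)"
  have "F \<in> ideal_power (point_ideal (P k)) (m' k)" if k: "k \<in> S" for k
  proof (cases "k = i")
    case True
    have "F - G \<in> ideal_power (point_ideal (P i)) (m i)" using F(2)[OF i_range] by simp
    then have "F - G \<in> ideal_power (point_ideal (P i)) (m i - 1)"
      using ideal_power_antimono[of "m i - 1" "m i"] by auto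
    from pv.subspace_add[OF ideal_power_pv_subspace this G(2)] show ?thesis by (simp add: True m'_def)
  next
    case False
    then show ?thesis using F(2)[of k] k by (simp add: S_def m'_def)
  qed
  moreover have "restrict_to_curve e d F \<noteq> 0" using G(3)[OF F(1)] F(2)[OF i_range] by simp
  ultimately have "(\<Sum>k\<in>S. m' k) \<le> j * d"
    using P(1) distinct by (intro sum_multiplicities_le[OF finS F(1) _ _ _ _ curve]) (auto simp: S_def)
  moreover have "(\<Sum>k\<in>S. m k) = (\<Sum>k\<in>S. m' k) + 1"
  proof -
    have "(\<Sum>k\<in>S. m k) = m i + (\<Sum>k\<in>S - {i}. m k)" using finS i by (rule sum.remove)
    moreover have "(\<Sum>k\<in>S. m' k) = (m i - 1) + (\<Sum>k\<in>S - {i}. m k)"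
      using finS i by (simp add: sum.remove m'_def)
    ultimately show ?thesis using P(2)[OF i_range] by simp
  qed
  ultimately show False using jd by simp
qed

theorem corollary5p5:
  fixes P :: "nat \<Rightarrow> 'a::field ^ 'v::finite"
    and m :: "nat \<Rightarrow> nat"
    and s :: nat
    and L C :: "('a ^ 'v) set"
  assumes "CARD('v) \<ge> 2"
    and "fat_point_scheme s P m"
    and "vec.subspace L" and "proj_dim L \<ge> 1"
    and "segre_bound s P m = segre_quotient s P m L"
    and "rational_normal_curve L C"
    and "\<forall>i\<in>{1..s}. P i \<in> L \<longrightarrow> P i \<in> C"
  shows "int (regularity_index s P m) = segre_bound s P m"
proof -
  have "1 \<in> {1..s}" "P 1 \<noteq> 0" "1 \<le> m 1"
    using assms(2) by (auto simp: fat_point_scheme_def)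
  then have "0 \<le> segre_bound s P m"
    using multiplicity_le_segre_bound[OF assms(1), of 1 s P m] by simp
  then obtain b where b: "segre_bound s P m = int b" using nonneg_int_cases by blast
  have "regularity_index s P m = b"
    unfolding regularity_index_def
  proof (rule Least_equality)
    show "hilbert_function (fat_ideal s P m) b = fat_degree s P m"
      by (rule hilbert_function_at_segre_bound[OF assms(1,2) b])
    show "b \<le> j" if "hilbert_function (fat_ideal s P m) j = fat_degree s P m" for j
      using hilbert_function_below_curve_bound[OF assms(1,2,6,7), of j] that assms(5) b by fastforce
  qed
  then show ?thesis using b by simp
qed

end
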